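(* Let $n\ge 1$ be an integer, $\mu>0$, $\sigma\in(0,2)$, $\gamma\in(0,1)$ and $p>1$. Put $\tilde\sigma:=\min\{\sigma,1\}$ and $$p_c:=1+\frac{2+(1-\gamma)(2-\tilde\sigma)}{\big[n-2+\gamma(2-\tilde\sigma)\big]_+}.$$ Assume that $(u_0,u_1)\in H^\sigma(\mathbb{R}^n)\times L^2(\mathbb{R}^n)$ satisfies $u_0\in L^1(\mathbb{R}^n)$, $u_1+\mu(-\Delta)^{\sigma/2}u_0\in L^1(\mathbb{R}^n)$ and $$\int_{\mathbb{R}^n}\big(u_1(x)+\mu(-\Delta)^{\sigma/2}u_0(x)\big)\,dx>0.$$ Suppose moreover that one of the following conditions holds: (i) $n\le [2-\gamma(2-\tilde\sigma)]$ (with any $\gamma\in(0,1)$ and any $p>1$); (ii) $p\in(1,p_c]$, and either $[2-\gamma(2-\tilde\sigma)]<n\le 2$ (with any $\gamma\in(0,1)$), or $n>2$ and $\gamma\in\big[\frac{n-2}{n},1\big)$; (iii) $p\in(1,\gamma^{-1})$, $n\ge 3$ and $\gamma\in\big(0,\frac{n-2}{n}\big)$. Then there is no global (in time) weak solution to the Cauchy problem $$\begin{cases}u_{tt}-\Delta u+\mu(-\Delta)^{\sigma/2}u_t=\displaystyle\int_0^t(t-s)^{-\gamma}|u(s)|^p\,ds, & x\in\mathbb{R}^n,\ t>0,\\ u(0,x)=u_0(x),\quad u_t(0,x)=u_1(x), & x\in\mathbb{R}^n.\end{cases}$$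
   Context: Notation: for $r\in\mathbb{R}$, $[r]_+:=\max\{r,0\}$ is the positive part and $[r]:=\max\{k\in\mathbb{Z}: k\le r\}$ is the integer part. For $s\in(0,1)$, $(-\Delta)^s$ is the fractional Laplacian, given on $H^{2s}(\mathbb{R}^n)$ by the Fourier multiplier $|\xi|^{2s}$ (equivalently, for suitable $v$, $(-\Delta)^s v(x)=C_{n,s}\,\mathrm{p.v.}\int_{\mathbb{R}^n}\frac{v(x)-v(y)}{|x-y|^{n+2s}}\,dy$ with $C_{n,s}=\frac{4^s\Gamma(\frac n2+s)}{\pi^{n/2}|\Gamma(-s)|}$). For $\alpha\in(0,1)$ the left-sided Riemann-Liouville fractional integral is $I^\alpha_{0|t}f(t):=\frac1{\Gamma(\alpha)}\int_0^t(t-s)^{-(1-\alpha)}f(s)\,ds$, where $\Gamma$ is the Euler gamma function. Weak solution: let $p>1$, $T>0$, $(u_0,u_1)\in H^\sigma(\mathbb{R}^n)\times L^2(\mathbb{R}^n)$ and $\alpha:=1-\gamma$. A function $u$ is a weak solution of the Cauchy problem on $[0,T)$ if $$u\in L^p((0,T),L^{2p}(\mathbb{R}^n))\cap L^1((0,T),L^2(\mathbb{R}^n))$$ and $$\begin{aligned}&\Gamma(\alpha)\int_0^T\int_{\mathbb{R}^n}I^\alpha_{0|t}(|u(t,x)|^p)\,\varphi(t,x)\,dx\,dt+\int_{\mathbb{R}^n}u_1(x)\varphi(0,x)\,dx-\int_{\mathbb{R}^n}u_0(x)\varphi_t(0,x)\,dx\\&\quad+\mu\int_{\mathbb{R}^n}(-\Delta)^{\sigma/2}u_0(x)\,\varphi(0,x)\,dx\\&=\int_0^T\int_{\mathbb{R}^n}u(t,x)\varphi_{tt}(t,x)\,dx\,dt-\int_0^T\int_{\mathbb{R}^n}u(t,x)\Delta\varphi(t,x)\,dx\,dt-\mu\int_0^T\int_{\mathbb{R}^n}u(t,x)(-\Delta)^{\sigma/2}\varphi_t(t,x)\,dx\,dt\end{aligned}$$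 holds for every test function $\varphi\in C([0,T];H^2(\mathbb{R}^n))\cap C^1([0,T];H^\sigma(\mathbb{R}^n))\cap C^2([0,T];L^2(\mathbb{R}^n))$ such that $\varphi(T,x)=0$ and $\varphi_t(T,x)=0$ for all $x\in\mathbb{R}^n$. A global weak solution is a function $u$ that is a weak solution on $[0,T)$ for every $T>0$. *)

theory Defs
  imports "HOL-Analysis.Analysis"
begin

section \<open>Lebesgue spaces\<close>

text \<open>
  Elements of L^q are real-valued and represented by Borel functions; every class of a.e. equal
  Lebesgue measurable functions contains one. The norms and integrals below depend on representatives
  only up to null sets.
\<close>

definition Lspace :: "real \<Rightarrow> ('a::euclidean_space \<Rightarrow> real) set" where
  "Lspace q = {f. f \<in> borel_measurable lborel \<and> integrable lborel (\<lambda>x. \<bar>f x\<bar> powr q)}"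

definition Lnorm :: "real \<Rightarrow> ('a::euclidean_space \<Rightarrow> real) \<Rightarrow> real" where
  "Lnorm q f = (LINT x|lborel. \<bar>f x\<bar> powr q) powr (1 / q)"

text \<open>
  The Bochner space L^r((0,T), L^q) for finite q: a strongly measurable curve in L^q is the same as
  (the class of) a jointly measurable function on (0,T) x R^n with sections in L^q.
\<close>

definition Lcurve :: "real \<Rightarrow> real \<Rightarrow> real \<Rightarrow> (real \<Rightarrow> 'a::euclidean_space \<Rightarrow> real) set" where
  "Lcurve T r q = {u.
     (\<lambda>(t, x). u t x) \<in> borel_measurable (restrict_space (lborel \<Otimes>\<^sub>M lborel) ({0<..<T} \<times> UNIV)) \<and>
     (AE t in lborel. t \<in> {0<..<T} \<longrightarrow> u t \<in> Lspace q) \<and>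
     set_integrable lborel {0<..<T} (\<lambda>t. Lnorm q (u t) powr r)}"

section \<open>Fourier transform, Sobolev spaces and fractional Laplacian\<close>

definition fourier_L1 :: "('a::euclidean_space \<Rightarrow> real) \<Rightarrow> 'a \<Rightarrow> complex" where
  "fourier_L1 f \<xi> =
     of_real ((2 * pi) powr (- real DIM('a) / 2)) * (LINT x|lborel. cis (- (x \<bullet> \<xi>)) * of_real (f x))"

text \<open>
  The Fourier-Plancherel transform on L^2, as the L^2 limit of the transforms of the truncations
  of f to balls (which are integrable). By Plancherel's theorem it exists for every f in L^2, and
  it is unique up to a null set.
\<close>

definition has_fourier_L2 :: "('a::euclidean_space \<Rightarrow> real) \<Rightarrow> ('a \<Rightarrow> complex) \<Rightarrow> bool" where
  "has_fourier_L2 f F \<longleftrightarrow>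
     f \<in> Lspace 2 \<and> F \<in> borel_measurable lborel \<and> integrable lborel (\<lambda>\<xi>. (cmod (F \<xi>))\<^sup>2) \<and>
     ((\<lambda>R. \<integral>\<^sup>+ \<xi>. ennreal ((cmod (F \<xi> - fourier_L1 (\<lambda>x. indicator (cball 0 R) x * f x) \<xi>))\<^sup>2) \<partial>lborel)
        \<longlongrightarrow> 0) (at_top :: real filter)"

definition fourier_L2 :: "('a::euclidean_space \<Rightarrow> real) \<Rightarrow> 'a \<Rightarrow> complex" where
  "fourier_L2 f = (SOME F. has_fourier_L2 f F)"

definition Hspace :: "real \<Rightarrow> ('a::euclidean_space \<Rightarrow> real) set" where
  "Hspace s = {f \<in> Lspace 2.
     integrable lborel (\<lambda>\<xi>. (1 + (norm \<xi>)\<^sup>2) powr s * (cmod (fourier_L2 f \<xi>))\<^sup>2)}"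

definition Hnorm :: "real \<Rightarrow> ('a::euclidean_space \<Rightarrow> real) \<Rightarrow> real" where
  "Hnorm s f = sqrt (LINT \<xi>|lborel. (1 + (norm \<xi>)\<^sup>2) powr s * (cmod (fourier_L2 f \<xi>))\<^sup>2)"

text \<open>
  The operator (-\<Delta>)^s on H^{2s} with multiplier |\<xi>|^{2s}. The result is a real-valued function,
  unique up to a null set; real-valuedness is no restriction, the multiplier being even.
\<close>

definition frac_laplacian :: "real \<Rightarrow> ('a::euclidean_space \<Rightarrow> real) \<Rightarrow> 'a \<Rightarrow> real" where
  "frac_laplacian s f = (SOME w. w \<in> Lspace 2 \<and>
     (AE \<xi> in lborel. fourier_L2 w \<xi> = of_real (norm \<xi> powr (2 * s)) * fourier_L2 f \<xi>))"

text \<open>The Laplacian on H^2, with multiplier -|\<xi>|^2.\<close>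

definition laplacian :: "('a::euclidean_space \<Rightarrow> real) \<Rightarrow> 'a \<Rightarrow> real" where
  "laplacian f = (\<lambda>x. - frac_laplacian 1 f x)"

section \<open>Continuously differentiable curves in function spaces\<close>

text \<open>
  The space X, with norm N, consists of functions up to null sets. Derivatives are norm limits of
  difference quotients within [0,T], hence one-sided at 0 and T.
\<close>

definition C0_curve ::
    "('a \<Rightarrow> real) set \<Rightarrow> (('a \<Rightarrow> real) \<Rightarrow> real) \<Rightarrow> real \<Rightarrow> (real \<Rightarrow> 'a \<Rightarrow> real) \<Rightarrow> bool" where
  "C0_curve X N T v \<longleftrightarrow> (\<forall>t\<in>{0..T}. v t \<in> X \<and>
     ((\<lambda>r. N (\<lambda>x. v r x - v t x)) \<longlongrightarrow> 0) (at t within {0..T}))"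

definition C1_curve ::
    "('a \<Rightarrow> real) set \<Rightarrow> (('a \<Rightarrow> real) \<Rightarrow> real) \<Rightarrow> real \<Rightarrow> (real \<Rightarrow> 'a \<Rightarrow> real) \<Rightarrow>
     (real \<Rightarrow> 'a \<Rightarrow> real) \<Rightarrow> bool" where
  "C1_curve X N T v v' \<longleftrightarrow> C0_curve X N T v \<and> C0_curve X N T v' \<and>
     (\<forall>t\<in>{0..T}. ((\<lambda>r. N (\<lambda>x. (v r x - v t x) / (r - t) - v' t x)) \<longlongrightarrow> 0) (at t within {0..T}))"

definition C2_curve ::
    "('a \<Rightarrow> real) set \<Rightarrow> (('a \<Rightarrow> real) \<Rightarrow> real) \<Rightarrow> real \<Rightarrow> (real \<Rightarrow> 'a \<Rightarrow> real) \<Rightarrow>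
     (real \<Rightarrow> 'a \<Rightarrow> real) \<Rightarrow> (real \<Rightarrow> 'a \<Rightarrow> real) \<Rightarrow> bool" where
  "C2_curve X N T v v' v'' \<longleftrightarrow> C1_curve X N T v v' \<and> C1_curve X N T v' v''"

section \<open>Weak solutions\<close>

definition RL_integral :: "real \<Rightarrow> (real \<Rightarrow> real) \<Rightarrow> real \<Rightarrow> real" where
  "RL_integral \<alpha> f t =
     1 / Gamma \<alpha> * (LINT s:{0<..<t}|lborel. (t - s) powr (- (1 - \<alpha>)) * f s)"

text \<open>A test function \<phi> together with its time derivatives \<phi>_t and \<phi>_tt.\<close>

definition test_function ::
    "real \<Rightarrow> real \<Rightarrow> (real \<Rightarrow> 'a::euclidean_space \<Rightarrow> real) \<Rightarrow> (real \<Rightarrow> 'a \<Rightarrow> real) \<Rightarrow>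
     (real \<Rightarrow> 'a \<Rightarrow> real) \<Rightarrow> bool" where
  "test_function \<sigma> T \<phi> \<phi>t \<phi>tt \<longleftrightarrow>
     C0_curve (Hspace 2) (Hnorm 2) T \<phi> \<and>
     C1_curve (Hspace \<sigma>) (Hnorm \<sigma>) T \<phi> \<phi>t \<and>
     C2_curve (Lspace 2) (Lnorm 2) T \<phi> \<phi>t \<phi>tt \<and>
     (\<forall>x. \<phi> T x = 0) \<and> (\<forall>x. \<phi>t T x = 0)"

text \<open>
  Weak solutions on [0,T) of
  u_tt - \<Delta> u + \<mu> (-\<Delta>)^{\<sigma>/2} u_t = \<integral>_0^t (t-s)^{-\<gamma>} |u(s)|^p ds, u(0) = u0, u_t(0) = u1.
\<close>

definition weak_solution ::
    "real \<Rightarrow> real \<Rightarrow> real \<Rightarrow> real \<Rightarrow> ('a::euclidean_space \<Rightarrow> real) \<Rightarrow> ('a \<Rightarrow> real) \<Rightarrow> real \<Rightarrow>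
     (real \<Rightarrow> 'a \<Rightarrow> real) \<Rightarrow> bool" where
  "weak_solution \<mu> \<sigma> \<gamma> p u0 u1 T u \<longleftrightarrow>
     u \<in> Lcurve T p (2 * p) \<and> u \<in> Lcurve T 1 2 \<and>
     (let \<alpha> = 1 - \<gamma> in
      \<forall>\<phi> \<phi>t \<phi>tt. test_function \<sigma> T \<phi> \<phi>t \<phi>tt \<longrightarrow>
        Gamma \<alpha> * (LINT t:{0<..<T}|lborel. LINT x|lborel.
                     RL_integral \<alpha> (\<lambda>s. \<bar>u s x\<bar> powr p) t * \<phi> t x)
        + (LINT x|lborel. u1 x * \<phi> 0 x)
        - (LINT x|lborel. u0 x * \<phi>t 0 x)
        + \<mu> * (LINT x|lborel. frac_laplacian (\<sigma> / 2) u0 x * \<phi> 0 x)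
        = (LINT t:{0<..<T}|lborel. LINT x|lborel. u t x * \<phi>tt t x)
        - (LINT t:{0<..<T}|lborel. LINT x|lborel. u t x * laplacian (\<phi> t) x)
        - \<mu> * (LINT t:{0<..<T}|lborel. LINT x|lborel. u t x * frac_laplacian (\<sigma> / 2) (\<phi>t t) x))"

definition global_weak_solution ::
    "real \<Rightarrow> real \<Rightarrow> real \<Rightarrow> real \<Rightarrow> ('a::euclidean_space \<Rightarrow> real) \<Rightarrow> ('a \<Rightarrow> real) \<Rightarrow>
     (real \<Rightarrow> 'a \<Rightarrow> real) \<Rightarrow> bool" where
  "global_weak_solution \<mu> \<sigma> \<gamma> p u0 u1 u \<longleftrightarrow> (\<forall>T>0. weak_solution \<mu> \<sigma> \<gamma> p u0 u1 T u)"

text \<open>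
  The critical exponent. When the positive part in the denominator vanishes it is to be read as
  infinity, which HOL division does not render; in that case n is at most the integer part
  of 2 - \<gamma> (2 - min \<sigma> 1), where no bound on p is imposed.
\<close>

definition p_crit :: "nat \<Rightarrow> real \<Rightarrow> real \<Rightarrow> real" where
  "p_crit n \<gamma> \<sigma> =
     1 + (2 + (1 - \<gamma>) * (2 - min \<sigma> 1)) / max (real n - 2 + \<gamma> * (2 - min \<sigma> 1)) 0"

end

theory Submission
  imports Defs "HOL-Probability.Characteristic_Functions"
begin

text \<open>
  The weak formulation is tested with \<open>(1 - t/T)^(k+2) \<Phi>(x/R)\<close>, where \<open>\<Phi> > 0\<close> is integrable and
  dominates \<open>|\<Delta>\<Phi>|\<close> and \<open>|(-\<Delta>)^(\<sigma>/2) \<Phi>|\<close>. A Beta integral moves the memory kernel onto the cut-off, so that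
  for \<open>A = \<integral>\<integral> |u|^p (1 - t/T)^(k+2+\<alpha>) \<Phi>(x/R)\<close>, \<open>\<alpha> = 1 - \<gamma>\<close>,
  \<open>T^\<alpha> A + (data) \<le> const (T^-2 + R^-2 + T^-1 R^-\<sigma>) \<integral>\<integral> |u| (1 - t/T)^k \<Phi>(x/R)\<close>.
  With \<open>R = T^\<kappa>\<close>, Young's inequality bounds A as \<open>T \<longrightarrow> \<infinity>\<close>; the choice of \<open>\<kappa>\<close> is where the conditions on p enter.
  Hence \<open>|u|^p\<close> is integrable over space-time. Now bound \<open>\<lambda> |u|\<close>, where \<open>\<lambda> \<longrightarrow> 0\<close> is the factor in front of the last integral
  divided by \<open>T^\<alpha>\<close>, by \<open>min (\<lambda> |u|) (c |u|^p)\<close> plus a Young remainder that is small for large c. The integral of the minimum tends to 0 by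
  dominated convergence, so \<open>A \<longrightarrow> 0\<close>, also in the critical case. Hence u vanishes, which contradicts the sign of the data.

  The operators of the weak formulation are only determined through the Plancherel transform. It suffices to have
  Bessel's inequality, which follows by Gaussian regularisation, and injectivity, which follows by testing with Gaussians.
  The function \<open>\<Phi>\<close> is a mixture of heat kernels, so that all operators act on the mixing density.
\<close>

section \<open>The Fourier transform of a Gaussian\<close>

text \<open>The obstacle is that the damping is nonlocal: \<open>(-\<Delta>)^(\<sigma>/2)\<close> of
  a compactly supported function or of a Gaussian generally decays only like |x|^(-n-\<sigma>), so
  it cannot be bounded by a multiple of the function itself. A mixture of heat kernels whose density
  decays like \<tau>^(-1-\<sigma>/2) has exactly this polynomial tail and stays explicit on the
  Fourier side.

  The exponents come from the Young remainder. It is \<lambda>^(p/(p-1)) times the volume T R^n of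
  the space-time cylinder, where up to constants \<lambda> = T^(-\<alpha>) (T^(-2) + R^(-2) + T^(-1)
  R^(-\<sigma>)). For R = T^\<kappa> it stays bounded exactly if 1 + \<kappa> n \<le> (\<alpha> + e)
  p/(p-1), where e is the smallest of 2, 2 \<kappa> and 1 + \<sigma> \<kappa>. The choice \<kappa> =
  1/(2 - min \<sigma> 1) turns this into the bound by the critical exponent, and \<kappa> close to 0
  turns it into p < 1/\<gamma>.\<close>

lemma gaussian_fourier_real:
  fixes t \<tau> :: real
  assumes "\<tau> > 0"
  shows "integrable lborel (\<lambda>y. cis (- (y * t)) * of_real (exp (- y\<^sup>2 / (4 * \<tau>))))"
    and "(LINT y|lborel. cis (- (y * t)) * of_real (exp (- y\<^sup>2 / (4 * \<tau>)))) =
      of_real (sqrt (4 * pi * \<tau>) * exp (- \<tau> * t\<^sup>2))"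
proof -
  \<comment> \<open>The substitution y = c x turns the Gaussian into a multiple of the standard
    normal density, whose Fourier transform is known as a characteristic function.\<close>
  define c where "c = sqrt (2 * \<tau>)"
  have c: "c > 0" "c\<^sup>2 = 2 * \<tau>" using assms by (auto simp: c_def)
  let ?g = "\<lambda>x. cis (- (c * t * x)) * of_real (std_normal_density x)"
  have gi: "integrable lborel ?g"
  proof (rule Bochner_Integration.integrable_bound[OF integrable_std_normal_moment[of 0]])
    show "AE x in lborel. norm (?g x) \<le> norm (std_normal_density x * x ^ 0)"
      by (simp add: norm_mult)
  qed (simp add: cis_conv_exp)
  have "(LINT x|lborel. ?g x) = char std_normal_distribution (- (c * t))"
    unfolding char_def
    by (subst integral_density) (auto simp: cis_conv_exp normal_density_nonneg scaleR_conv_of_real mult.commute algebra_simps)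
  then have gI: "(LINT x|lborel. ?g x) = of_real (exp (- \<tau> * t\<^sup>2))"
    using c by (simp add: char_std_normal_distribution power_mult_distrib)
  have eq: "(\<lambda>x. cis (- ((0 + c * x) * t)) * of_real (exp (- (0 + c * x)\<^sup>2 / (4 * \<tau>)))) =
      (\<lambda>x. of_real (sqrt (2 * pi)) * ?g x)"
  proof
    fix x :: real
    have "(c * x)\<^sup>2 / (4 * \<tau>) = x\<^sup>2 / 2"
      using assms by (simp add: power_mult_distrib c)
    then have "- (0 + c * x)\<^sup>2 / (4 * \<tau>) = - x\<^sup>2 / 2" by simp
    moreover have "(0 + c * x) * t = c * t * x" by simp
    ultimately show "cis (- ((0 + c * x) * t)) * of_real (exp (- (0 + c * x)\<^sup>2 / (4 * \<tau>))) = of_real (sqrt (2 * pi)) * ?g x"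
      by (simp only:) (simp add: std_normal_density_def mult.left_commute)
  qed
  have "integrable lborel (\<lambda>x. cis (- ((0 + c * x) * t)) * of_real (exp (- (0 + c * x)\<^sup>2 / (4 * \<tau>))))"
    unfolding eq using gi by (rule integrable_mult_right)
  then show "integrable lborel (\<lambda>y. cis (- (y * t)) * of_real (exp (- y\<^sup>2 / (4 * \<tau>))))"
    using lborel_integrable_real_affine_iff[of c "\<lambda>y. cis (- (y * t)) * of_real (exp (- y\<^sup>2 / (4 * \<tau>)))" 0] c
    by simp
  have "(LINT y|lborel. cis (- (y * t)) * of_real (exp (- y\<^sup>2 / (4 * \<tau>)))) =
     \<bar>c\<bar> *\<^sub>R (LINT x|lborel. cis (- ((0 + c * x) * t)) * of_real (exp (- (0 + c * x)\<^sup>2 / (4 * \<tau>))))"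
    using c by (intro lborel_integral_real_affine) auto
  also have "\<dots> = c *\<^sub>R (of_real (sqrt (2 * pi)) * of_real (exp (- \<tau> * t\<^sup>2)))"
    unfolding eq using c by (simp only: integral_mult_right_zero gI abs_of_pos)
  also have "c * sqrt (2 * pi) = sqrt (4 * pi * \<tau>)"
    unfolding c_def real_sqrt_mult[symmetric] by (simp add: mult_ac)
  then have "c *\<^sub>R (of_real (sqrt (2 * pi)) * of_real (exp (- \<tau> * t\<^sup>2))) = (of_real (sqrt (4 * pi * \<tau>) * exp (- \<tau> * t\<^sup>2)) :: complex)"
    unfolding scaleR_conv_of_real of_real_mult[symmetric] by (simp only: mult.assoc[symmetric])
  finally show "(LINT y|lborel. cis (- (y * t)) * of_real (exp (- y\<^sup>2 / (4 * \<tau>)))) =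
      of_real (sqrt (4 * pi * \<tau>) * exp (- \<tau> * t\<^sup>2))" .
qed

lemma cis_sum: "finite A \<Longrightarrow> cis (\<Sum>i\<in>A. f i) = (\<Prod>i\<in>A. cis (f i))"
  by (induction A rule: finite_induct) (auto simp: cis_mult[symmetric])

text \<open>Lebesgue measure is the image of the product measure over \<open>Basis\<close>, and both
  the phase and the Gaussian factor along the basis, so the integral is a product of one-dimensional
  ones.\<close>

lemma gaussian_fourier:
  fixes \<xi> :: "'a::euclidean_space"
  assumes "\<tau> > 0"
  shows "integrable lborel (\<lambda>x::'a. cis (- (x \<bullet> \<xi>)) * of_real (exp (- (norm x)\<^sup>2 / (4 * \<tau>))))"
    and "(LINT x|lborel. cis (- (x \<bullet> \<xi>)) * of_real (exp (- (norm x)\<^sup>2 / (4 * \<tau>)))) =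
      of_real ((4 * pi * \<tau>) powr (real DIM('a) / 2) * exp (- \<tau> * (norm \<xi>)\<^sup>2))"
proof -
  interpret product_sigma_finite "\<lambda>b::'a. lborel :: real measure" ..
  let ?F = "\<lambda>x::'a. cis (- (x \<bullet> \<xi>)) * of_real (exp (- (norm x)\<^sup>2 / (4 * \<tau>)))"
  let ?f = "\<lambda>b y. cis (- (y * (\<xi> \<bullet> b))) * of_real (exp (- y\<^sup>2 / (4 * \<tau>))) :: complex"
  let ?T = "\<lambda>f. \<Sum>b\<in>Basis. f b *\<^sub>R (b::'a)"
  have Fm: "?F \<in> borel_measurable borel"
    by (intro borel_measurable_continuous_onI continuous_intros continuous_on_cis) (use assms in auto)
  have Tm: "?T \<in> measurable (Pi\<^sub>M Basis (\<lambda>b. lborel)) borel" by measurable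
  have eq: "?F (?T f) = (\<Prod>b\<in>Basis. ?f b (f b))" for f
  proof -
    have 1: "?T f \<bullet> \<xi> = (\<Sum>b\<in>Basis. f b * (\<xi> \<bullet> b))"
      unfolding inner_sum_left inner_scaleR_left by (rule sum.cong) (simp_all add: inner_commute)
    have 2: "(norm (?T f))\<^sup>2 = (\<Sum>b\<in>Basis. (f b)\<^sup>2)"
      unfolding norm_eq_sqrt_inner
      by (subst euclidean_inner) (simp add: power2_eq_square sum_nonneg)
    show ?thesis
      unfolding 1 2 prod.distrib
      by (simp add: cis_sum[symmetric] sum_negf exp_sum[symmetric] sum_divide_distrib flip: of_real_prod)
  qed
  have i: "integrable lborel (?f b)" for b using gaussian_fourier_real(1)[OF assms] .
  have "integrable (Pi\<^sub>M Basis (\<lambda>b. lborel)) (\<lambda>f. ?F (?T f))"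
    unfolding eq by (intro product_integrable_prod i) auto
  then show "integrable lborel ?F"
    unfolding lborel_eq[where 'a='a] using integrable_distr_eq[OF Tm Fm] by simp
  have "(LINT x|lborel. ?F x) = (LINT f|Pi\<^sub>M Basis (\<lambda>b. lborel). ?F (?T f))"
    unfolding lborel_eq[where 'a='a] using integral_distr[OF Tm Fm] by simp
  also have "\<dots> = (\<Prod>b\<in>Basis. integral\<^sup>L lborel (?f b))"
    unfolding eq by (intro product_integral_prod i) auto
  also have "\<dots> = (\<Prod>b\<in>Basis. of_real (sqrt (4 * pi * \<tau>) * exp (- \<tau> * (\<xi> \<bullet> b)\<^sup>2)))"
    by (intro prod.cong refl gaussian_fourier_real(2)[OF assms])
  also have "\<dots> = of_real (\<Prod>b\<in>(Basis::'a set). sqrt (4 * pi * \<tau>) * exp (- \<tau> * (\<xi> \<bullet> b)\<^sup>2))"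
    by simp
  also have "(\<Prod>b\<in>(Basis::'a set). sqrt (4 * pi * \<tau>) * exp (- \<tau> * (\<xi> \<bullet> b)\<^sup>2)) =
     sqrt (4 * pi * \<tau>) ^ DIM('a) * exp (\<Sum>b\<in>Basis. - \<tau> * (\<xi> \<bullet> b)\<^sup>2)"
    by (simp add: prod.distrib exp_sum)
  also have "(\<Sum>b\<in>Basis. - \<tau> * (\<xi> \<bullet> b)\<^sup>2) = - \<tau> * (norm \<xi>)\<^sup>2"
    unfolding norm_eq_sqrt_inner
    by (subst (2) euclidean_inner) (simp add: power2_eq_square sum_nonneg sum_distrib_left sum_negf)
  also have "sqrt (4 * pi * \<tau>) ^ DIM('a) = (4 * pi * \<tau>) powr (real DIM('a) / 2)"
    using assms by (simp add: powr_half_sqrt[symmetric] powr_powr flip: powr_realpow)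
  finally show "(LINT x|lborel. ?F x) =
      of_real ((4 * pi * \<tau>) powr (real DIM('a) / 2) * exp (- \<tau> * (norm \<xi>)\<^sup>2))" .
qed

section \<open>Bessel's inequality\<close>

lemma borel_measurable_cis [measurable (raw)]:
  "f \<in> borel_measurable M \<Longrightarrow> (\<lambda>x. cis (f x)) \<in> borel_measurable M"
  by (simp add: cis_conv_exp)

lemma integrable_pair_mult:
  fixes f :: "'a \<Rightarrow> 'c::{real_normed_field, banach, second_countable_topology}"
  assumes "sigma_finite_measure M" "sigma_finite_measure N"
    and f: "integrable M f" and g: "integrable N g"
  shows "integrable (M \<Otimes>\<^sub>M N) (\<lambda>(x, y). f x * g y)"
proof -
  interpret pair_sigma_finite M N using assms by (simp add: pair_sigma_finite_def)
  have [measurable]: "f \<in> borel_measurable M" "g \<in> borel_measurable N" using f g by auto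
  show ?thesis
  proof (rule Fubini_integrable)
    show "integrable M (\<lambda>x. \<integral>y. norm (case (x, y) of (x, y) \<Rightarrow> f x * g y) \<partial>N)"
      using f by (simp add: norm_mult)
    show "AE x in M. integrable N (\<lambda>y. case (x, y) of (x, y) \<Rightarrow> f x * g y)"
      using g by simp
  qed measurable
qed

lemma fourier_L1_measurable [measurable]:
  assumes [measurable]: "f \<in> borel_measurable lborel"
  shows "fourier_L1 f \<in> borel_measurable borel"
  unfolding fourier_L1_def by measurable

lemma integrable_cis_mult:
  fixes f :: "'a::euclidean_space \<Rightarrow> real"
  assumes "integrable lborel f"
  shows "integrable lborel (\<lambda>x. cis (- (x \<bullet> \<xi>)) * complex_of_real (f x))"
proof (rule Bochner_Integration.integrable_bound[OF assms])
  have [measurable]: "f \<in> borel_measurable lborel" using assms by simp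
  show "(\<lambda>x. cis (- (x \<bullet> \<xi>)) * complex_of_real (f x)) \<in> borel_measurable lborel"
    by measurable
qed (simp add: norm_mult)

lemma nn_integral_lborel_translate:
  fixes k :: "'a::euclidean_space \<Rightarrow> ennreal"
  assumes [measurable]: "k \<in> borel_measurable borel"
  shows "(\<integral>\<^sup>+x. k (x - y) \<partial>lborel) = (\<integral>\<^sup>+x. k x \<partial>lborel)"
  by (subst lborel_distr_plus[symmetric, of y], subst nn_integral_distr) auto

text \<open>Writing the squared modulus as a double integral and integrating over \<xi> first leaves
  the quadratic form of f with a Gaussian kernel \<open>k\<close>. Then |f(x) f(y)| \<le> (f(x)^2 +
  f(y)^2)/2 reduces everything to the mass of \<open>k\<close>, as in Schur's test.\<close>

lemma bessel_gaussian:
  fixes f :: "'a::euclidean_space \<Rightarrow> real"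
  assumes f1: "integrable lborel f" and f2: "integrable lborel (\<lambda>x. (f x)\<^sup>2)" and \<tau>: "\<tau> > 0"
  shows "(\<integral>\<^sup>+\<xi>. ennreal ((cmod (fourier_L1 f \<xi>))\<^sup>2 * exp (- (norm \<xi>)\<^sup>2 / (4 * \<tau>))) \<partial>lborel)
    \<le> (\<integral>\<^sup>+x. ennreal ((f x)\<^sup>2) \<partial>lborel)"
proof -
  have [measurable]: "f \<in> borel_measurable borel" using f1 by simp
  define c where "c = (2 * pi) powr (- real DIM('a) / 2)"
  define k where "k = (\<lambda>z::'a. exp (- \<tau> * (norm z)\<^sup>2))"
  define d where "d = (4 * pi * \<tau>) powr (real DIM('a) / 2)"
  have c0: "c > 0" and d0: "d > 0" using \<tau> by (auto simp: c_def d_def)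
  have km[measurable]: "k \<in> borel_measurable borel" unfolding k_def by measurable
  let ?e = "\<lambda>\<xi>::'a. complex_of_real (exp (- (norm \<xi>)\<^sup>2 / (4 * \<tau>)))"
  \<comment> \<open>The pair z carries the two copies of f; the second phase has the opposite sign
    because it stems from the complex conjugate.\<close>
  let ?H = "\<lambda>(\<xi>::'a) z. cis (- (fst z \<bullet> \<xi>)) * cis (snd z \<bullet> \<xi>) * of_real (f (fst z) * f (snd z)) * ?e \<xi>"
  have e_int: "integrable lborel ?e" using gaussian_fourier(1)[OF \<tau>, of 0] by simp
  have ff: "integrable (lborel \<Otimes>\<^sub>M lborel) (\<lambda>(x, y). f x * f y)"
    by (intro integrable_pair_mult f1) unfold_locales
  have Hint: "integrable (lborel \<Otimes>\<^sub>M lborel) (case_prod ?H)"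
  proof (rule Bochner_Integration.integrable_bound)
    show "integrable (lborel \<Otimes>\<^sub>M lborel) (\<lambda>(\<xi>::'a, z). ?e \<xi> * complex_of_real (f (fst z) * f (snd z)))"
    proof (intro integrable_pair_mult e_int)
      show "integrable lborel (\<lambda>z. complex_of_real (f (fst z) * f (snd z)))"
        using ff unfolding complex_of_real_integrable_eq lborel_prod case_prod_beta .
    qed unfold_locales
    show "AE x in lborel \<Otimes>\<^sub>M lborel. norm (case_prod ?H x) \<le> norm (case x of (\<xi>::'a, z) \<Rightarrow> ?e \<xi> * complex_of_real (f (fst z) * f (snd z)))"
      by (auto simp: norm_mult)
    have "case_prod ?H \<in> borel_measurable (borel \<Otimes>\<^sub>M (borel \<Otimes>\<^sub>M borel))"
      by measurable
    then show "case_prod ?H \<in> borel_measurable (lborel \<Otimes>\<^sub>M lborel)"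
      by (simp add: borel_prod lborel_prod)
  qed
  have sq: "complex_of_real ((cmod (fourier_L1 f \<xi>))\<^sup>2 * exp (- (norm \<xi>)\<^sup>2 / (4 * \<tau>))) = of_real (c\<^sup>2) * (LINT z|lborel. ?H \<xi> z)" for \<xi>
  proof -
    let ?a = "\<lambda>x. cis (- (x \<bullet> \<xi>)) * complex_of_real (f x)"
    let ?b = "\<lambda>x. cis (x \<bullet> \<xi>) * complex_of_real (f x)"
    let ?I = "LINT x|lborel. ?a x"
    have ai: "integrable lborel ?a" by (rule integrable_cis_mult[OF f1])
    have bi: "integrable lborel ?b" using integrable_cis_mult[OF f1, of "- \<xi>"] by simp
    have "cnj ?I = (LINT x|lborel. cnj (?a x))"
      by (rule Bochner_Integration.integral_cnj[symmetric])
    then have cnj: "cnj ?I = (LINT x|lborel. ?b x)" by (simp add: cis_cnj)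
    have "integrable (lborel \<Otimes>\<^sub>M lborel) (\<lambda>(x, y). ?a x * ?b y)"
      by (intro integrable_pair_mult ai bi) unfold_locales
    from lborel_pair.integral_fst[OF this]
    have "(LINT z|lborel. ?a (fst z) * ?b (snd z)) = (LINT x|lborel. LINT y|lborel. ?a x * ?b y)"
      unfolding lborel_prod case_prod_unfold by (rule sym)
    also have "\<dots> = ?I * cnj ?I" unfolding cnj by simp
    finally have *: "?I * cnj ?I = (LINT z|lborel. ?a (fst z) * ?b (snd z))" ..
    have "of_real (c\<^sup>2) * (LINT z|lborel. ?H \<xi> z) = of_real (c\<^sup>2) * ((LINT z|lborel. ?a (fst z) * ?b (snd z)) * ?e \<xi>)"
      by (subst integral_mult_left_zero[symmetric]) (simp add: mult_ac)
    also have "\<dots> = of_real (c\<^sup>2) * (of_real ((cmod ?I)\<^sup>2) * ?e \<xi>)"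
      unfolding *[symmetric] complex_norm_square by simp
    also have "\<dots> = of_real ((c * cmod ?I)\<^sup>2 * exp (- (norm \<xi>)\<^sup>2 / (4 * \<tau>)))"
      by (simp add: power_mult_distrib)
    also have "c * cmod ?I = cmod (fourier_L1 f \<xi>)"
      unfolding fourier_L1_def c_def[symmetric] using c0 by (simp add: norm_mult)
    finally show ?thesis ..
  qed
  have swap: "(LINT \<xi>|lborel. LINT z|lborel. ?H \<xi> z) = (LINT z|lborel. LINT \<xi>|lborel. ?H \<xi> z)"
    by (rule lborel_pair.Fubini_integral[symmetric, OF Hint])
  have inner: "(LINT \<xi>|lborel. ?H \<xi> z) = of_real (d * (f (fst z) * f (snd z) * k (fst z - snd z)))" for z
  proof -
    have "?H \<xi> z = of_real (f (fst z) * f (snd z)) * (cis (- (\<xi> \<bullet> (fst z - snd z))) * ?e \<xi>)" for \<xi>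
      by (simp add: cis_mult inner_diff_right inner_diff_left inner_commute algebra_simps)
    then have "(LINT \<xi>|lborel. ?H \<xi> z) = of_real (f (fst z) * f (snd z)) * of_real (d * k (fst z - snd z))"
      by (simp only: integral_mult_right_zero gaussian_fourier(2)[OF \<tau>] d_def k_def)
    then show ?thesis by (simp add: mult_ac)
  qed
  have Iint: "integrable lborel (\<lambda>\<xi>. complex_of_real ((cmod (fourier_L1 f \<xi>))\<^sup>2 * exp (- (norm \<xi>)\<^sup>2 / (4 * \<tau>))))"
    unfolding sq using lborel_pair.integrable_fst[OF Hint] by (rule integrable_mult_right)
  then have Iint': "integrable lborel (\<lambda>\<xi>. (cmod (fourier_L1 f \<xi>))\<^sup>2 * exp (- (norm \<xi>)\<^sup>2 / (4 * \<tau>)))"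
    by (simp only: complex_of_real_integrable_eq)
  let ?P = "\<lambda>z. f (fst z) * f (snd z) * k (fst z - snd z)"
  have "(LINT \<xi>|lborel. complex_of_real ((cmod (fourier_L1 f \<xi>))\<^sup>2 * exp (- (norm \<xi>)\<^sup>2 / (4 * \<tau>)))) = of_real (c\<^sup>2) * (LINT z|lborel. of_real (d * ?P z))"
    unfolding sq integral_mult_right_zero swap inner ..
  also have "\<dots> = of_real (c\<^sup>2 * (LINT z|lborel. d * ?P z))"
    unfolding integral_complex_of_real by simp
  finally have eqI: "(LINT \<xi>|lborel. (cmod (fourier_L1 f \<xi>))\<^sup>2 * exp (- (norm \<xi>)\<^sup>2 / (4 * \<tau>))) = c\<^sup>2 * d * (LINT z|lborel. ?P z)"
    unfolding integral_complex_of_real of_real_eq_iff by (simp only: integral_mult_right_zero mult.assoc)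
  have kint: "(\<integral>\<^sup>+z. ennreal (k z) \<partial>lborel) = ennreal ((pi / \<tau>) powr (real DIM('a) / 2))"
  proof -
    let ?s = "1 / (4 * \<tau>)"
    have s: "?s > 0" using \<tau> by simp
    have "integrable lborel (\<lambda>x::'a. complex_of_real (k x))"
      using gaussian_fourier(1)[OF s, of "0::'a"] \<tau> by (simp add: k_def mult.commute)
    then have 1: "integrable lborel k" by (simp only: complex_of_real_integrable_eq)
    have "(LINT x|lborel. complex_of_real (k x)) = of_real ((pi / \<tau>) powr (real DIM('a) / 2))"
      using gaussian_fourier(2)[OF s, of "0::'a"] \<tau> by (simp add: k_def mult.commute)
    then have 2: "integral\<^sup>L lborel k = (pi / \<tau>) powr (real DIM('a) / 2)"
      unfolding integral_complex_of_real of_real_eq_iff .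
    show ?thesis by (subst nn_integral_eq_integral[OF 1]) (auto simp: 2, simp add: k_def)
  qed
  have k_nonneg: "k z \<ge> 0" for z by (simp add: k_def)
  have ksym: "k (x - y) = k (y - x)" for x y by (simp add: k_def norm_minus_commute)
  have A: "(\<integral>\<^sup>+z. ennreal ((f (fst z))\<^sup>2 * k (fst z - snd z)) \<partial>(lborel \<Otimes>\<^sub>M lborel)) = (\<integral>\<^sup>+x. ennreal ((f x)\<^sup>2) \<partial>lborel) * ennreal ((pi / \<tau>) powr (real DIM('a) / 2))"
  proof -
    have "(\<integral>\<^sup>+z. ennreal ((f (fst z))\<^sup>2 * k (fst z - snd z)) \<partial>(lborel \<Otimes>\<^sub>M lborel)) = (\<integral>\<^sup>+x. \<integral>\<^sup>+y. ennreal ((f x)\<^sup>2 * k (x - y)) \<partial>lborel \<partial>lborel)"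
      by (subst lborel.nn_integral_fst[symmetric]) auto
    also have "\<dots> = (\<integral>\<^sup>+x. ennreal ((f x)\<^sup>2) * (\<integral>\<^sup>+y. ennreal (k (y - x)) \<partial>lborel) \<partial>lborel)"
      by (subst ksym) (simp add: ennreal_mult k_nonneg nn_integral_cmult)
    also have "\<dots> = (\<integral>\<^sup>+x. ennreal ((f x)\<^sup>2) * ennreal ((pi / \<tau>) powr (real DIM('a) / 2)) \<partial>lborel)"
      by (subst nn_integral_lborel_translate[of "\<lambda>z. ennreal (k z)"]) (auto simp: kint)
    finally show ?thesis by (simp add: nn_integral_multc)
  qed
  have B: "(\<integral>\<^sup>+z. ennreal ((f (snd z))\<^sup>2 * k (fst z - snd z)) \<partial>(lborel \<Otimes>\<^sub>M lborel)) = (\<integral>\<^sup>+x. ennreal ((f x)\<^sup>2) \<partial>lborel) * ennreal ((pi / \<tau>) powr (real DIM('a) / 2))"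
  proof -
    have "(\<integral>\<^sup>+z. ennreal ((f (snd z))\<^sup>2 * k (fst z - snd z)) \<partial>(lborel \<Otimes>\<^sub>M lborel)) = (\<integral>\<^sup>+y. \<integral>\<^sup>+x. ennreal ((f y)\<^sup>2 * k (x - y)) \<partial>lborel \<partial>lborel)"
      by (subst lborel_pair.nn_integral_snd[symmetric]) (auto simp: case_prod_beta)
    also have "\<dots> = (\<integral>\<^sup>+x. ennreal ((f x)\<^sup>2) * (\<integral>\<^sup>+y. ennreal (k (y - x)) \<partial>lborel) \<partial>lborel)"
      by (simp add: ennreal_mult k_nonneg nn_integral_cmult)
    also have "\<dots> = (\<integral>\<^sup>+x. ennreal ((f x)\<^sup>2) * ennreal ((pi / \<tau>) powr (real DIM('a) / 2)) \<partial>lborel)"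
      by (subst nn_integral_lborel_translate[of "\<lambda>z. ennreal (k z)"]) (auto simp: kint)
    finally show ?thesis by (simp add: nn_integral_multc)
  qed
  define N where "N = (\<integral>\<^sup>+x. ennreal ((f x)\<^sup>2) \<partial>lborel)"
  have "(\<integral>\<^sup>+\<xi>. ennreal ((cmod (fourier_L1 f \<xi>))\<^sup>2 * exp (- (norm \<xi>)\<^sup>2 / (4 * \<tau>))) \<partial>lborel) = ennreal (c\<^sup>2 * d * (LINT z|lborel. ?P z))"
    unfolding eqI[symmetric] by (rule nn_integral_eq_integral[OF Iint']) auto
  also have "\<dots> \<le> ennreal (c\<^sup>2 * d) * (\<integral>\<^sup>+z. ennreal (norm (?P z)) \<partial>lborel)"
  proof -
    \<comment> \<open>If \<open>?P\<close> were not integrable, its Bochner integral would be 0 by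
      convention, so the bound holds in both cases.\<close>
    have le: "ennreal (norm (LINT z|lborel. ?P z)) \<le> (\<integral>\<^sup>+z. ennreal (norm (?P z)) \<partial>lborel)"
    proof (cases "integrable lborel ?P")
      case True
      then show ?thesis by (rule integral_norm_bound_ennreal)
    next
      case False
      then show ?thesis by (simp add: not_integrable_integral_eq)
    qed
    have "c\<^sup>2 * d * (LINT z|lborel. ?P z) \<le> (c\<^sup>2 * d) * norm (LINT z|lborel. ?P z)"
      unfolding real_norm_def by (rule mult_left_mono[OF abs_ge_self mult_nonneg_nonneg[OF zero_le_power2 less_imp_le[OF d0]]])
    then have "ennreal (c\<^sup>2 * d * (LINT z|lborel. ?P z)) \<le> ennreal ((c\<^sup>2 * d) * norm (LINT z|lborel. ?P z))"
      by (rule ennreal_leI)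
    also have "\<dots> = ennreal (c\<^sup>2 * d) * ennreal (norm (LINT z|lborel. ?P z))"
      by (rule ennreal_mult[OF mult_nonneg_nonneg[OF zero_le_power2 less_imp_le[OF d0]] norm_ge_zero])
    also have "\<dots> \<le> ennreal (c\<^sup>2 * d) * (\<integral>\<^sup>+z. ennreal (norm (?P z)) \<partial>lborel)"
      by (intro mult_left_mono le) simp
    finally show ?thesis .
  qed
  also have "(\<integral>\<^sup>+z. ennreal (norm (?P z)) \<partial>lborel) \<le> (\<integral>\<^sup>+z. ennreal (1/2) * ennreal ((f (fst z))\<^sup>2 * k (fst z - snd z)) + ennreal (1/2) * ennreal ((f (snd z))\<^sup>2 * k (fst z - snd z)) \<partial>lborel)"
  proof (intro nn_integral_mono)
    fix z :: "'a \<times> 'a"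
    have "\<bar>f (fst z) * f (snd z)\<bar> \<le> 1/2 * (f (fst z))\<^sup>2 + 1/2 * (f (snd z))\<^sup>2"
      using sum_squares_bound[of "\<bar>f (fst z)\<bar>" "\<bar>f (snd z)\<bar>"] by (simp add: abs_mult)
    then have "\<bar>f (fst z) * f (snd z)\<bar> * k (fst z - snd z) \<le> (1/2 * (f (fst z))\<^sup>2 + 1/2 * (f (snd z))\<^sup>2) * k (fst z - snd z)"
      by (rule mult_right_mono[OF _ k_nonneg])
    then have "norm (?P z) \<le> 1/2 * ((f (fst z))\<^sup>2 * k (fst z - snd z)) + 1/2 * ((f (snd z))\<^sup>2 * k (fst z - snd z))"
      by (simp only: real_norm_def abs_mult abs_of_nonneg[OF k_nonneg] distrib_right mult.assoc)
    then show "ennreal (norm (?P z)) \<le> ennreal (1/2) * ennreal ((f (fst z))\<^sup>2 * k (fst z - snd z)) + ennreal (1/2) * ennreal ((f (snd z))\<^sup>2 * k (fst z - snd z))"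
      by (metis (no_types, lifting) ennreal_leI ennreal_mult ennreal_plus half_gt_zero_iff k_nonneg less_imp_le mult_nonneg_nonneg zero_le_power2 zero_less_one)
  qed
  also have "\<dots> = ennreal (1/2) * (N * ennreal ((pi / \<tau>) powr (real DIM('a) / 2))) + ennreal (1/2) * (N * ennreal ((pi / \<tau>) powr (real DIM('a) / 2)))"
    unfolding lborel_prod[symmetric] by (subst nn_integral_add) (auto simp: nn_integral_cmult A B N_def)
  also have "\<dots> = N * ennreal ((pi / \<tau>) powr (real DIM('a) / 2))"
    unfolding distrib_right[symmetric] ennreal_plus[of "1/2" "1/2", OF divide_nonneg_pos divide_nonneg_pos, OF zero_le_one zero_less_numeral zero_le_one zero_less_numeral, symmetric]
    by simp
  also have "ennreal (c\<^sup>2 * d) * (N * ennreal ((pi / \<tau>) powr (real DIM('a) / 2))) = N * ennreal (c\<^sup>2 * d * (pi / \<tau>) powr (real DIM('a) / 2))"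
    using d0 by (simp add: mult_ac ennreal_mult)
  \<comment> \<open>Here d (pi/\<tau>)^(n/2) = (2 pi)^n, which c^2 cancels: the bound has constant
    1, uniformly in \<tau>.\<close>
  also have "c\<^sup>2 * d * (pi / \<tau>) powr (real DIM('a) / 2) = 1"
  proof -
    have "d * (pi / \<tau>) powr (real DIM('a) / 2) = ((4 * pi * \<tau>) * (pi / \<tau>)) powr (real DIM('a) / 2)"
      unfolding d_def using \<tau> by (subst powr_mult) auto
    also have "(4 * pi * \<tau>) * (pi / \<tau>) = (2 * pi) powr 2"
      using \<tau> by (simp add: power2_eq_square powr_numeral)
    also have "((2 * pi) powr 2) powr (real DIM('a) / 2) = (2 * pi) powr (real DIM('a))"
      unfolding powr_powr by simp
    finally have 1: "d * (pi / \<tau>) powr (real DIM('a) / 2) = (2 * pi) powr (real DIM('a))" .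
    have "c\<^sup>2 = (2 * pi) powr (- real DIM('a))"
      unfolding c_def by (simp add: power2_eq_square flip: powr_add)
    then show ?thesis unfolding mult.assoc 1 by (simp flip: powr_add)
  qed
  finally show ?thesis by (simp add: N_def mult_left_mono)
qed

text \<open>The Gaussian weight with \<tau> = j + 1 tends to 1 while the bound on the weighted
  integrals does not depend on j, so Fatou's lemma removes the weight.\<close>

theorem bessel_inequality:
  fixes f :: "'a::euclidean_space \<Rightarrow> real"
  assumes f1: "integrable lborel f" and f2: "integrable lborel (\<lambda>x. (f x)\<^sup>2)"
  shows "(\<integral>\<^sup>+\<xi>. ennreal ((cmod (fourier_L1 f \<xi>))\<^sup>2) \<partial>lborel) \<le> (\<integral>\<^sup>+x. ennreal ((f x)\<^sup>2) \<partial>lborel)"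
proof -
  have [measurable]: "f \<in> borel_measurable borel" using f1 by simp
  let ?g = "\<lambda>j \<xi>. ennreal ((cmod (fourier_L1 f \<xi>))\<^sup>2 * exp (- (norm \<xi>)\<^sup>2 / (4 * real (Suc j))))"
  have "liminf (\<lambda>j. ?g j \<xi>) = ennreal ((cmod (fourier_L1 f \<xi>))\<^sup>2)" for \<xi>
  proof (intro lim_imp_Liminf trivial_limit_sequentially tendsto_ennrealI)
    have "(\<lambda>j. - (norm \<xi>)\<^sup>2 / 4 * inverse (real (Suc j))) \<longlonglongrightarrow> - (norm \<xi>)\<^sup>2 / 4 * 0"
      by (intro tendsto_mult[OF tendsto_const] LIMSEQ_inverse_real_of_nat)
    then have "(\<lambda>j. (cmod (fourier_L1 f \<xi>))\<^sup>2 * exp (- (norm \<xi>)\<^sup>2 / 4 * inverse (real (Suc j)))) \<longlonglongrightarrow> (cmod (fourier_L1 f \<xi>))\<^sup>2 * exp (- (norm \<xi>)\<^sup>2 / 4 * 0)"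
      by (rule tendsto_mult[OF tendsto_const tendsto_exp])
    then show "(\<lambda>j. (cmod (fourier_L1 f \<xi>))\<^sup>2 * exp (- (norm \<xi>)\<^sup>2 / (4 * real (Suc j)))) \<longlonglongrightarrow> (cmod (fourier_L1 f \<xi>))\<^sup>2"
      by (simp add: field_simps)
  qed
  then have "(\<integral>\<^sup>+\<xi>. ennreal ((cmod (fourier_L1 f \<xi>))\<^sup>2) \<partial>lborel) = (\<integral>\<^sup>+\<xi>. liminf (\<lambda>j. ?g j \<xi>) \<partial>lborel)"
    by simp
  also have "\<dots> \<le> liminf (\<lambda>j. \<integral>\<^sup>+\<xi>. ?g j \<xi> \<partial>lborel)"
    by (intro nn_integral_liminf) measurable
  also have "\<dots> \<le> liminf (\<lambda>j. \<integral>\<^sup>+x. ennreal ((f x)\<^sup>2) \<partial>lborel)"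
    by (intro Liminf_mono always_eventually allI bessel_gaussian f1 f2) auto
  finally show ?thesis by (simp add: Liminf_const)
qed

section \<open>The Fourier-Plancherel transform\<close>

lemma abs_powr_two [simp]: "\<bar>x\<bar> powr 2 = (x::real)\<^sup>2"
  by (cases "x = 0") (auto simp: powr_numeral)

lemma Lspace_2_iff: "f \<in> Lspace 2 \<longleftrightarrow> f \<in> borel_measurable borel \<and> integrable lborel (\<lambda>x. (f x)\<^sup>2)"
  by (simp add: Lspace_def)

lemma integrable_mult_L2:
  fixes f g :: "'a \<Rightarrow> real"
  assumes [measurable]: "f \<in> borel_measurable M" "g \<in> borel_measurable M"
    and "integrable M (\<lambda>x. (f x)\<^sup>2)" "integrable M (\<lambda>x. (g x)\<^sup>2)"
  shows "integrable M (\<lambda>x. f x * g x)"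
proof (rule Bochner_Integration.integrable_bound)
  show "integrable M (\<lambda>x. (f x)\<^sup>2 + (g x)\<^sup>2)" using assms by simp
  show "AE x in M. norm (f x * g x) \<le> norm ((f x)\<^sup>2 + (g x)\<^sup>2)"
  proof (intro always_eventually allI)
    fix x
    have "2 * (\<bar>f x\<bar> * \<bar>g x\<bar>) \<le> (f x)\<^sup>2 + (g x)\<^sup>2"
      using sum_squares_bound[of "\<bar>f x\<bar>" "\<bar>g x\<bar>"] by simp
    moreover have "0 \<le> \<bar>f x\<bar> * \<bar>g x\<bar>" by simp
    ultimately have "\<bar>f x\<bar> * \<bar>g x\<bar> \<le> (f x)\<^sup>2 + (g x)\<^sup>2" by linarith
    then show "norm (f x * g x) \<le> norm ((f x)\<^sup>2 + (g x)\<^sup>2)" by (simp add: abs_mult)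
  qed
qed measurable

lemma Lspace_2_cmult: "f \<in> Lspace 2 \<Longrightarrow> (\<lambda>x. c * f x) \<in> Lspace 2"
  by (auto simp: Lspace_2_iff power_mult_distrib)

lemma Lspace_2_diff:
  assumes "f \<in> Lspace 2" "g \<in> Lspace 2"
  shows "(\<lambda>x. f x - g x) \<in> Lspace 2"
proof -
  have [measurable]: "f \<in> borel_measurable borel" "g \<in> borel_measurable borel"
    and i: "integrable lborel (\<lambda>x. (f x)\<^sup>2)" "integrable lborel (\<lambda>x. (g x)\<^sup>2)"
    using assms by (auto simp: Lspace_2_iff)
  have "integrable lborel (\<lambda>x. f x * g x)" using i by (intro integrable_mult_L2) auto
  then have "integrable lborel (\<lambda>x. (f x)\<^sup>2 + (g x)\<^sup>2 - 2 * (f x * g x))" using i by simp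
  then show ?thesis by (simp add: Lspace_2_iff power2_diff mult.assoc)
qed

lemma indicator_power2 [simp]: "(indicator A x :: real)\<^sup>2 = indicator A x"
  by (simp add: indicator_def)

abbreviation trunc :: "real \<Rightarrow> ('a::euclidean_space \<Rightarrow> real) \<Rightarrow> 'a \<Rightarrow> real" where
  "trunc R f \<equiv> \<lambda>x. indicator (cball 0 R) x * f x"

lemma cball_measurable [measurable]: "cball a r \<in> sets borel"
  by simp

lemma trunc_measurable [measurable]:
  "f \<in> borel_measurable borel \<Longrightarrow> trunc R f \<in> borel_measurable borel"
  by (intro borel_measurable_times borel_measurable_indicator) auto

lemma integrable_indicator_cball_mult:
  fixes f :: "'a::euclidean_space \<Rightarrow> real"
  assumes "integrable lborel f"
  shows "integrable lborel (trunc R f)"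
  using integrable_mult_indicator[of "cball 0 R" lborel f] assms by simp

lemma trunc_L1:
  fixes f :: "'a::euclidean_space \<Rightarrow> real"
  assumes "f \<in> Lspace 2"
  shows "integrable lborel (trunc R f)"
proof -
  have [measurable]: "f \<in> borel_measurable borel" and f: "integrable lborel (\<lambda>x. (f x)\<^sup>2)"
    using assms by (auto simp: Lspace_2_iff)
  have "integrable lborel (\<lambda>x::'a. (indicator (cball 0 R) x :: real)\<^sup>2)"
    using emeasure_lborel_cball_finite[of "0::'a" R] by (simp add: integrable_real_indicator)
  then show ?thesis using f by (intro integrable_mult_L2) auto
qed

lemma trunc_L2:
  assumes "f \<in> Lspace 2"
  shows "integrable lborel (\<lambda>x. (trunc R f x)\<^sup>2)"
proof -
  have "integrable lborel (\<lambda>x. (f x)\<^sup>2)"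
    using assms by (auto simp: Lspace_2_iff)
  from integrable_indicator_cball_mult[OF this] show ?thesis
    by (simp add: power_mult_distrib)
qed

text \<open>The squared L^2 distance of f to its truncation. Through Bessel's inequality it controls
  how fast the transforms of the truncations converge.\<close>

definition tail2 :: "('a::euclidean_space \<Rightarrow> real) \<Rightarrow> real \<Rightarrow> ennreal" where
  "tail2 f R = (\<integral>\<^sup>+x. ennreal ((1 - indicator (cball 0 R) x) * (f x)\<^sup>2) \<partial>lborel)"

lemma tail2_tendsto_0:
  fixes f :: "'a::euclidean_space \<Rightarrow> real"
  assumes "f \<in> Lspace 2"
  shows "(tail2 f \<longlongrightarrow> 0) at_top"
proof -
  have [measurable]: "f \<in> borel_measurable borel" and f: "integrable lborel (\<lambda>x. (f x)\<^sup>2)"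
    using assms by (auto simp: Lspace_2_iff)
  let ?g = "\<lambda>R x. (1 - indicator (cball 0 R) x) * (f x)\<^sup>2"
  have lim: "((\<lambda>R. LINT x|lborel. ?g R x) \<longlongrightarrow> (LINT x::'a|lborel. 0)) at_top"
  proof (rule integral_dominated_convergence_at_top[where w = "\<lambda>x. (f x)\<^sup>2"])
    show "AE x in lborel. ((\<lambda>R. ?g R x) \<longlongrightarrow> 0) at_top"
    proof (rule AE_I2, rule tendsto_eventually)
      fix x :: 'a
      show "\<forall>\<^sub>F R in at_top. ?g R x = 0"
        using eventually_ge_at_top[of "norm x"] by eventually_elim (simp add: indicator_def)
    qed
    show "\<forall>\<^sub>F R in at_top. AE x in lborel. norm (?g R x) \<le> (f x)\<^sup>2"
      by (auto simp: indicator_def)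
  qed (use f in auto)
  have "tail2 f R = ennreal (LINT x|lborel. ?g R x)" for R
    unfolding tail2_def
  proof (rule nn_integral_eq_integral)
    show "integrable lborel (?g R)"
      by (rule Bochner_Integration.integrable_bound[OF f]) (auto simp: indicator_def)
  qed (auto simp: indicator_def)
  then have "tail2 f = (\<lambda>R. ennreal (LINT x|lborel. ?g R x))" by blast
  then show ?thesis using tendsto_ennrealI[OF lim] by simp
qed

lemma fourier_L1_diff:
  assumes "integrable lborel f" "integrable lborel g"
  shows "fourier_L1 (\<lambda>x. f x - g x) \<xi> = fourier_L1 f \<xi> - fourier_L1 g \<xi>"
proof -
  have "(LINT x|lborel. cis (- (x \<bullet> \<xi>)) * of_real (f x - g x)) =
      (LINT x|lborel. cis (- (x \<bullet> \<xi>)) * of_real (f x) - cis (- (x \<bullet> \<xi>)) * of_real (g x))"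
    by (simp add: algebra_simps)
  also have "\<dots> = (LINT x|lborel. cis (- (x \<bullet> \<xi>)) * of_real (f x)) - (LINT x|lborel. cis (- (x \<bullet> \<xi>)) * of_real (g x))"
    by (intro Bochner_Integration.integral_diff integrable_cis_mult assms)
  finally show ?thesis unfolding fourier_L1_def by (simp only: right_diff_distrib)
qed

lemma fourier_L1_cmult: "fourier_L1 (\<lambda>x. c * f x) \<xi> = of_real c * fourier_L1 f \<xi>"
proof -
  have "(LINT x|lborel. cis (- (x \<bullet> \<xi>)) * of_real (c * f x)) =
      (LINT x|lborel. of_real c * (cis (- (x \<bullet> \<xi>)) * of_real (f x)))"
    by (simp add: mult_ac)
  then show ?thesis unfolding fourier_L1_def by simp
qed

text \<open>The Cauchy property of the truncated transforms. The truncations differ only outside the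
  smaller ball; the sum of both tails spares a case distinction on which ball that is.\<close>

lemma bessel_diff_trunc:
  assumes "f \<in> Lspace 2"
  shows "(\<integral>\<^sup>+\<xi>. ennreal ((cmod (fourier_L1 (trunc R f) \<xi> - fourier_L1 (trunc R' f) \<xi>))\<^sup>2) \<partial>lborel)
    \<le> tail2 f R + tail2 f R'"
proof -
  have [measurable]: "f \<in> borel_measurable borel" using assms by (auto simp: Lspace_2_iff)
  let ?d = "\<lambda>x. trunc R f x - trunc R' f x"
  have d1: "integrable lborel ?d" using trunc_L1[OF assms] by (intro Bochner_Integration.integrable_diff)
  have "(\<lambda>x. trunc R f x) \<in> Lspace 2" for R
    using trunc_L2[OF assms, of R] by (simp add: Lspace_2_iff trunc_measurable)
  from Lspace_2_diff[OF this this]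
  have d2: "integrable lborel (\<lambda>x. (?d x)\<^sup>2)" by (simp add: Lspace_2_iff)
  have "(\<integral>\<^sup>+\<xi>. ennreal ((cmod (fourier_L1 (trunc R f) \<xi> - fourier_L1 (trunc R' f) \<xi>))\<^sup>2) \<partial>lborel) \<le> (\<integral>\<^sup>+x. ennreal ((?d x)\<^sup>2) \<partial>lborel)"
    using bessel_inequality[OF d1 d2] by (simp only: fourier_L1_diff[OF trunc_L1[OF assms] trunc_L1[OF assms]])
  also have "\<dots> \<le> (\<integral>\<^sup>+x. ennreal ((1 - indicator (cball 0 R) x) * (f x)\<^sup>2) + ennreal ((1 - indicator (cball 0 R') x) * (f x)\<^sup>2) \<partial>lborel)"
    by (intro nn_integral_mono) (auto simp: indicator_def)
  also have "\<dots> = tail2 f R + tail2 f R'"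
    unfolding tail2_def by (intro nn_integral_add) measurable
  finally show ?thesis .
qed

text \<open>Bessel's inequality applied to f minus its truncation. This is what makes the abstract
  transform computable: the test profiles are integrable, so their transform is an explicit
  integral.\<close>

lemma has_fourier_L2_L1:
  fixes f :: "'a::euclidean_space \<Rightarrow> real"
  assumes f1: "integrable lborel f" and f2: "f \<in> Lspace 2"
  shows "has_fourier_L2 f (fourier_L1 f)"
proof -
  have [measurable]: "f \<in> borel_measurable borel" and i: "integrable lborel (\<lambda>x. (f x)\<^sup>2)"
    using f2 by (auto simp: Lspace_2_iff)
  have "(\<integral>\<^sup>+\<xi>. ennreal ((cmod (fourier_L1 f \<xi>))\<^sup>2) \<partial>lborel) < \<infinity>"
    by (rule order.strict_trans1[OF bessel_inequality[OF f1 i]]) (use i in \<open>simp add: nn_integral_eq_integral\<close>)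
  then have int: "integrable lborel (\<lambda>\<xi>. (cmod (fourier_L1 f \<xi>))\<^sup>2)"
    by (intro integrableI_bounded) auto
  have le: "(\<integral>\<^sup>+\<xi>. ennreal ((cmod (fourier_L1 f \<xi> - fourier_L1 (trunc R f) \<xi>))\<^sup>2) \<partial>lborel) \<le> tail2 f R" for R
  proof -
    let ?d = "\<lambda>x. f x - trunc R f x"
    have d1: "integrable lborel ?d" using trunc_L1[OF f2] f1 by (intro Bochner_Integration.integrable_diff)
    have "(\<lambda>x. trunc R f x) \<in> Lspace 2"
      using trunc_L2[OF f2, of R] by (simp add: Lspace_2_iff trunc_measurable)
    from Lspace_2_diff[OF f2 this]
    have d2: "integrable lborel (\<lambda>x. (?d x)\<^sup>2)" by (simp add: Lspace_2_iff)
    have "(\<integral>\<^sup>+\<xi>. ennreal ((cmod (fourier_L1 f \<xi> - fourier_L1 (trunc R f) \<xi>))\<^sup>2) \<partial>lborel) \<le> (\<integral>\<^sup>+x. ennreal ((?d x)\<^sup>2) \<partial>lborel)"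
      using bessel_inequality[OF d1 d2] by (simp only: fourier_L1_diff[OF f1 trunc_L1[OF f2]])
    also have "\<dots> = tail2 f R"
      unfolding tail2_def by (intro nn_integral_cong) (auto simp: indicator_def)
    finally show ?thesis .
  qed
  have "((\<lambda>R. \<integral>\<^sup>+\<xi>. ennreal ((cmod (fourier_L1 f \<xi> - fourier_L1 (trunc R f) \<xi>))\<^sup>2) \<partial>lborel) \<longlongrightarrow> 0) at_top"
    by (rule tendsto_sandwich[OF _ _ tendsto_const tail2_tendsto_0[OF f2]]) (auto simp: le)
  then show ?thesis unfolding has_fourier_L2_def using f2 int by auto
qed

lemma cmod_add_sq_le: "(cmod (a + b))\<^sup>2 \<le> 2 * (cmod a)\<^sup>2 + 2 * (cmod b)\<^sup>2"
proof -
  have "(cmod (a + b))\<^sup>2 \<le> (cmod a + cmod b)\<^sup>2"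
    by (intro power_mono norm_triangle_ineq) simp
  also have "\<dots> \<le> 2 * (cmod a)\<^sup>2 + 2 * (cmod b)\<^sup>2"
    using sum_squares_bound[of "cmod a" "cmod b"] by (simp add: power2_sum)
  finally show ?thesis .
qed

lemma nn_integral_cmod_add_sq_le:
  fixes F G :: "'a \<Rightarrow> complex"
  assumes [measurable]: "F \<in> borel_measurable M" "G \<in> borel_measurable M"
  shows "(\<integral>\<^sup>+x. ennreal ((cmod (F x + G x))\<^sup>2) \<partial>M) \<le>
    2 * (\<integral>\<^sup>+x. ennreal ((cmod (F x))\<^sup>2) \<partial>M) + 2 * (\<integral>\<^sup>+x. ennreal ((cmod (G x))\<^sup>2) \<partial>M)"
proof -
  have "ennreal ((cmod (F x + G x))\<^sup>2) \<le> 2 * ennreal ((cmod (F x))\<^sup>2) + 2 * ennreal ((cmod (G x))\<^sup>2)" for x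
  proof -
    have "ennreal ((cmod (F x + G x))\<^sup>2) \<le> ennreal (2 * (cmod (F x))\<^sup>2 + 2 * (cmod (G x))\<^sup>2)"
      by (intro ennreal_leI cmod_add_sq_le)
    then show ?thesis by (simp add: ennreal_mult)
  qed
  then have "(\<integral>\<^sup>+x. ennreal ((cmod (F x + G x))\<^sup>2) \<partial>M) \<le> (\<integral>\<^sup>+x. 2 * ennreal ((cmod (F x))\<^sup>2) + 2 * ennreal ((cmod (G x))\<^sup>2) \<partial>M)"
    by (intro nn_integral_mono)
  also have "\<dots> = 2 * (\<integral>\<^sup>+x. ennreal ((cmod (F x))\<^sup>2) \<partial>M) + 2 * (\<integral>\<^sup>+x. ennreal ((cmod (G x))\<^sup>2) \<partial>M)"
    by (subst nn_integral_add) (auto simp: nn_integral_cmult)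
  finally show ?thesis .
qed

lemma has_fourier_L2_unique:
  fixes f :: "'a::euclidean_space \<Rightarrow> real"
  assumes F: "has_fourier_L2 f F" and G: "has_fourier_L2 f G"
  shows "AE \<xi> in lborel. F \<xi> = G \<xi>"
proof -
  have [measurable]: "F \<in> borel_measurable borel" "G \<in> borel_measurable borel" "f \<in> borel_measurable borel"
    using F G by (auto simp: has_fourier_L2_def Lspace_2_iff)
  let ?t = "\<lambda>R. fourier_L1 (trunc R f)"
  let ?a = "\<lambda>F R. \<integral>\<^sup>+\<xi>. ennreal ((cmod (F \<xi> - ?t R \<xi>))\<^sup>2) \<partial>lborel"
  let ?I = "\<integral>\<^sup>+\<xi>. ennreal ((cmod (F \<xi> - G \<xi>))\<^sup>2) \<partial>lborel"
  have tm [measurable]: "?t R \<in> borel_measurable borel" for R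
    using trunc_measurable[of f R] fourier_L1_measurable[of "trunc R f"] by simp
  have le: "?I \<le> 2 * ?a F R + 2 * ?a G R" for R
    using nn_integral_cmod_add_sq_le[of "\<lambda>\<xi>. F \<xi> - ?t R \<xi>" lborel "\<lambda>\<xi>. ?t R \<xi> - G \<xi>"]
    by (simp add: norm_minus_commute)
  have "((\<lambda>R. 2 * ?a F R + 2 * ?a G R) \<longlongrightarrow> 2 * 0 + 2 * 0) at_top"
    using F G unfolding has_fourier_L2_def
    by (intro tendsto_add ennreal_tendsto_cmult) auto
  then have "?I \<le> 2 * 0 + 2 * 0"
    by (intro tendsto_lowerbound[where F = at_top]) (auto intro!: always_eventually simp: le)
  then have "AE \<xi> in lborel. ennreal ((cmod (F \<xi> - G \<xi>))\<^sup>2) = 0"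
    by (subst nn_integral_0_iff_AE[symmetric]) auto
  then show ?thesis by eventually_elim simp
qed

text \<open>Each weighted square is at most the total sum B, so the increments are bounded by sqrt B
  2^(-j/2), a summable geometric sequence.\<close>

lemma convergent_if_summable_weighted_sq:
  fixes z :: "nat \<Rightarrow> complex"
  assumes "(\<Sum>j. ennreal (2 ^ j * (cmod (z (Suc j) - z j))\<^sup>2)) < \<infinity>"
  shows "convergent z"
proof -
  let ?d = "\<lambda>j. cmod (z (Suc j) - z j)"
  define g where "g = (\<lambda>j. ennreal (2 ^ j * (?d j)\<^sup>2))"
  obtain B where B: "B \<ge> 0" "suminf g = ennreal B"
    using assms unfolding infinity_ennreal_def less_top_ennreal g_def by blast
  have bd: "?d j \<le> sqrt B * (1 / sqrt 2) ^ j" for j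
  proof -
    have "sum g {j} \<le> suminf g" by (rule sum_le_suminf) auto
    then have "g j \<le> ennreal B" by (simp add: B)
    then have "ennreal (2 ^ j * (?d j)\<^sup>2) \<le> ennreal B" by (simp only: g_def)
    then have "2 ^ j * (?d j)\<^sup>2 \<le> B" using B(1) by simp
    then have "(?d j)\<^sup>2 \<le> B * (1 / 2) ^ j" by (simp add: field_simps)
    then have "?d j \<le> sqrt (B * (1 / 2) ^ j)" by (rule real_le_rsqrt)
    then show ?thesis by (simp add: real_sqrt_mult real_sqrt_power real_sqrt_divide)
  qed
  have "summable (\<lambda>j. sqrt B * (1 / sqrt 2) ^ j)"
    by (intro summable_mult summable_geometric) simp
  then have "summable (\<lambda>j. z (Suc j) - z j)"
    by (rule summable_comparison_test[rotated]) (use bd in auto)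
  then have "convergent (\<lambda>n. \<Sum>j<n. z (Suc j) - z j)"
    by (simp add: summable_iff_convergent)
  then have "convergent (\<lambda>n. (z n - z 0) + z 0)"
    unfolding sum_lessThan_telescope by (intro convergent_add convergent_const)
  then show ?thesis by simp
qed

text \<open>The completeness argument for L^2 done by hand: along sufficiently large radii the
  transforms of the truncations converge almost everywhere, and Fatou's lemma upgrades the pointwise
  limit to the L^2 limit. Without existence the choice in \<open>fourier_L2\<close> would carry no
  information.\<close>

lemma has_fourier_L2_exists:
  fixes f :: "'a::euclidean_space \<Rightarrow> real"
  assumes f: "f \<in> Lspace 2"
  shows "\<exists>F. has_fourier_L2 f F"
proof -
  have [measurable]: "f \<in> borel_measurable borel" using f by (auto simp: Lspace_2_iff)
  have "\<exists>R. tail2 f R \<le> ennreal ((1/4) ^ j)" for j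
  proof -
    have "\<forall>\<^sub>F R in at_top. tail2 f R < ennreal ((1/4) ^ j)"
      by (rule order_tendstoD[OF tail2_tendsto_0[OF f]]) simp
    then show ?thesis by (meson eventually_happens' less_imp_le trivial_limit_at_top_linorder)
  qed
  \<comment> \<open>The rate 4^(-j) beats the weight 2^j under which the squared increments are
    summed, leaving a geometric series.\<close>
  then obtain k where k: "tail2 f (k j) \<le> ennreal ((1/4) ^ j)" for j by metis
  let ?t = "\<lambda>R. fourier_L1 (trunc R f)"
  have tm [measurable]: "?t R \<in> borel_measurable borel" for R
    using trunc_measurable[of f R] fourier_L1_measurable[of "trunc R f"] by simp
  define F where "F = (\<lambda>\<xi>. lim (\<lambda>j. ?t (k j) \<xi>))"
  have [measurable]: "F \<in> borel_measurable borel"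
    unfolding F_def by (rule borel_measurable_lim_metric) measurable
  have "(\<integral>\<^sup>+\<xi>. (\<Sum>j. ennreal (2 ^ j * (cmod (?t (k (Suc j)) \<xi> - ?t (k j) \<xi>))\<^sup>2)) \<partial>lborel) =
      (\<Sum>j. \<integral>\<^sup>+\<xi>. ennreal (2 ^ j * (cmod (?t (k (Suc j)) \<xi> - ?t (k j) \<xi>))\<^sup>2) \<partial>lborel)"
    by (rule nn_integral_suminf) measurable
  also have "\<dots> \<le> (\<Sum>j. ennreal (2 * (1/2) ^ j))"
  proof (rule suminf_le)
    fix j
    have "(\<integral>\<^sup>+\<xi>. ennreal (2 ^ j * (cmod (?t (k (Suc j)) \<xi> - ?t (k j) \<xi>))\<^sup>2) \<partial>lborel) =
        ennreal (2 ^ j) * (\<integral>\<^sup>+\<xi>. ennreal ((cmod (?t (k (Suc j)) \<xi> - ?t (k j) \<xi>))\<^sup>2) \<partial>lborel)"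
      by (simp add: ennreal_mult nn_integral_cmult)
    also have "\<dots> \<le> ennreal (2 ^ j) * (tail2 f (k (Suc j)) + tail2 f (k j))"
      by (intro mult_left_mono bessel_diff_trunc f) simp
    also have "\<dots> \<le> ennreal (2 ^ j) * (ennreal ((1/4) ^ Suc j) + ennreal ((1/4) ^ j))"
      by (intro mult_left_mono add_mono k) simp
    also have "\<dots> = ennreal (2 ^ j * ((1/4) ^ Suc j + (1/4) ^ j))"
      by (subst ennreal_mult) (auto simp: ennreal_plus[symmetric] simp del: ennreal_plus)
    also have "\<dots> \<le> ennreal (2 * (1/2) ^ j)"
    proof (rule ennreal_leI)
      have "(2::real) ^ j * (1/4) ^ j = (1/2) ^ j" by (simp flip: power_mult_distrib)
      then have "(2::real) ^ j * ((1/4) ^ Suc j + (1/4) ^ j) = 5/4 * (1/2) ^ j"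
        unfolding power_Suc distrib_left mult.left_commute[of _ "1/4"] by simp
      then show "(2::real) ^ j * ((1/4) ^ Suc j + (1/4) ^ j) \<le> 2 * (1/2) ^ j" by (simp only: mult_right_mono) simp
    qed
    finally show "(\<integral>\<^sup>+\<xi>. ennreal (2 ^ j * (cmod (?t (k (Suc j)) \<xi> - ?t (k j) \<xi>))\<^sup>2) \<partial>lborel) \<le> ennreal (2 * (1/2) ^ j)" .
  qed auto
  also have "\<dots> < \<infinity>"
    by (subst suminf_ennreal2) (auto intro!: summable_mult summable_geometric)
  finally have "AE \<xi> in lborel. (\<Sum>j. ennreal (2 ^ j * (cmod (?t (k (Suc j)) \<xi> - ?t (k j) \<xi>))\<^sup>2)) \<noteq> \<infinity>"
    by (intro nn_integral_PInf_AE) auto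
  then have conv: "AE \<xi> in lborel. (\<lambda>j. ?t (k j) \<xi>) \<longlonglongrightarrow> F \<xi>"
  proof eventually_elim
    case (elim \<xi>)
    then have "convergent (\<lambda>j. ?t (k j) \<xi>)"
      by (intro convergent_if_summable_weighted_sq) (simp add: less_top)
    then show ?case unfolding F_def by (simp add: convergent_LIMSEQ_iff)
  qed
  \<comment> \<open>Fatou is applied in j with R fixed, so the estimate holds for every radius and
    yields the full limit R \<longrightarrow> \<infinity>, not only the limit along
    \<open>k\<close>.\<close>
  have le: "(\<integral>\<^sup>+\<xi>. ennreal ((cmod (F \<xi> - ?t R \<xi>))\<^sup>2) \<partial>lborel) \<le> tail2 f R" for R
  proof -
    have "(\<integral>\<^sup>+\<xi>. ennreal ((cmod (F \<xi> - ?t R \<xi>))\<^sup>2) \<partial>lborel) = (\<integral>\<^sup>+\<xi>. liminf (\<lambda>j. ennreal ((cmod (?t (k j) \<xi> - ?t R \<xi>))\<^sup>2)) \<partial>lborel)"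
    proof (rule nn_integral_cong_AE)
      show "AE \<xi> in lborel. ennreal ((cmod (F \<xi> - ?t R \<xi>))\<^sup>2) = liminf (\<lambda>j. ennreal ((cmod (?t (k j) \<xi> - ?t R \<xi>))\<^sup>2))"
        using conv
        by eventually_elim (intro lim_imp_Liminf[symmetric] trivial_limit_sequentially tendsto_ennrealI tendsto_power tendsto_norm tendsto_diff tendsto_const)
    qed
    also have "\<dots> \<le> liminf (\<lambda>j. \<integral>\<^sup>+\<xi>. ennreal ((cmod (?t (k j) \<xi> - ?t R \<xi>))\<^sup>2) \<partial>lborel)"
      by (rule nn_integral_liminf) measurable
    also have "\<dots> \<le> liminf (\<lambda>j. ennreal ((1/4) ^ j) + tail2 f R)"
      by (intro Liminf_mono always_eventually allI order_trans[OF bessel_diff_trunc[OF f]] add_mono k order_refl)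
    also have "\<dots> = tail2 f R"
    proof (rule lim_imp_Liminf)
      have "(\<lambda>j. ennreal ((1/4) ^ j)) \<longlonglongrightarrow> ennreal 0"
        by (intro tendsto_ennrealI LIMSEQ_realpow_zero) auto
      from tendsto_add[OF this tendsto_const, of "tail2 f R"]
      show "(\<lambda>j. ennreal ((1/4) ^ j) + tail2 f R) \<longlonglongrightarrow> tail2 f R" by simp
    qed simp
    finally show ?thesis .
  qed
  have "(\<integral>\<^sup>+\<xi>. ennreal ((cmod (F \<xi>))\<^sup>2) \<partial>lborel) < \<infinity>"
  proof -
    have 1: "(\<integral>\<^sup>+\<xi>. ennreal ((cmod (F \<xi> - ?t (k 0) \<xi>))\<^sup>2) \<partial>lborel) < \<infinity>"
      using order_trans[OF le k[of 0]] by (rule order.strict_trans1) simp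
    have "(\<integral>\<^sup>+x. ennreal ((trunc (k 0) f x)\<^sup>2) \<partial>lborel) < \<infinity>"
      using trunc_L2[OF f, of "k 0"] by (simp add: nn_integral_eq_integral)
    then have 2: "(\<integral>\<^sup>+\<xi>. ennreal ((cmod (?t (k 0) \<xi>))\<^sup>2) \<partial>lborel) < \<infinity>"
      by (rule order.strict_trans1[OF bessel_inequality[OF trunc_L1[OF f] trunc_L2[OF f]]])
    have "(\<integral>\<^sup>+\<xi>. ennreal ((cmod (F \<xi>))\<^sup>2) \<partial>lborel) \<le> 2 * (\<integral>\<^sup>+\<xi>. ennreal ((cmod (F \<xi> - ?t (k 0) \<xi>))\<^sup>2) \<partial>lborel) + 2 * (\<integral>\<^sup>+\<xi>. ennreal ((cmod (?t (k 0) \<xi>))\<^sup>2) \<partial>lborel)"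
      using nn_integral_cmod_add_sq_le[of "\<lambda>\<xi>. F \<xi> - ?t (k 0) \<xi>" lborel "?t (k 0)"] by simp
    also have "\<dots> < \<infinity>" using 1 2 by (simp add: ennreal_mult_less_top)
    finally show ?thesis .
  qed
  then have int: "integrable lborel (\<lambda>\<xi>. (cmod (F \<xi>))\<^sup>2)"
    by (intro integrableI_bounded) auto
  have "((\<lambda>R. \<integral>\<^sup>+\<xi>. ennreal ((cmod (F \<xi> - ?t R \<xi>))\<^sup>2) \<partial>lborel) \<longlongrightarrow> 0) at_top"
    by (rule tendsto_sandwich[OF _ _ tendsto_const tail2_tendsto_0[OF f]]) (auto simp: le)
  then have "has_fourier_L2 f F" unfolding has_fourier_L2_def using f int by auto
  then show "\<exists>F. has_fourier_L2 f F" by blast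
qed

lemma has_fourier_L2_fourier_L2: "f \<in> Lspace 2 \<Longrightarrow> has_fourier_L2 f (fourier_L2 f)"
  unfolding fourier_L2_def by (rule someI_ex[OF has_fourier_L2_exists])

lemma fourier_L2_AE_eq:
  assumes "has_fourier_L2 f F"
  shows "AE \<xi> in lborel. fourier_L2 f \<xi> = F \<xi>"
proof (rule has_fourier_L2_unique[OF _ assms])
  show "has_fourier_L2 f (fourier_L2 f)"
    by (rule has_fourier_L2_fourier_L2) (use assms in \<open>simp add: has_fourier_L2_def\<close>)
qed

lemma fourier_L2_L1:
  assumes "integrable lborel f" "f \<in> Lspace 2"
  shows "AE \<xi> in lborel. fourier_L2 f \<xi> = fourier_L1 f \<xi>"
  by (rule fourier_L2_AE_eq[OF has_fourier_L2_L1[OF assms]])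

section \<open>Injectivity of the Fourier-Plancherel transform\<close>

lemma exp_gaussian_integrable:
  assumes "a > 0"
  shows "integrable lborel (\<lambda>x::'a::euclidean_space. exp (- a * (norm x)\<^sup>2))"
proof -
  have "integrable lborel (\<lambda>x::'a. complex_of_real (exp (- a * (norm x)\<^sup>2)))"
    using gaussian_fourier(1)[of "1 / (4 * a)" "0::'a"] assms by (simp add: mult.commute)
  then show ?thesis by (simp only: complex_of_real_integrable_eq)
qed

lemma
  fixes h :: "'a::euclidean_space \<Rightarrow> 'b::{banach, second_countable_topology}"
  assumes [measurable]: "h \<in> borel_measurable borel" and c: "c > 0"
  shows lborel_integral_affine: "(LINT y|lborel. h y) = c ^ DIM('a) *\<^sub>R (LINT z|lborel. h (t + c *\<^sub>R z))"
    and lborel_integrable_affine: "integrable lborel (\<lambda>z. h (t + c *\<^sub>R z)) \<longleftrightarrow> integrable lborel h"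
proof -
  have eq: "lborel = density (distr lborel borel (\<lambda>x. t + c *\<^sub>R x)) (\<lambda>_. ennreal (c ^ DIM('a)))"
    using lborel_affine[of c t] c by simp
  show "(LINT y|lborel. h y) = c ^ DIM('a) *\<^sub>R (LINT z|lborel. h (t + c *\<^sub>R z))"
    using c by (subst eq) (simp add: integral_density integral_distr)
  show "integrable lborel (\<lambda>z. h (t + c *\<^sub>R z)) \<longleftrightarrow> integrable lborel h"
  proof -
    have "integrable lborel h \<longleftrightarrow> integrable lborel (\<lambda>z. c ^ DIM('a) *\<^sub>R h (t + c *\<^sub>R z))"
      using c by (subst eq) (simp add: integrable_density integrable_distr_eq)
    also have "\<dots> \<longleftrightarrow> integrable lborel (\<lambda>z. h (t + c *\<^sub>R z))"
    proof
      assume "integrable lborel (\<lambda>z. c ^ DIM('a) *\<^sub>R h (t + c *\<^sub>R z))"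
      from integrable_scaleR_right[OF this, of "inverse (c ^ DIM('a))"]
      show "integrable lborel (\<lambda>z. h (t + c *\<^sub>R z))" using c by simp
    qed (rule integrable_scaleR_right)
    finally show ?thesis ..
  qed
qed

text \<open>A regularised inversion formula: Fubini moves the transform from g onto a modulated
  Gaussian, which gives Gaussian averages of g around y in place of its values.\<close>

lemma gaussian_integral_fourier_L1:
  fixes g :: "'a::euclidean_space \<Rightarrow> real"
  assumes g: "integrable lborel g" and \<tau>: "\<tau> > 0"
  shows "(LINT \<xi>|lborel. fourier_L1 g \<xi> * (cis (\<xi> \<bullet> y) * of_real (exp (- (norm \<xi>)\<^sup>2 / (4 * \<tau>))))) =
    of_real ((2 * pi) powr (- real DIM('a) / 2) * (4 * pi * \<tau>) powr (real DIM('a) / 2) *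
      (LINT x|lborel. g x * exp (- \<tau> * (norm (x - y))\<^sup>2)))"
proof -
  have [measurable]: "g \<in> borel_measurable borel" using g by simp
  define c where "c = (2 * pi) powr (- real DIM('a) / 2)"
  define d where "d = (4 * pi * \<tau>) powr (real DIM('a) / 2)"
  let ?e = "\<lambda>\<xi>::'a. complex_of_real (exp (- (norm \<xi>)\<^sup>2 / (4 * \<tau>)))"
  let ?H = "\<lambda>\<xi> x. cis (- (x \<bullet> \<xi>)) * complex_of_real (g x) * (cis (\<xi> \<bullet> y) * ?e \<xi>)"
  have e_int: "integrable lborel ?e" using gaussian_fourier(1)[OF \<tau>, of 0] by simp
  have Hint: "integrable (lborel \<Otimes>\<^sub>M lborel) (case_prod ?H)"
  proof (rule Bochner_Integration.integrable_bound)
    show "integrable (lborel \<Otimes>\<^sub>M lborel) (\<lambda>(\<xi>::'a, x). ?e \<xi> * complex_of_real (g x))"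
      by (intro integrable_pair_mult e_int) (use g in \<open>auto intro: sigma_finite_lborel\<close>)
    show "AE x in lborel \<Otimes>\<^sub>M lborel. norm (case_prod ?H x) \<le> norm (case x of (\<xi>::'a, z) \<Rightarrow> ?e \<xi> * complex_of_real (g z))"
      by (auto simp: norm_mult)
    have "case_prod ?H \<in> borel_measurable (borel \<Otimes>\<^sub>M borel)"
      by measurable
    then show "case_prod ?H \<in> borel_measurable (lborel \<Otimes>\<^sub>M lborel)"
      by (simp add: borel_prod lborel_prod)
  qed
  have inner: "(LINT \<xi>|lborel. ?H \<xi> x) = of_real (d * (g x * exp (- \<tau> * (norm (x - y))\<^sup>2)))" for x
  proof -
    have "?H \<xi> x = of_real (g x) * (cis (- (\<xi> \<bullet> (x - y))) * ?e \<xi>)" for \<xi>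
    proof -
      have "cis (- (x \<bullet> \<xi>)) * cis (\<xi> \<bullet> y) = cis (- (\<xi> \<bullet> (x - y)))"
        by (simp add: cis_mult inner_diff_right inner_commute)
      then have "of_real (g x) * (cis (- (x \<bullet> \<xi>)) * cis (\<xi> \<bullet> y)) * ?e \<xi> = of_real (g x) * cis (- (\<xi> \<bullet> (x - y))) * ?e \<xi>"
        by (simp only:)
      then show ?thesis by (simp only: mult_ac)
    qed
    then have "(LINT \<xi>|lborel. ?H \<xi> x) = of_real (g x) * of_real (d * exp (- \<tau> * (norm (x - y))\<^sup>2))"
      by (simp only: integral_mult_right_zero gaussian_fourier(2)[OF \<tau>] d_def)
    then show ?thesis by (simp add: mult_ac)
  qed
  have "(LINT \<xi>|lborel. fourier_L1 g \<xi> * (cis (\<xi> \<bullet> y) * ?e \<xi>)) = (LINT \<xi>|lborel. of_real c * (LINT x|lborel. ?H \<xi> x))"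
    unfolding fourier_L1_def c_def[symmetric] by (simp only: mult.assoc integral_mult_left_zero[symmetric])
  also have "\<dots> = of_real c * (LINT x|lborel. LINT \<xi>|lborel. ?H \<xi> x)"
    by (simp only: integral_mult_right_zero lborel_pair.Fubini_integral[OF Hint])
  also have "\<dots> = of_real c * of_real (LINT x|lborel. d * (g x * exp (- \<tau> * (norm (x - y))\<^sup>2)))"
    unfolding inner integral_complex_of_real ..
  finally show ?thesis by (simp add: c_def d_def)
qed

text \<open>The truncations of f have transforms that tend to 0 in L^2. By the regularised inversion
  formula and Cauchy-Schwarz their Gaussian averages tend to 0, and by dominated convergence these
  averages tend to those of f.\<close>

lemma gaussian_integral_eq_0:
  fixes f :: "'a::euclidean_space \<Rightarrow> real"
  assumes F: "has_fourier_L2 f (\<lambda>_. 0)" and \<tau>: "\<tau> > 0"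
  shows "(LINT x|lborel. f x * exp (- \<tau> * (norm (x - y))\<^sup>2)) = 0"
proof -
  have f2: "f \<in> Lspace 2" using F by (simp add: has_fourier_L2_def)
  then have fm [measurable]: "f \<in> borel_measurable borel" and f: "integrable lborel (\<lambda>x. (f x)\<^sup>2)"
    by (auto simp: Lspace_2_iff)
  let ?t = "\<lambda>R. fourier_L1 (trunc R f)"
  have tm [measurable]: "?t R \<in> borel_measurable borel" for R
    using trunc_measurable[of f R] fourier_L1_measurable[of "trunc R f"] by simp
  let ?k = "\<lambda>x. exp (- \<tau> * (norm (x - y))\<^sup>2)"
  let ?C = "(2 * pi) powr (- real DIM('a) / 2) * (4 * pi * \<tau>) powr (real DIM('a) / 2)"
  let ?g = "\<lambda>\<xi>::'a. exp (- (norm \<xi>)\<^sup>2 / (4 * \<tau>))"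
  let ?N = "\<lambda>R. \<integral>\<^sup>+\<xi>. ennreal ((cmod (?t R \<xi>))\<^sup>2) \<partial>lborel"
  let ?G = "\<integral>\<^sup>+\<xi>. ennreal ((?g \<xi>)\<^sup>2) \<partial>lborel"
  have k2: "integrable lborel (\<lambda>x. (?k x)\<^sup>2)"
  proof -
    have "integrable lborel (\<lambda>x. exp (- (2 * \<tau>) * (norm (x - y))\<^sup>2))"
      by (rule lborel_integrable_affine[of "\<lambda>x. exp (- (2 * \<tau>) * (norm (x - y))\<^sup>2)" 1 y, THEN iffD1])
        (use exp_gaussian_integrable[of "2 * \<tau>"] \<tau> in auto)
    moreover have "(?k x)\<^sup>2 = exp (- (2 * \<tau>) * (norm (x - y))\<^sup>2)" for x
      by (simp flip: exp_double)
    ultimately show ?thesis by (simp only:)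
  qed
  have fk: "integrable lborel (\<lambda>x. f x * ?k x)"
    by (rule integrable_mult_L2) (use f k2 in auto)
  have lim1: "((\<lambda>R. LINT x|lborel. trunc R f x * ?k x) \<longlongrightarrow> (LINT x|lborel. f x * ?k x)) at_top"
  proof (rule integral_dominated_convergence_at_top[where w = "\<lambda>x. \<bar>f x * ?k x\<bar>"])
    show "AE x in lborel. ((\<lambda>R. trunc R f x * ?k x) \<longlongrightarrow> f x * ?k x) at_top"
    proof (rule AE_I2, rule tendsto_eventually)
      fix x :: 'a
      show "\<forall>\<^sub>F R in at_top. trunc R f x * ?k x = f x * ?k x"
        using eventually_ge_at_top[of "norm x"] by eventually_elim (simp add: indicator_def)
    qed
    show "\<forall>\<^sub>F R in at_top. AE x in lborel. norm (trunc R f x * ?k x) \<le> \<bar>f x * ?k x\<bar>"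
      by (auto simp: indicator_def)
    show "(\<lambda>x. trunc R f x * ?k x) \<in> borel_measurable lborel" for R
      using trunc_measurable[OF fm, of R] by measurable
  qed (use fk in auto)
  have G: "?G < \<infinity>"
  proof -
    have "integrable lborel (\<lambda>\<xi>. (?g \<xi>)\<^sup>2)"
      using exp_gaussian_integrable[of "1 / (2 * \<tau>)"] \<tau> by (simp add: power2_eq_square field_simps flip: exp_add)
    then show ?thesis by (simp add: nn_integral_eq_integral)
  qed
  have bound: "ennreal ((?C * (LINT x|lborel. trunc R f x * ?k x))\<^sup>2) \<le> ?N R * ?G" for R
  proof -
    let ?h = "\<lambda>\<xi>. ?t R \<xi> * (cis (\<xi> \<bullet> y) * of_real (?g \<xi>))"
    have "ennreal (cmod (LINT \<xi>|lborel. ?h \<xi>)) \<le> (\<integral>\<^sup>+\<xi>. ennreal (norm (?h \<xi>)) \<partial>lborel)"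
    proof (cases "integrable lborel ?h")
      case True
      then show ?thesis by (rule integral_norm_bound_ennreal)
    qed (simp add: not_integrable_integral_eq)
    also have "\<dots> = (\<integral>\<^sup>+\<xi>. ennreal (cmod (?t R \<xi>)) * ennreal (?g \<xi>) \<partial>lborel)"
      by (simp add: norm_mult ennreal_mult)
    finally have "(ennreal (cmod (LINT \<xi>|lborel. ?h \<xi>)))\<^sup>2 \<le> (\<integral>\<^sup>+\<xi>. ennreal (cmod (?t R \<xi>)) * ennreal (?g \<xi>) \<partial>lborel)\<^sup>2"
      by (intro power_mono) auto
    also have "\<dots> \<le> (\<integral>\<^sup>+\<xi>. (ennreal (cmod (?t R \<xi>)))\<^sup>2 \<partial>lborel) * (\<integral>\<^sup>+\<xi>. (ennreal (?g \<xi>))\<^sup>2 \<partial>lborel)"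
      by (rule Cauchy_Schwarz_nn_integral) measurable
    also have "\<dots> = ?N R * ?G" by (simp add: ennreal_power)
    finally show ?thesis
      unfolding gaussian_integral_fourier_L1[OF trunc_L1[OF f2] \<tau>] norm_of_real
      by (simp add: ennreal_power)
  qed
  have "((\<lambda>R. ?N R) \<longlongrightarrow> 0) at_top"
    using F unfolding has_fourier_L2_def by simp
  then have "((\<lambda>R. ?G * ?N R) \<longlongrightarrow> ?G * 0) at_top"
    using G by (intro ennreal_tendsto_cmult) auto
  then have lim0: "((\<lambda>R. ?N R * ?G) \<longlongrightarrow> 0) at_top" by (simp add: mult.commute)
  have "((\<lambda>R. ennreal ((?C * (LINT x|lborel. trunc R f x * ?k x))\<^sup>2)) \<longlongrightarrow> 0) at_top"
  proof (rule tendsto_sandwich[OF _ _ tendsto_const lim0])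
    show "\<forall>\<^sub>F R in at_top. ennreal ((?C * (LINT x|lborel. trunc R f x * ?k x))\<^sup>2) \<le> ?N R * ?G"
      by (intro always_eventually allI bound)
  qed (rule always_eventually, rule allI, rule zero_le)
  moreover have "((\<lambda>R. ennreal ((?C * (LINT x|lborel. trunc R f x * ?k x))\<^sup>2)) \<longlongrightarrow> ennreal ((?C * (LINT x|lborel. f x * ?k x))\<^sup>2)) at_top"
    by (intro tendsto_ennrealI tendsto_power tendsto_mult tendsto_const lim1)
  ultimately have "ennreal ((?C * (LINT x|lborel. f x * ?k x))\<^sup>2) = 0"
    by (intro tendsto_unique[OF trivial_limit_at_top_linorder])
  then have "?C * (LINT x|lborel. f x * ?k x) = 0"
    by (simp only: ennreal_eq_0_iff zero_le_power2 power2_less_eq_zero_iff)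
  then show ?thesis using \<tau> by simp
qed

text \<open>Integrate over y in a box and let the Gaussians concentrate.\<close>

lemma box_integral_0_if_gaussian_integrals_0:
  fixes f :: "'a::euclidean_space \<Rightarrow> real"
  assumes f: "integrable lborel f"
    and zero: "\<And>a y. a > 0 \<Longrightarrow> (LINT x|lborel. f x * exp (- a * (norm (x - y))\<^sup>2)) = 0"
  shows "(LINT x|lborel. f x * indicator (box l u) x) = 0"
proof -
  have [measurable]: "f \<in> borel_measurable borel" using f by simp
  let ?B = "box l u"
  define E where "E = (LINT z::'a|lborel. exp (- (norm z)\<^sup>2))"
  have gi: "integrable lborel (\<lambda>z::'a. exp (- (norm z)\<^sup>2))" using exp_gaussian_integrable[of 1] by simp
  have E: "E > 0"
  proof -
    have "(LINT x::'a|lborel. complex_of_real (exp (- (norm x)\<^sup>2))) = of_real (pi powr (real DIM('a) / 2))"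
      using gaussian_fourier(2)[of "1/4" "0::'a"] by simp
    then show ?thesis unfolding E_def integral_complex_of_real of_real_eq_iff by simp
  qed
  \<comment> \<open>The average of the indicator of the box over a Gaussian of width c around x, in
    the variable z = (y - x)/c. This fixes the Gaussian, so that c \<longrightarrow> 0 acts on the
    indicator alone.\<close>
  let ?b = "\<lambda>c x. LINT z|lborel. exp (- (norm z)\<^sup>2) * indicator ?B (x + c *\<^sub>R z)"
  have bi: "integrable lborel (\<lambda>z. exp (- (norm z)\<^sup>2) * indicator ?B (x + c *\<^sub>R z) :: real)" for c x
    by (rule Bochner_Integration.integrable_bound[OF gi]) (auto simp: indicator_def)
  have bm[measurable]: "?b c \<in> borel_measurable borel" for c
    by (rule lborel.borel_measurable_lebesgue_integral) measurable
  have z: "(LINT x|lborel. f x * ?b c x) = 0" if c: "c > 0" for c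
  proof -
    let ?H = "\<lambda>x y. f x * exp (- (1 / c\<^sup>2) * (norm (x - y))\<^sup>2) * indicator ?B y"
    have Hint: "integrable (lborel \<Otimes>\<^sub>M lborel) (case_prod ?H)"
    proof (rule Bochner_Integration.integrable_bound)
      show "integrable (lborel \<Otimes>\<^sub>M lborel) (\<lambda>(x, y). f x * (indicator ?B y :: real))"
        using emeasure_lborel_box_finite[of l u]
        by (intro integrable_pair_mult f sigma_finite_lborel) (simp add: integrable_real_indicator)
      have "\<bar>f x\<bar> * e * i \<le> \<bar>f x\<bar> * i" if "e \<le> 1" "0 \<le> i" for x e i
        using mult_left_mono[OF that(1), of "\<bar>f x\<bar> * i"] that(2) by (simp add: mult_ac)
      then show "AE x in lborel \<Otimes>\<^sub>M lborel. norm (case_prod ?H x) \<le> norm (case x of (x, y) \<Rightarrow> f x * (indicator ?B y :: real))"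
        by (auto simp: abs_mult)
      have "case_prod ?H \<in> borel_measurable (borel \<Otimes>\<^sub>M borel)"
        by measurable
      then show "case_prod ?H \<in> borel_measurable (lborel \<Otimes>\<^sub>M lborel)"
        by (simp add: borel_prod lborel_prod)
    qed
    have sub: "(LINT y|lborel. ?H x y) = c ^ DIM('a) * (f x * ?b c x)" for x
    proof -
      have "(LINT y|lborel. ?H x y) = f x * (LINT y|lborel. exp (- (1 / c\<^sup>2) * (norm (x - y))\<^sup>2) * indicator ?B y)"
        by (simp add: mult.assoc)
      also have "(LINT y|lborel. exp (- (1 / c\<^sup>2) * (norm (x - y))\<^sup>2) * indicator ?B y) =
          c ^ DIM('a) * (LINT z|lborel. exp (- (1 / c\<^sup>2) * (norm (x - (x + c *\<^sub>R z)))\<^sup>2) * indicator ?B (x + c *\<^sub>R z))"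
        using c by (subst lborel_integral_affine[of _ c x]) auto
      also have "(\<lambda>z. exp (- (1 / c\<^sup>2) * (norm (x - (x + c *\<^sub>R z)))\<^sup>2)) = (\<lambda>z. exp (- (norm z)\<^sup>2))"
        using c by (auto simp: power_mult_distrib)
      finally show ?thesis by (simp add: mult_ac)
    qed
    have "c ^ DIM('a) * (LINT x|lborel. f x * ?b c x) = (LINT x|lborel. LINT y|lborel. ?H x y)"
      unfolding sub by simp
    also have "\<dots> = (LINT y|lborel. LINT x|lborel. ?H x y)"
      by (rule lborel_pair.Fubini_integral[symmetric, OF Hint])
    also have "\<dots> = 0"
      using zero[of "1 / c\<^sup>2"] c by simp
    finally show ?thesis using c by simp
  qed
  let ?c = "\<lambda>i. inverse (real (Suc i))"
  have "(\<lambda>i. LINT x|lborel. f x * ?b (?c i) x) \<longlonglongrightarrow> (LINT x|lborel. f x * (E * indicator ?B x))"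
  proof (rule integral_dominated_convergence[where w = "\<lambda>x. \<bar>f x\<bar> * E"])
    \<comment> \<open>Off the boundary of the box the indicator is locally constant, so the averages
      converge there to E times the indicator; the boundary is a null set.\<close>
    have null: "cbox l u - box l u \<in> null_sets lborel"
    proof -
      have "emeasure lborel (cbox l u - box l u) = emeasure lborel (cbox l u) - emeasure lborel (box l u)"
        by (rule emeasure_Diff) (use emeasure_lborel_box_finite[of l u] box_subset_cbox[of l u] in auto)
      also have "\<dots> = 0"
        by (simp add: emeasure_lborel_cbox_eq emeasure_lborel_box_eq)
      finally show ?thesis by auto
    qed
    show "AE x in lborel. (\<lambda>i. f x * ?b (?c i) x) \<longlonglongrightarrow> f x * (E * indicator ?B x)"
      using AE_not_in[OF null]
    proof eventually_elim
      case (elim x)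
      have "(\<lambda>i. ?b (?c i) x) \<longlonglongrightarrow> (LINT z::'a|lborel. exp (- (norm z)\<^sup>2) * indicator ?B x)"
      proof (rule integral_dominated_convergence[where w = "\<lambda>z. exp (- (norm z)\<^sup>2)"])
        show "AE z in lborel. (\<lambda>i. exp (- (norm z)\<^sup>2) * indicator ?B (x + ?c i *\<^sub>R z)) \<longlonglongrightarrow> exp (- (norm z)\<^sup>2) * indicat_real ?B x"
        proof (rule AE_I2)
          fix z :: 'a
          have "(\<lambda>i. x + ?c i *\<^sub>R z) \<longlonglongrightarrow> x + 0 *\<^sub>R z"
            by (rule tendsto_add[OF tendsto_const tendsto_scaleR[OF LIMSEQ_inverse_real_of_nat tendsto_const]])
          then have lim: "(\<lambda>i. x + ?c i *\<^sub>R z) \<longlonglongrightarrow> x" by simp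
          have "\<forall>\<^sub>F i in sequentially. indicat_real ?B (x + ?c i *\<^sub>R z) = indicat_real ?B x"
          proof (cases "x \<in> ?B")
            case True
            from topological_tendstoD[OF lim open_box True] show ?thesis
              by eventually_elim (simp add: True)
          next
            case False
            then have "x \<in> - cbox l u" using elim by auto
            from topological_tendstoD[OF lim _ this] have "\<forall>\<^sub>F i in sequentially. x + ?c i *\<^sub>R z \<in> - cbox l u"
              by (simp add: open_Compl closed_cbox)
            then show ?thesis
              by eventually_elim (use False box_subset_cbox[of l u] in \<open>auto simp: indicator_def\<close>)
          qed
          then show "(\<lambda>i. exp (- (norm z)\<^sup>2) * indicator ?B (x + ?c i *\<^sub>R z)) \<longlonglongrightarrow> exp (- (norm z)\<^sup>2) * indicat_real ?B x"
            by (intro tendsto_mult[OF tendsto_const] tendsto_eventually)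
        qed
      qed (use gi in \<open>auto simp: indicator_def\<close>)
      then have "(\<lambda>i. ?b (?c i) x) \<longlonglongrightarrow> E * indicator ?B x" by (simp add: E_def)
      then show ?case by (rule tendsto_mult[OF tendsto_const])
    qed
    show "AE x in lborel. norm (f x * ?b (?c i) x) \<le> \<bar>f x\<bar> * E" for i
    proof (rule AE_I2)
      fix x
      have "?b (?c i) x \<le> E" unfolding E_def by (rule integral_mono[OF bi gi]) (auto simp: indicator_def)
      moreover have "?b (?c i) x \<ge> 0" by (rule Bochner_Integration.integral_nonneg) simp
      ultimately show "norm (f x * ?b (?c i) x) \<le> \<bar>f x\<bar> * E"
        by (simp add: abs_mult mult_left_mono)
    qed
    show "integrable lborel (\<lambda>x. \<bar>f x\<bar> * E)" using f by simp
  qed measurable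
  then have "(\<lambda>i::nat. 0) \<longlonglongrightarrow> (LINT x|lborel. f x * (E * indicator ?B x))"
    using z by simp
  then have "(LINT x|lborel. E * (f x * indicator ?B x)) = 0"
    by (simp add: LIMSEQ_const_iff mult.left_commute)
  then show ?thesis using E by simp
qed

text \<open>Boxes are closed under intersection and generate the Borel sets, so the induction over
  disjoint unions and complements extends the vanishing integral to all Borel sets.\<close>

lemma AE_0_if_box_integrals_0:
  fixes f :: "'a::euclidean_space \<Rightarrow> real"
  assumes f: "integrable lborel f"
    and box: "\<And>l u. (LINT x|lborel. f x * indicator (box l u) x) = 0"
  shows "AE x in lborel. f x = 0"
proof (rule sigma_finite_measure.density_zero[OF sigma_finite_lborel f])
  fix A :: "'a set" assume "A \<in> sets lborel"
  then have A: "A \<in> sigma_sets UNIV (range (\<lambda>(a, b). box a b))"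
    by (simp add: borel_eq_box)
  \<comment> \<open>The complement step subtracts from the integral over the whole space, which
    therefore has to vanish first; the space is exhausted by boxes.\<close>
  have total: "(LINT x|lborel. f x) = 0"
  proof -
    let ?B = "\<lambda>i::nat. box (- (real i *\<^sub>R One)) (real i *\<^sub>R One) :: 'a set"
    have "(\<lambda>i. LINT x|lborel. f x * indicator (?B i) x) \<longlonglongrightarrow> (LINT x|lborel. f x)"
    proof (rule integral_dominated_convergence[where w = "\<lambda>x. \<bar>f x\<bar>"])
      show "AE x in lborel. (\<lambda>i. f x * indicator (?B i) x) \<longlonglongrightarrow> f x"
      proof (rule AE_I2, rule tendsto_eventually)
        fix x :: 'a
        have "x \<in> (\<Union>i. ?B i)" unfolding UN_box_eq_UNIV by simp
        then obtain i where i: "x \<in> ?B i" by auto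
        have "x \<in> ?B j" if "j \<ge> i" for j
        proof -
          have "real i \<le> real j" using that by simp
          then show ?thesis using i by (fastforce simp: mem_box)
        qed
        then show "\<forall>\<^sub>F i in sequentially. f x * indicator (?B i) x = f x"
          unfolding eventually_sequentially by (intro exI[of _ i]) simp
      qed
    qed (use f in \<open>auto simp: indicator_def\<close>)
    then show ?thesis unfolding box by (simp add: LIMSEQ_const_iff)
  qed
  have si: "set_integrable lborel B f" if "B \<in> sets borel" for B
    unfolding set_integrable_def using that f by (intro integrable_mult_indicator) auto
  have "Int_stable (range (\<lambda>(a, b). box a b :: 'a set))"
    by (auto simp: Int_stable_def box_Int_box)
  from this _ A show "(LINT x:A|lborel. f x) = 0"
  proof (rule sigma_sets_induct_disjoint)
    fix B :: "'a set" assume "B \<in> range (\<lambda>(a, b). box a b)"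
    then show "(LINT x:B|lborel. f x) = 0"
      using box by (auto simp: set_lebesgue_integral_def mult.commute)
  next
    show "(LINT x:{}|lborel. f x) = 0" by (simp add: set_lebesgue_integral_def)
  next
    fix B :: "'a set" assume B: "B \<in> sigma_sets UNIV (range (\<lambda>(a, b). box a b))" and zero: "(LINT x:B|lborel. f x) = 0"
    have "B \<in> sets borel" using B by (simp add: borel_eq_box)
    then have "(LINT x:UNIV - B|lborel. f x) = (LINT x|lborel. f x) - (LINT x:B|lborel. f x)"
    proof -
      have "(LINT x:UNIV - B|lborel. f x) = (LINT x|lborel. f x - indicator B x *\<^sub>R f x)"
        unfolding set_lebesgue_integral_def by (intro Bochner_Integration.integral_cong) (auto simp: indicator_def)
      also have "\<dots> = (LINT x|lborel. f x) - (LINT x:B|lborel. f x)"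
        unfolding set_lebesgue_integral_def
        by (intro Bochner_Integration.integral_diff f) (use si[OF \<open>B \<in> sets borel\<close>] in \<open>simp add: set_integrable_def\<close>)
      finally show ?thesis .
    qed
    then show "(LINT x:UNIV - B|lborel. f x) = 0" using zero total by simp
  next
    fix B :: "nat \<Rightarrow> 'a set"
    assume d: "disjoint_family B" and r: "range B \<subseteq> sigma_sets UNIV (range (\<lambda>(a, b). box a b))"
      and zero: "\<And>i. (LINT x:B i|lborel. f x) = 0"
    have m: "B i \<in> sets borel" for i using r by (auto simp: borel_eq_box)
    have "(LINT x:(\<Union>i. B i)|lborel. f x) = (\<Sum>i. LINT x:B i|lborel. f x)"
      by (intro lebesgue_integral_countable_add si) (use m d in \<open>auto simp: disjoint_family_on_def\<close>)
    then show "(LINT x:(\<Union>i. B i)|lborel. f x) = 0" using zero by simp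
  qed auto
qed

lemma has_fourier_L2_0_imp_AE_0:
  fixes f :: "'a::euclidean_space \<Rightarrow> real"
  assumes F: "has_fourier_L2 f (\<lambda>_. 0)"
  shows "AE x in lborel. f x = 0"
proof -
  have [measurable]: "f \<in> borel_measurable borel" and f: "integrable lborel (\<lambda>x. (f x)\<^sup>2)"
    using F by (auto simp: has_fourier_L2_def Lspace_2_iff)
  let ?w = "\<lambda>x::'a. exp (- (norm x)\<^sup>2)"
  have "integrable lborel (\<lambda>x. (?w x)\<^sup>2)"
    using exp_gaussian_integrable[of 2] by (simp add: power2_eq_square flip: exp_add)
  then have i: "integrable lborel (\<lambda>x. f x * ?w x)"
    using f by (intro integrable_mult_L2) auto
  \<comment> \<open>A product of Gaussians is a multiple of a Gaussian, so f may be replaced by the integrable function f w.\<close>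
  have "(LINT x|lborel. f x * ?w x * exp (- a * (norm (x - y))\<^sup>2)) = 0" if a: "a > 0" for a y
  proof -
    \<comment> \<open>Completing the square: the rates 1 and a add up to 1 + a, and the new centre
      is the weighted mean \<open>?b *\<^sub>R y\<close> of the centres 0 and y.\<close>
    let ?b = "a / (1 + a)"
    have eq: "?w x * exp (- a * (norm (x - y))\<^sup>2) = exp (- (a - a\<^sup>2 / (1 + a)) * (norm y)\<^sup>2) * exp (- (1 + a) * (norm (x - ?b *\<^sub>R y))\<^sup>2)" for x
    proof -
      have "(1 + a) * ?b = a" "(1 + a) * ?b\<^sup>2 = a\<^sup>2 / (1 + a)"
        using a by (simp_all add: power2_eq_square)
      then have 1: "(1 + a) * (norm (x - ?b *\<^sub>R y))\<^sup>2 = (1 + a) * (norm x)\<^sup>2 - 2 * a * (x \<bullet> y) + a\<^sup>2 / (1 + a) * (norm y)\<^sup>2"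
      proof -
        have "(1 + a) * (norm (x - b *\<^sub>R y))\<^sup>2 = (1 + a) * (norm x)\<^sup>2 - 2 * ((1 + a) * b) * (x \<bullet> y) + ((1 + a) * b\<^sup>2) * (norm y)\<^sup>2" for b
          unfolding power2_norm_eq_inner by (simp add: inner_diff_left inner_diff_right inner_commute power2_eq_square algebra_simps)
        from this[of ?b] show ?thesis using \<open>(1 + a) * ?b = a\<close> \<open>(1 + a) * ?b\<^sup>2 = a\<^sup>2 / (1 + a)\<close> by (simp only:)
      qed
      have 2: "a * (norm (x - y))\<^sup>2 = a * (norm x)\<^sup>2 - 2 * a * (x \<bullet> y) + a * (norm y)\<^sup>2"
        unfolding power2_norm_eq_inner by (simp add: inner_diff_left inner_diff_right inner_commute algebra_simps)
      show ?thesis unfolding exp_add[symmetric] mult_minus_left 1 2 by (simp add: algebra_simps)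
    qed
    have "(LINT x|lborel. f x * ?w x * exp (- a * (norm (x - y))\<^sup>2)) =
        (LINT x|lborel. exp (- (a - a\<^sup>2 / (1 + a)) * (norm y)\<^sup>2) * (f x * exp (- (1 + a) * (norm (x - ?b *\<^sub>R y))\<^sup>2)))"
      by (simp only: mult.assoc eq) (simp only: mult.left_commute)
    also have "\<dots> = 0"
      using gaussian_integral_eq_0[OF F, of "1 + a" "?b *\<^sub>R y"] a by (simp only: integral_mult_right_zero add_pos_pos zero_less_one)
    finally show ?thesis .
  qed
  from AE_0_if_box_integrals_0[OF i box_integral_0_if_gaussian_integrals_0[OF i this]]
  show ?thesis by simp
qed

section \<open>Linearity of the transform\<close>

lemma has_fourier_L2_cmult:
  assumes F: "has_fourier_L2 f F"
  shows "has_fourier_L2 (\<lambda>x. c * f x) (\<lambda>\<xi>. of_real c * F \<xi>)"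
proof -
  have [measurable]: "F \<in> borel_measurable borel" "f \<in> borel_measurable borel"
    using F by (auto simp: has_fourier_L2_def Lspace_2_iff)
  let ?t = "\<lambda>R. fourier_L1 (trunc R f)"
  have tm [measurable]: "?t R \<in> borel_measurable borel" for R
    using trunc_measurable[of f R] fourier_L1_measurable[of "trunc R f"] by simp
  have eq: "(\<integral>\<^sup>+\<xi>. ennreal ((cmod (of_real c * F \<xi> - fourier_L1 (\<lambda>x. indicator (cball 0 R) x * (c * f x)) \<xi>))\<^sup>2) \<partial>lborel)
     = ennreal (c\<^sup>2) * (\<integral>\<^sup>+\<xi>. ennreal ((cmod (F \<xi> - ?t R \<xi>))\<^sup>2) \<partial>lborel)" for R
  proof -
    have "(cmod (of_real c * F \<xi> - fourier_L1 (\<lambda>x. indicator (cball 0 R) x * (c * f x)) \<xi>))\<^sup>2 = c\<^sup>2 * (cmod (F \<xi> - ?t R \<xi>))\<^sup>2" for \<xi>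
      unfolding mult.left_commute[of _ c] fourier_L1_cmult right_diff_distrib[symmetric] norm_mult
      by (simp add: power_mult_distrib)
    then show ?thesis by (simp add: ennreal_mult nn_integral_cmult)
  qed
  have "((\<lambda>R. ennreal (c\<^sup>2) * (\<integral>\<^sup>+\<xi>. ennreal ((cmod (F \<xi> - ?t R \<xi>))\<^sup>2) \<partial>lborel)) \<longlongrightarrow> ennreal (c\<^sup>2) * 0) at_top"
    using F by (intro ennreal_tendsto_cmult) (auto simp: has_fourier_L2_def)
  then show ?thesis
    using F unfolding has_fourier_L2_def eq
    by (intro conjI Lspace_2_cmult) (simp_all add: norm_mult power_mult_distrib)
qed

lemma has_fourier_L2_diff:
  assumes F: "has_fourier_L2 f F" and G: "has_fourier_L2 g G"
  shows "has_fourier_L2 (\<lambda>x. f x - g x) (\<lambda>\<xi>. F \<xi> - G \<xi>)"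
proof -
  have fg: "f \<in> Lspace 2" "g \<in> Lspace 2" using F G by (auto simp: has_fourier_L2_def)
  have [measurable]: "F \<in> borel_measurable borel" "f \<in> borel_measurable borel" "G \<in> borel_measurable borel" "g \<in> borel_measurable borel"
    using F G by (auto simp: has_fourier_L2_def Lspace_2_iff)
  let ?t = "\<lambda>f R. fourier_L1 (trunc R f)"
  have tm [measurable]: "?t f R \<in> borel_measurable borel" "?t g R \<in> borel_measurable borel" for R
    using trunc_measurable[of f R] fourier_L1_measurable[of "trunc R f"]
      trunc_measurable[of g R] fourier_L1_measurable[of "trunc R g"] by simp_all
  let ?a = "\<lambda>F f R. \<integral>\<^sup>+\<xi>. ennreal ((cmod (F \<xi> - ?t f R \<xi>))\<^sup>2) \<partial>lborel"
  let ?d = "\<lambda>R. \<integral>\<^sup>+\<xi>. ennreal ((cmod (F \<xi> - G \<xi> - fourier_L1 (trunc R (\<lambda>x. f x - g x)) \<xi>))\<^sup>2) \<partial>lborel"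
  have le: "?d R \<le> 2 * ?a F f R + 2 * ?a G g R" for R
  proof -
    have "fourier_L1 (trunc R (\<lambda>x. f x - g x)) \<xi> = ?t f R \<xi> - ?t g R \<xi>" for \<xi>
      using fourier_L1_diff[OF trunc_L1[OF fg(1)] trunc_L1[OF fg(2)]] by (simp add: right_diff_distrib)
    then have "F \<xi> - G \<xi> - fourier_L1 (trunc R (\<lambda>x. f x - g x)) \<xi> = (F \<xi> - ?t f R \<xi>) + (?t g R \<xi> - G \<xi>)" for \<xi>
      by (simp only:) (simp add: algebra_simps)
    then have "?d R = (\<integral>\<^sup>+\<xi>. ennreal ((cmod ((F \<xi> - ?t f R \<xi>) + (?t g R \<xi> - G \<xi>)))\<^sup>2) \<partial>lborel)"
      by (simp only:)
    also have "\<dots> \<le> 2 * ?a F f R + 2 * (\<integral>\<^sup>+\<xi>. ennreal ((cmod (?t g R \<xi> - G \<xi>))\<^sup>2) \<partial>lborel)"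
      by (rule nn_integral_cmod_add_sq_le) measurable
    finally show ?thesis by (simp add: norm_minus_commute)
  qed
  have "((\<lambda>R. 2 * ?a F f R + 2 * ?a G g R) \<longlongrightarrow> 2 * 0 + 2 * 0) at_top"
    using F G unfolding has_fourier_L2_def
    by (intro tendsto_add ennreal_tendsto_cmult) auto
  then have lim: "((\<lambda>R. 2 * ?a F f R + 2 * ?a G g R) \<longlongrightarrow> 0) at_top" by simp
  have "(?d \<longlongrightarrow> 0) at_top"
    by (rule tendsto_sandwich[OF _ _ tendsto_const lim]) (auto simp: le)
  moreover have "integrable lborel (\<lambda>\<xi>. (cmod (F \<xi> - G \<xi>))\<^sup>2)"
  proof (rule Bochner_Integration.integrable_bound)
    show "integrable lborel (\<lambda>\<xi>. 2 * (cmod (F \<xi>))\<^sup>2 + 2 * (cmod (G \<xi>))\<^sup>2)"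
      using F G by (auto simp: has_fourier_L2_def)
    show "AE \<xi> in lborel. norm ((cmod (F \<xi> - G \<xi>))\<^sup>2) \<le> norm (2 * (cmod (F \<xi>))\<^sup>2 + 2 * (cmod (G \<xi>))\<^sup>2)"
      using cmod_add_sq_le[of "F _" "- G _"] by simp
  qed measurable
  ultimately show ?thesis
    unfolding has_fourier_L2_def using Lspace_2_diff[OF fg] by simp
qed

text \<open>The operators of the weak formulation are chosen only by a condition on their
  transforms; injectivity is what determines the chosen function almost everywhere.\<close>

lemma fourier_L2_inj:
  assumes "f \<in> Lspace 2" "g \<in> Lspace 2"
    and "AE \<xi> in lborel. fourier_L2 f \<xi> = fourier_L2 g \<xi>"
  shows "AE x in lborel. f x = g x"
proof -
  let ?D = "\<lambda>\<xi>. fourier_L2 f \<xi> - fourier_L2 g \<xi>"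
  let ?t = "\<lambda>R. fourier_L1 (trunc R (\<lambda>x. f x - g x))"
  have D: "has_fourier_L2 (\<lambda>x. f x - g x) ?D"
    by (intro has_fourier_L2_diff has_fourier_L2_fourier_L2 assms)
  have "(\<integral>\<^sup>+\<xi>. ennreal ((cmod (?D \<xi> - ?t R \<xi>))\<^sup>2) \<partial>lborel) = (\<integral>\<^sup>+\<xi>. ennreal ((cmod (0 - ?t R \<xi>))\<^sup>2) \<partial>lborel)" for R
    by (rule nn_integral_cong_AE) (use assms(3) in auto)
  then have "has_fourier_L2 (\<lambda>x. f x - g x) (\<lambda>_. 0)"
    using D unfolding has_fourier_L2_def by simp
  from has_fourier_L2_0_imp_AE_0[OF this] show ?thesis by simp
qed

section \<open>Mixtures of heat kernels\<close>

definition gaussian :: "real \<Rightarrow> 'a::euclidean_space \<Rightarrow> real" where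
  "gaussian \<tau> x = (4 * pi * \<tau>) powr (- real DIM('a) / 2) * exp (- (norm x)\<^sup>2 / (4 * \<tau>))"

lemma gaussian_nonneg [simp]: "gaussian \<tau> x \<ge> 0"
  by (simp add: gaussian_def)

lemma gaussian_measurable [measurable (raw)]:
  assumes [measurable]: "f \<in> borel_measurable M" "g \<in> borel_measurable M"
  shows "(\<lambda>x. gaussian (f x) (g x)) \<in> borel_measurable M"
  unfolding gaussian_def by measurable

lemma gaussian_integral:
  assumes "\<tau> > 0"
  shows "integrable lborel (gaussian \<tau> :: 'a::euclidean_space \<Rightarrow> real)"
    and "(LINT x::'a|lborel. gaussian \<tau> x) = 1"
    and "fourier_L1 (gaussian \<tau>) (\<xi>::'a) = of_real ((2 * pi) powr (- real DIM('a) / 2) * exp (- \<tau> * (norm \<xi>)\<^sup>2))"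
proof -
  let ?e = "\<lambda>x::'a. exp (- (norm x)\<^sup>2 / (4 * \<tau>))"
  have c: "(4 * pi * \<tau>) powr (- real DIM('a) / 2) * (4 * pi * \<tau>) powr (real DIM('a) / 2) = 1"
    using assms by (simp flip: powr_add)
  have "integrable lborel (\<lambda>x::'a. complex_of_real (?e x))"
    using gaussian_fourier(1)[OF assms, of "0::'a"] by simp
  then have i: "integrable lborel ?e" by (simp only: complex_of_real_integrable_eq)
  then show "integrable lborel (gaussian \<tau> :: 'a \<Rightarrow> real)"
    unfolding gaussian_def by (rule integrable_mult_right)
  have "(LINT x::'a|lborel. complex_of_real (?e x)) = of_real ((4 * pi * \<tau>) powr (real DIM('a) / 2))"
    using gaussian_fourier(2)[OF assms, of "0::'a"] by simp
  then have "(LINT x::'a|lborel. ?e x) = (4 * pi * \<tau>) powr (real DIM('a) / 2)"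
    unfolding integral_complex_of_real of_real_eq_iff .
  then show "(LINT x::'a|lborel. gaussian \<tau> x) = 1"
    unfolding gaussian_def integral_mult_right_zero by (simp only: c)
  have "fourier_L1 (gaussian \<tau>) \<xi> = of_real ((4 * pi * \<tau>) powr (- real DIM('a) / 2)) * fourier_L1 ?e \<xi>"
    unfolding gaussian_def[abs_def] by (rule fourier_L1_cmult)
  also have "\<dots> = of_real ((4 * pi * \<tau>) powr (- real DIM('a) / 2)) * (of_real ((2 * pi) powr (- real DIM('a) / 2)) *
      of_real ((4 * pi * \<tau>) powr (real DIM('a) / 2) * exp (- \<tau> * (norm \<xi>)\<^sup>2)))"
    unfolding fourier_L1_def gaussian_fourier(2)[OF assms] ..
  also have "\<dots> = of_real (((4 * pi * \<tau>) powr (- real DIM('a) / 2) * (4 * pi * \<tau>) powr (real DIM('a) / 2)) * ((2 * pi) powr (- real DIM('a) / 2) * exp (- \<tau> * (norm \<xi>)\<^sup>2)))"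
    by (simp only: of_real_mult mult_ac)
  finally show "fourier_L1 (gaussian \<tau>) \<xi> = of_real ((2 * pi) powr (- real DIM('a) / 2) * exp (- \<tau> * (norm \<xi>)\<^sup>2))"
    unfolding c by simp
qed

lemma gaussian_le_1:
  assumes "\<tau> \<ge> 1" shows "gaussian \<tau> (x::'a::euclidean_space) \<le> 1"
proof -
  have "(4 * pi * \<tau>) powr (- real DIM('a) / 2) \<le> 1"
  proof -
    have "1 * 1 \<le> (4 * pi) * \<tau>" using assms pi_gt3 by (intro mult_mono) auto
    then have "(4 * pi * \<tau>) powr (- real DIM('a) / 2) \<le> (4 * pi * \<tau>) powr 0" by (intro powr_mono) auto
    then show ?thesis using assms by (simp split: if_splits)
  qed
  moreover have "exp (- (norm x)\<^sup>2 / (4 * \<tau>)) \<le> 1" using assms by simp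
  ultimately show ?thesis unfolding gaussian_def using mult_mono[of _ 1 _ 1] by fastforce
qed

definition mix :: "(real \<Rightarrow> real) \<Rightarrow> 'a::euclidean_space \<Rightarrow> real" where
  "mix \<nu> x = (LINT \<tau>|lborel. \<nu> \<tau> * gaussian \<tau> x)"

text \<open>Support in [1, \<infinity>) keeps away from \<tau> = 0, where the heat kernel is
  unbounded at the origin; by \<open>gaussian_le_1\<close> the mixtures are then bounded, with the
  density itself as majorant.\<close>

definition mixing :: "(real \<Rightarrow> real) \<Rightarrow> bool" where
  "mixing \<nu> \<longleftrightarrow> integrable lborel \<nu> \<and> (\<forall>\<tau><1. \<nu> \<tau> = 0)"

lemma mixing_bound: "mixing \<nu> \<Longrightarrow> \<bar>\<nu> \<tau> * gaussian \<tau> x\<bar> \<le> \<bar>\<nu> \<tau>\<bar>"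
  using mult_left_mono[OF gaussian_le_1[of \<tau> x], of "\<bar>\<nu> \<tau>\<bar>"]
  by (cases "\<tau> < 1") (auto simp: mixing_def abs_mult)

lemma mixing_integrable:
  assumes "mixing \<nu>" shows "integrable lborel (\<lambda>\<tau>. \<nu> \<tau> * gaussian \<tau> x)"
proof (rule Bochner_Integration.integrable_bound)
  show "integrable lborel \<nu>" using assms by (simp add: mixing_def)
  then have [measurable]: "\<nu> \<in> borel_measurable borel" by simp
  show "(\<lambda>\<tau>. \<nu> \<tau> * gaussian \<tau> x) \<in> borel_measurable lborel" by measurable
qed (use mixing_bound[OF assms] in auto)

lemma mix_bounded:
  assumes "mixing \<nu>" shows "\<bar>mix \<nu> x\<bar> \<le> (LINT \<tau>|lborel. \<bar>\<nu> \<tau>\<bar>)"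
proof -
  have "\<bar>mix \<nu> x\<bar> \<le> (LINT \<tau>|lborel. \<bar>\<nu> \<tau> * gaussian \<tau> x\<bar>)"
    unfolding mix_def by (rule integral_abs_bound)
  also have "\<dots> \<le> (LINT \<tau>|lborel. \<bar>\<nu> \<tau>\<bar>)"
    using mixing_integrable[OF assms, of x] assms mixing_bound[OF assms]
    by (intro integral_mono) (auto simp: mixing_def)
  finally show ?thesis .
qed

lemma mix_pair_integrable:
  assumes "mixing \<nu>"
  shows "integrable (lborel \<Otimes>\<^sub>M lborel) (\<lambda>(\<tau>, x::'a::euclidean_space). \<nu> \<tau> * gaussian \<tau> x)"
proof (rule lborel_pair.Fubini_integrable)
  have i: "integrable lborel \<nu>" using assms by (simp add: mixing_def)
  then have [measurable]: "\<nu> \<in> borel_measurable borel" by simp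
  have "(\<lambda>(\<tau>, x::'a). \<nu> \<tau> * gaussian \<tau> x) \<in> borel_measurable (borel \<Otimes>\<^sub>M borel)" by measurable
  then show "(\<lambda>(\<tau>, x::'a). \<nu> \<tau> * gaussian \<tau> x) \<in> borel_measurable (lborel \<Otimes>\<^sub>M lborel)"
    by (simp add: borel_prod lborel_prod)
  have "(LINT x::'a|lborel. norm (\<nu> \<tau> * gaussian \<tau> x)) = \<bar>\<nu> \<tau>\<bar>" for \<tau>
    using assms gaussian_integral(2)[of \<tau>, where 'a='a] by (cases "\<tau> < 1") (auto simp: mixing_def abs_mult)
  then show "integrable lborel (\<lambda>\<tau>. LINT x::'a|lborel. norm (case (\<tau>, x) of (\<tau>, x) \<Rightarrow> \<nu> \<tau> * gaussian \<tau> x))"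
    using i by simp
  show "AE \<tau> in lborel. integrable lborel (\<lambda>x::'a. case (\<tau>, x) of (\<tau>, x) \<Rightarrow> \<nu> \<tau> * gaussian \<tau> x)"
  proof (rule AE_I2)
    fix \<tau>
    show "integrable lborel (\<lambda>x::'a. case (\<tau>, x) of (\<tau>, x) \<Rightarrow> \<nu> \<tau> * gaussian \<tau> x)"
      using assms gaussian_integral(1)[of \<tau>, where 'a='a] by (cases "\<tau> < 1") (auto simp: mixing_def)
  qed
qed

lemma mix_integrable:
  assumes "mixing \<nu>" shows "integrable lborel (mix \<nu> :: 'a::euclidean_space \<Rightarrow> real)"
  using lborel_pair.integrable_snd[OF mix_pair_integrable[OF assms, where 'a='a]]
  unfolding mix_def[abs_def] by simp

text \<open>Fubini gives the Laplace transform of \<nu> at |\<xi>|^2, so that identities between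
  Laplace transforms become Fourier multiplier identities.\<close>

lemma fourier_L1_mix:
  assumes "mixing \<nu>"
  shows "fourier_L1 (mix \<nu>) (\<xi>::'a::euclidean_space) =
    of_real ((2 * pi) powr (- real DIM('a) / 2) * (LINT \<tau>|lborel. \<nu> \<tau> * exp (- \<tau> * (norm \<xi>)\<^sup>2)))"
proof -
  have i: "integrable lborel \<nu>" using assms by (simp add: mixing_def)
  then have [measurable]: "\<nu> \<in> borel_measurable borel" by simp
  let ?c = "complex_of_real ((2 * pi) powr (- real DIM('a) / 2))"
  let ?H = "\<lambda>\<tau> x. cis (- (x \<bullet> \<xi>)) * complex_of_real (\<nu> \<tau> * gaussian \<tau> x)"
  have Hint: "integrable (lborel \<Otimes>\<^sub>M lborel) (case_prod ?H)"
  proof (rule Bochner_Integration.integrable_bound[OF mix_pair_integrable[OF assms]])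
    show "AE z in lborel \<Otimes>\<^sub>M lborel. norm (case_prod ?H z) \<le> norm (case z of (\<tau>, x::'a) \<Rightarrow> \<nu> \<tau> * gaussian \<tau> x)"
      by (auto simp: norm_mult)
    have "case_prod ?H \<in> borel_measurable (borel \<Otimes>\<^sub>M borel)" by measurable
    then show "case_prod ?H \<in> borel_measurable (lborel \<Otimes>\<^sub>M lborel)"
      by (simp add: borel_prod lborel_prod)
  qed
  have "fourier_L1 (mix \<nu>) \<xi> = ?c * (LINT x|lborel. LINT \<tau>|lborel. ?H \<tau> x)"
    unfolding fourier_L1_def mix_def by (simp del: of_real_mult)
  also have "\<dots> = ?c * (LINT \<tau>|lborel. LINT x|lborel. ?H \<tau> x)"
    by (subst lborel_pair.Fubini_integral[OF Hint]) simp
  also have "\<dots> = (LINT \<tau>|lborel. ?c * (LINT x|lborel. ?H \<tau> x))" by simp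
  also have "\<dots> = (LINT \<tau>|lborel. ?c * of_real (\<nu> \<tau> * exp (- \<tau> * (norm \<xi>)\<^sup>2)))"
  proof (intro Bochner_Integration.integral_cong refl)
    fix \<tau> :: real
    show "?c * (LINT x|lborel. ?H \<tau> x) = ?c * of_real (\<nu> \<tau> * exp (- \<tau> * (norm \<xi>)\<^sup>2))"
    proof (cases "\<tau> < 1")
      case True
      then show ?thesis using assms by (simp add: mixing_def)
    next
      case False
      then have "\<tau> > 0" by simp
      have "?c * (LINT x|lborel. ?H \<tau> x) = fourier_L1 (\<lambda>x. \<nu> \<tau> * gaussian \<tau> x) \<xi>"
        unfolding fourier_L1_def ..
      also have "\<dots> = of_real (\<nu> \<tau>) * of_real ((2 * pi) powr (- real DIM('a) / 2) * exp (- \<tau> * (norm \<xi>)\<^sup>2))"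
        unfolding fourier_L1_cmult gaussian_integral(3)[OF \<open>\<tau> > 0\<close>] ..
      finally show ?thesis by (simp add: mult_ac)
    qed
  qed
  also have "\<dots> = ?c * of_real (LINT \<tau>|lborel. \<nu> \<tau> * exp (- \<tau> * (norm \<xi>)\<^sup>2))"
    unfolding integral_mult_right_zero integral_complex_of_real ..
  finally show ?thesis by simp
qed

text \<open>Positivity of the heat kernel carries bounds between densities over to the
  mixtures.\<close>

lemma mix_abs_le:
  assumes "mixing \<nu>" "mixing \<kappa>" "\<And>\<tau>. \<bar>\<nu> \<tau>\<bar> \<le> C * \<kappa> \<tau>"
  shows "\<bar>mix \<nu> x\<bar> \<le> C * mix \<kappa> x"
proof -
  have "\<bar>mix \<nu> x\<bar> \<le> (LINT \<tau>|lborel. \<bar>\<nu> \<tau> * gaussian \<tau> x\<bar>)"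
    unfolding mix_def by (rule integral_abs_bound)
  also have "\<dots> \<le> (LINT \<tau>|lborel. C * (\<kappa> \<tau> * gaussian \<tau> x))"
  proof (intro integral_mono)
    show "\<bar>\<nu> \<tau> * gaussian \<tau> x\<bar> \<le> C * (\<kappa> \<tau> * gaussian \<tau> x)" for \<tau>
      using mult_right_mono[OF assms(3)[of \<tau>] gaussian_nonneg[of \<tau> x]] by (simp add: abs_mult mult.assoc)
  qed (use mixing_integrable[OF assms(1), of x] mixing_integrable[OF assms(2), of x] in auto)
  finally show ?thesis by (simp add: mix_def)
qed

lemma mix_tendsto:
  assumes \<nu>: "mixing \<nu>" and X: "X \<longlonglongrightarrow> (x::'a::euclidean_space)"
  shows "(\<lambda>i. mix \<nu> (X i)) \<longlonglongrightarrow> mix \<nu> x"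
  unfolding mix_def
proof (rule integral_dominated_convergence[where w = "\<lambda>\<tau>. \<bar>\<nu> \<tau>\<bar>"])
  have i: "integrable lborel \<nu>" using \<nu> by (simp add: mixing_def)
  then have [measurable]: "\<nu> \<in> borel_measurable borel" by simp
  show "integrable lborel (\<lambda>\<tau>. \<bar>\<nu> \<tau>\<bar>)" using i by simp
  show "(\<lambda>\<tau>. \<nu> \<tau> * gaussian \<tau> x) \<in> borel_measurable lborel"
    "(\<lambda>\<tau>. \<nu> \<tau> * gaussian \<tau> (X i)) \<in> borel_measurable lborel" for i by measurable
  show "AE \<tau> in lborel. (\<lambda>i. \<nu> \<tau> * gaussian \<tau> (X i)) \<longlonglongrightarrow> \<nu> \<tau> * gaussian \<tau> x"
  proof (rule AE_I2)
    fix \<tau>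
    show "(\<lambda>i. \<nu> \<tau> * gaussian \<tau> (X i)) \<longlonglongrightarrow> \<nu> \<tau> * gaussian \<tau> x"
    proof (cases "\<tau> < 1")
      case True
      then show ?thesis using \<nu> by (simp add: mixing_def)
    next
      case False
      then show ?thesis unfolding gaussian_def by (intro tendsto_intros X) auto
    qed
  qed
  show "AE \<tau> in lborel. norm (\<nu> \<tau> * gaussian \<tau> (X i)) \<le> \<bar>\<nu> \<tau>\<bar>" for i
    by (simp add: mixing_bound[OF \<nu>])
qed

section \<open>Power-law mixing densities and their increments\<close>

lemma powr_tail_integrable:
  assumes "e < -1" "a > (0::real)"
  shows "integrable lborel (\<lambda>x. indicator {a..} x * x powr e)"
proof -
  have eq: "(\<lambda>x. indicator {a..} x * x powr e) = (\<lambda>x. if x \<in> {a..} then x powr e else 0)"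
    by (auto simp: indicator_def)
  have "((\<lambda>x. indicator {a..} x * x powr e) has_integral - (a powr (e + 1)) / (e + 1)) UNIV"
    using has_integral_powr_to_inf[OF assms]
    unfolding eq has_integral_restrict_UNIV .
  from nn_integral_has_integral_lborel[OF _ _ this]
  show ?thesis by (intro integrableI_nonneg) auto
qed

lemma powr_near_0_integrable:
  assumes "e > -1" "a \<ge> (0::real)"
  shows "integrable lborel (\<lambda>x. indicator {0..a} x * x powr e)"
proof -
  have eq: "(\<lambda>x. indicator {0..a} x * x powr e) = (\<lambda>x. if x \<in> {0..a} then x powr e else 0)"
    by (auto simp: indicator_def)
  have "((\<lambda>x. indicator {0..a} x * x powr e) has_integral a powr (e + 1) / (e + 1)) UNIV"
    using has_integral_powr_from_0[OF assms]
    unfolding eq has_integral_restrict_UNIV .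
  from nn_integral_has_integral_lborel[OF _ _ this]
  show ?thesis by (intro integrableI_nonneg) auto
qed

lemma powr_neg_diff_le:
  fixes x y b :: real
  assumes "0 < x" "x \<le> y" "b > 0"
  shows "x powr (- b) - y powr (- b) \<le> b * (y - x) * x powr (- b - 1)"
proof (cases "x = y")
  case False
  then have "x < y" using assms by simp
  have "\<And>z. x \<le> z \<Longrightarrow> z \<le> y \<Longrightarrow> ((\<lambda>z. z powr (- b)) has_real_derivative (- b) * z powr (- b - 1)) (at z)"
    using assms by (auto intro!: derivative_eq_intros simp: powr_diff)
  from MVT2[OF \<open>x < y\<close> this] obtain z where z: "x < z" "z < y" "y powr (- b) - x powr (- b) = (y - x) * ((- b) * z powr (- b - 1))"
    by auto
  have "z powr (- b - 1) \<le> x powr (- b - 1)" using assms z by (intro powr_mono2') auto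
  then have "b * (y - x) * z powr (- b - 1) \<le> b * (y - x) * x powr (- b - 1)"
    using assms by (intro mult_left_mono) auto
  then show ?thesis using z(3) by (simp add: algebra_simps)
qed simp

text \<open>
  The mixing density of the profile is \<open>dens s\<close>; it vanishes at 1, so that its derivative is again a density and has no atom.
  It has the decay \<open>\<tau>^(-1-s)\<close> of \<open>tail s\<close>, which is also that of its fractional derivative of order s.
\<close>

definition tail :: "real \<Rightarrow> real \<Rightarrow> real" where
  "tail s \<tau> = indicator {1..} \<tau> * \<tau> powr (-1 - s)"

definition dens :: "real \<Rightarrow> real \<Rightarrow> real" where
  "dens s \<tau> = indicator {1..} \<tau> * (\<tau> powr (-1 - s) - \<tau> powr (-2 - s))"

definition dens' :: "real \<Rightarrow> real \<Rightarrow> real" where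
  "dens' s \<tau> = indicator {1..} \<tau> * (- (1 + s) * \<tau> powr (-2 - s) + (2 + s) * \<tau> powr (-3 - s))"

lemma tail_measurable [measurable]: "tail s \<in> borel_measurable borel"
  and dens_measurable [measurable]: "dens s \<in> borel_measurable borel"
  and dens'_measurable [measurable]: "dens' s \<in> borel_measurable borel"
  unfolding tail_def[abs_def] dens_def[abs_def] dens'_def[abs_def] by measurable

lemma tail_nonneg [simp]: "tail s \<tau> \<ge> 0"
  by (simp add: tail_def)

lemma dens_nonneg [simp]: "dens s \<tau> \<ge> 0"
  by (auto simp: dens_def indicator_def intro!: powr_mono)

lemma dens_le_tail: "dens s \<tau> \<le> tail s \<tau>"
  by (auto simp: dens_def tail_def indicator_def)

lemma mixing_if_le_tail:
  assumes s: "s > 0" and [measurable]: "f \<in> borel_measurable borel" and le: "\<And>\<tau>. \<bar>f \<tau>\<bar> \<le> C * tail s \<tau>"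
  shows "mixing f"
proof -
  have "integrable lborel (tail s)"
    using powr_tail_integrable[of "-1 - s" 1] s by (simp add: tail_def[abs_def])
  then have "integrable lborel (\<lambda>\<tau>. C * tail s \<tau>)" by simp
  then have "integrable lborel f"
    by (rule Bochner_Integration.integrable_bound) (auto intro!: AE_I2 order_trans[OF le])
  moreover have "f \<tau> = 0" if "\<tau> < 1" for \<tau>
    using le[of \<tau>] that by (simp add: tail_def)
  ultimately show ?thesis by (simp add: mixing_def)
qed

lemma mixing_tail: "s > 0 \<Longrightarrow> mixing (tail s)"
  by (rule mixing_if_le_tail[of s _ 1]) auto

lemma mixing_dens: "s > 0 \<Longrightarrow> mixing (dens s)"
  by (rule mixing_if_le_tail[of s _ 1]) (auto simp: dens_le_tail)

lemma dens'_le: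
  assumes "0 < s" "s < 1" shows "\<bar>dens' s \<tau>\<bar> \<le> 5 * tail s \<tau>"
proof (cases "\<tau> \<ge> 1")
  case True
  have 1: "\<tau> powr (-2 - s) \<le> \<tau> powr (-1 - s)" "\<tau> powr (-3 - s) \<le> \<tau> powr (-1 - s)"
    using True by (auto intro: powr_mono)
  have "(1 + s) * \<tau> powr (-2 - s) \<le> 2 * \<tau> powr (-1 - s)" "(2 + s) * \<tau> powr (-3 - s) \<le> 3 * \<tau> powr (-1 - s)"
    using 1 assms by (auto intro!: mult_mono)
  moreover have "0 \<le> (1 + s) * \<tau> powr (-2 - s)" "0 \<le> (2 + s) * \<tau> powr (-3 - s)" "0 \<le> \<tau> powr (-1 - s)"
    using assms by auto
  ultimately have "\<bar>- ((1 + s) * \<tau> powr (-2 - s)) + (2 + s) * \<tau> powr (-3 - s)\<bar> \<le> 5 * \<tau> powr (-1 - s)"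
    by linarith
  moreover have "dens' s \<tau> = - ((1 + s) * \<tau> powr (-2 - s)) + (2 + s) * \<tau> powr (-3 - s)"
    using True by (simp add: dens'_def algebra_simps)
  moreover have "tail s \<tau> = \<tau> powr (-1 - s)"
    using True by (simp add: tail_def)
  ultimately show ?thesis by (simp only:)
qed (simp add: dens'_def tail_def)

lemma tail_half:
  assumes "s > 0" "\<tau> \<ge> 1" "x \<ge> \<tau> / 2"
  shows "x powr (-1 - s) \<le> 2 powr (1 + s) * tail s \<tau>"
proof -
  have "x powr (-1 - s) \<le> (\<tau> / 2) powr (-1 - s)"
    using assms by (intro powr_mono2') auto
  also have "\<dots> = 2 powr (1 + s) * \<tau> powr (-1 - s)"
    using assms by (simp add: powr_divide powr_minus powr_diff divide_simps powr_add)
  finally show ?thesis using assms by (simp add: tail_def)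
qed

text \<open>A Lipschitz bound relative to the tail. If the shift stays above 1, the mean value
  theorem gives 48 l for each of the two powers. If it crosses 1, the zero of \<open>dens s\<close>
  at 1 supplies the factor l.\<close>

lemma dens_diff_small:
  assumes s: "0 < s" "s < 1" and l: "0 < l" "l \<le> 1/2"
  shows "\<bar>dens s \<tau> - dens s (\<tau> - l)\<bar> \<le> 100 * l * tail s \<tau>"
proof (cases "\<tau> \<ge> 1")
  case True
  show ?thesis
  proof (cases "\<tau> - l \<ge> 1")
    case t1: True
    have D: "\<bar>(\<tau> - l) powr (- b) - \<tau> powr (- b)\<bar> \<le> 48 * l * tail s \<tau>" if b: "1 + s \<le> b" "b \<le> 3" for b
    proof -
      have "(\<tau> - l) powr (- b) \<ge> \<tau> powr (- b)"
        using t1 l b s by (intro powr_mono2') auto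
      moreover have "(\<tau> - l) powr (- b) - \<tau> powr (- b) \<le> b * (\<tau> - (\<tau> - l)) * (\<tau> - l) powr (- b - 1)"
        using t1 l b s by (intro powr_neg_diff_le) auto
      moreover have "b * (\<tau> - (\<tau> - l)) * (\<tau> - l) powr (- b - 1) \<le> 3 * l * (16 * tail s \<tau>)"
      proof -
        have "(\<tau> - l) powr (- b - 1) \<le> (\<tau> - l) powr (-1 - s)"
          using t1 b by (intro powr_mono) auto
        also have "\<dots> \<le> 2 powr (1 + s) * tail s \<tau>"
          using t1 True l s by (intro tail_half) auto
        also have "\<dots> \<le> 16 * tail s \<tau>"
        proof (rule mult_right_mono)
          have "2 powr (1 + s) \<le> 2 powr (4::real)" using s by (intro powr_mono) auto
          then show "2 powr (1 + s) \<le> 16" by simp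
        qed simp
        finally show ?thesis using b s l by (intro mult_mono) auto
      qed
      ultimately show ?thesis by simp
    qed
    have "dens s \<tau> - dens s (\<tau> - l) = - ((\<tau> - l) powr (- (1 + s)) - \<tau> powr (- (1 + s))) + ((\<tau> - l) powr (- (2 + s)) - \<tau> powr (- (2 + s)))"
      using t1 l by (simp add: dens_def)
    then show ?thesis using D[of "1 + s"] D[of "2 + s"] s l mult_nonneg_nonneg[of l "tail s \<tau>"] by simp
  next
    case False
    have "dens s \<tau> \<le> l * tail s \<tau>"
    proof -
      have "\<tau> powr (-2 - s) = \<tau> powr (-1 - s) / \<tau>"
        using True powr_diff[of \<tau> "-1 - s" 1] by simp
      then have "dens s \<tau> = tail s \<tau> * ((\<tau> - 1) / \<tau>)"
        using True by (simp add: dens_def tail_def field_simps)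
      also have "\<dots> \<le> tail s \<tau> * l"
      proof (rule mult_left_mono)
        have "\<tau> - 1 \<le> l * 1" using False by simp
        also have "\<dots> \<le> l * \<tau>" using True l by (intro mult_left_mono) auto
        finally show "(\<tau> - 1) / \<tau> \<le> l" using True by (simp add: field_simps)
      qed simp
      finally show ?thesis by (simp add: mult.commute)
    qed
    moreover have "dens s (\<tau> - l) = 0" using False by (simp add: dens_def)
    moreover have "0 \<le> dens s \<tau>" "0 \<le> l * tail s \<tau>" using l by auto
    ultimately have "\<bar>dens s \<tau> - dens s (\<tau> - l)\<bar> \<le> 100 * (l * tail s \<tau>)" by linarith
    then show ?thesis by (simp only: mult.assoc)
  qed
next
  case False
  then show ?thesis using l by (simp add: dens_def tail_def)
qed

text \<open>The part of the kernel majorant that does not depend on \<tau>. Near 0 the increment of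
  the density gains a factor l, which lowers the singularity to l^(-s), integrable for s <
  1.\<close>

definition levy_majorant :: "real \<Rightarrow> real \<Rightarrow> real" where
  "levy_majorant s l = indicator {0..1/2} l * l powr (- s) + indicator {1/2..} l * l powr (-1 - s)"

lemma levy_majorant_integrable:
  assumes "0 < s" "s < 1" shows "integrable lborel (levy_majorant s)"
  unfolding levy_majorant_def[abs_def]
  using powr_near_0_integrable[of "- s" "1/2"] powr_tail_integrable[of "-1 - s" "1/2"] assms
  by (intro Bochner_Integration.integrable_add) auto

lemma levy_majorant_nonneg [simp]: "levy_majorant s l \<ge> 0"
  by (simp add: levy_majorant_def)

text \<open>Integrated over l, the right side is a multiple of \<open>tail s \<tau>\<close>, the
  decay wanted for \<open>fdens s\<close>. Small l use the Lipschitz bound, large l the triangle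
  inequality.\<close>

lemma levy_kernel_bound:
  assumes s: "0 < s" "s < 1" and l: "l > 0"
  shows "\<bar>dens s \<tau> - dens s (\<tau> - l)\<bar> * l powr (-1 - s) \<le> 100 * tail s \<tau> * (levy_majorant s l + tail s (\<tau> - l))"
proof (cases "l \<le> 1/2")
  case True
  have "\<bar>dens s \<tau> - dens s (\<tau> - l)\<bar> * l powr (-1 - s) \<le> (100 * l * tail s \<tau>) * l powr (-1 - s)"
    by (intro mult_right_mono dens_diff_small s l True) simp
  also have "\<dots> = 100 * tail s \<tau> * (l * l powr (-1 - s))" by simp
  also have "l * l powr (-1 - s) = l powr (- s)" using powr_mult_base[of l "-1 - s"] l by simp
  also have "\<dots> \<le> levy_majorant s l + tail s (\<tau> - l)"
    using l True by (auto simp: levy_majorant_def indicator_def)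
  finally show ?thesis by (simp add: mult_left_mono)
next
  case False
  then have m: "l powr (-1 - s) \<le> levy_majorant s l" by (simp add: levy_majorant_def indicator_def)
  show ?thesis
  proof (cases "\<tau> \<ge> 1")
    case t: True
    have l1: "l powr (-1 - s) \<ge> 0" by simp
    have p4: "2 powr (1 + s) \<le> 4"
    proof -
      have "2 powr (1 + s) \<le> 2 powr (2::real)" using s by (intro powr_mono) auto
      then show ?thesis by simp
    qed
    \<comment> \<open>A convolution of two power tails: as l and \<tau> - l add up to \<tau>, one of
      them is at least \<tau>/2, and its factor is at most 4 \<open>tail s \<tau>\<close>.\<close>
    have shift: "tail s (\<tau> - l) * l powr (-1 - s) \<le> 4 * tail s \<tau> * (levy_majorant s l + tail s (\<tau> - l))"
    proof (cases "l \<ge> \<tau> / 2")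
      case True
      have "l powr (-1 - s) \<le> 4 * tail s \<tau>"
        using order_trans[OF tail_half[OF s(1) t True] mult_right_mono[OF p4 tail_nonneg]] .
      then have "tail s (\<tau> - l) * l powr (-1 - s) \<le> tail s (\<tau> - l) * (4 * tail s \<tau>)"
        by (intro mult_left_mono) auto
      also have "\<dots> \<le> 4 * tail s \<tau> * (levy_majorant s l + tail s (\<tau> - l))"
        by (simp add: algebra_simps)
      finally show ?thesis .
    next
      case False
      have "tail s (\<tau> - l) \<le> (\<tau> - l) powr (-1 - s)"
        by (simp add: tail_def indicator_def)
      also have "\<dots> \<le> 4 * tail s \<tau>"
        using order_trans[OF tail_half[OF s(1) t] mult_right_mono[OF p4 tail_nonneg]] False by simp
      finally have "tail s (\<tau> - l) * l powr (-1 - s) \<le> 4 * tail s \<tau> * levy_majorant s l"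
        using m by (intro mult_mono) auto
      also have "\<dots> \<le> 4 * tail s \<tau> * (levy_majorant s l + tail s (\<tau> - l))"
        by (intro mult_left_mono) auto
      finally show ?thesis .
    qed
    have "\<bar>dens s \<tau> - dens s (\<tau> - l)\<bar> \<le> tail s \<tau> + tail s (\<tau> - l)"
      using dens_le_tail[of s \<tau>] dens_le_tail[of s "\<tau> - l"] dens_nonneg[of s \<tau>] dens_nonneg[of s "\<tau> - l"] by linarith
    then have "\<bar>dens s \<tau> - dens s (\<tau> - l)\<bar> * l powr (-1 - s) \<le> (tail s \<tau> + tail s (\<tau> - l)) * l powr (-1 - s)"
      by (intro mult_right_mono) auto
    also have "\<dots> \<le> tail s \<tau> * (levy_majorant s l + tail s (\<tau> - l)) + 4 * tail s \<tau> * (levy_majorant s l + tail s (\<tau> - l))"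
      unfolding distrib_right using m by (intro add_mono shift mult_left_mono) (auto intro: add_increasing2)
    also have "\<dots> \<le> 100 * tail s \<tau> * (levy_majorant s l + tail s (\<tau> - l))"
    proof -
      have "0 \<le> tail s \<tau> * (levy_majorant s l + tail s (\<tau> - l))" by simp
      then show ?thesis by linarith
    qed
    finally show ?thesis .
  qed (use l in \<open>auto simp: dens_def tail_def\<close>)
qed

section \<open>Fractional derivatives of the mixing density\<close>

text \<open>
  \<open>fdens s\<close> is the Marchaud derivative of order s of \<open>dens s\<close>. Since
  \<open>\<integral> (1 - exp (- l \<rho>)) l^(-1-s) dl\<close> is a multiple of \<open>\<rho>^s\<close>, it multiplies the Laplace transform by \<open>\<rho>^s\<close>,
  and \<open>\<rho> = |\<xi>|^2\<close> is the Fourier side of the mixture.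
\<close>

definition levy_const :: "real \<Rightarrow> real" where
  "levy_const s = (LINT l|lborel. indicator {0<..} l * ((1 - exp (- l)) * l powr (-1 - s)))"

definition fdens :: "real \<Rightarrow> real \<Rightarrow> real" where
  "fdens s \<tau> = inverse (levy_const s) * (LINT l|lborel. indicator {0<..} l * ((dens s \<tau> - dens s (\<tau> - l)) * l powr (-1 - s)))"

lemma levy_const_integrable:
  fixes s :: real
  assumes s: "0 < s" "s < 1"
  shows "integrable lborel (\<lambda>l. indicator {0<..} l * ((1 - exp (- l)) * l powr (-1 - s)))"
proof (rule Bochner_Integration.integrable_bound[OF levy_majorant_integrable[OF s]])
  show "AE l in lborel. norm (indicator {0<..} l * ((1 - exp (- l)) * l powr (-1 - s))) \<le> norm (levy_majorant s l)"
  proof (rule AE_I2)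
    fix l :: real
    show "norm (indicator {0<..} l * ((1 - exp (- l)) * l powr (-1 - s))) \<le> norm (levy_majorant s l)"
    proof (cases "l > 0")
      case l: True
      have e: "1 - exp (- l) \<le> l" "1 - exp (- l) \<le> 1" "0 \<le> 1 - exp (- l)"
        using exp_ge_add_one_self[of "- l"] l by auto
      have "(1 - exp (- l)) * l powr (-1 - s) \<le> levy_majorant s l"
      proof (cases "l \<le> 1/2")
        case True
        have "(1 - exp (- l)) * l powr (-1 - s) \<le> l * l powr (-1 - s)"
          using e by (intro mult_right_mono) auto
        also have "\<dots> = l powr (- s)" using powr_mult_base[of l "-1 - s"] l by simp
        also have "\<dots> \<le> levy_majorant s l" using True l by (simp add: levy_majorant_def indicator_def)
        finally show ?thesis .
      next
        case False
        have "(1 - exp (- l)) * l powr (-1 - s) \<le> 1 * l powr (-1 - s)"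
          using e by (intro mult_right_mono) auto
        also have "\<dots> \<le> levy_majorant s l" using False l by (simp add: levy_majorant_def indicator_def)
        finally show ?thesis .
      qed
      then show ?thesis using l e by (simp add: abs_mult)
    qed simp
  qed
qed measurable

lemma levy_const_pos:
  assumes s: "0 < s" "s < 1" shows "levy_const s > 0"
proof -
  let ?f = "\<lambda>l. indicator {0<..} l * ((1 - exp (- l)) * l powr (-1 - s))"
  have nn: "?f l \<ge> 0" for l by (simp add: indicator_def)
  have "levy_const s \<noteq> 0"
  proof
    assume "levy_const s = 0"
    then have "AE l in lborel. ?f l = 0"
      unfolding levy_const_def
      using integral_nonneg_eq_0_iff_AE[OF levy_const_integrable[OF s]] nn by auto
    then have "AE l in lborel. l \<notin> {0<..<1::real}"
      by eventually_elim (auto simp: indicator_def split: if_splits)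
    then have "emeasure lborel {l::real. l \<in> {0<..<1}} = 0"
      by (subst (asm) AE_iff_measurable[OF _ refl]) auto
    moreover have "{l::real. l \<in> {0<..<1}} = {0<..<1}" by auto
    ultimately show False by simp
  qed
  moreover have "levy_const s \<ge> 0" unfolding levy_const_def using nn by (intro Bochner_Integration.integral_nonneg) auto
  ultimately show ?thesis by simp
qed

text \<open>The substitution l to \<rho> l in \<open>levy_const\<close>: the kernel l^(-1-s) dl is
  homogeneous of degree -s.\<close>

lemma levy_laplace:
  fixes s \<rho> :: real
  assumes s: "0 < s" "s < 1" and \<rho>: "\<rho> \<ge> 0"
  shows "(LINT l|lborel. indicator {0<..} l * ((1 - exp (- l * \<rho>)) * l powr (-1 - s))) = levy_const s * \<rho> powr s"
proof (cases "\<rho> = 0")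
  case False
  then have r: "\<rho> > 0" using \<rho> by simp
  have "levy_const s = \<rho> * (LINT l|lborel. indicator {0<..} (0 + \<rho> * l) * ((1 - exp (- (0 + \<rho> * l))) * (0 + \<rho> * l) powr (-1 - s)))"
    unfolding levy_const_def using r by (subst lborel_integral_real_affine[of \<rho> _ 0]) auto
  also have "\<dots> = \<rho> * (LINT l|lborel. \<rho> powr (-1 - s) * (indicator {0<..} l * ((1 - exp (- l * \<rho>)) * l powr (-1 - s))))"
    using r by (intro arg_cong[where f = "\<lambda>x. \<rho> * x"] Bochner_Integration.integral_cong)
      (auto simp: indicator_def powr_mult zero_less_mult_iff mult_ac)
  also have "\<dots> = (\<rho> * \<rho> powr (-1 - s)) * (LINT l|lborel. indicator {0<..} l * ((1 - exp (- l * \<rho>)) * l powr (-1 - s)))"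
    by simp
  also have "\<rho> * \<rho> powr (-1 - s) = \<rho> powr (- s)" using powr_mult_base[of \<rho> "-1 - s"] r by simp
  finally show ?thesis using r by (simp add: powr_minus field_simps)
qed simp

lemma levy_kernel_measurable:
  "(\<lambda>(\<tau>, l). indicator {0<..} l * ((dens s \<tau> - dens s (\<tau> - l)) * l powr (-1 - s))) \<in> borel_measurable (lborel \<Otimes>\<^sub>M (lborel :: real measure))"
proof -
  have "(\<lambda>(\<tau>, l). indicator {0<..} l * ((dens s \<tau> - dens s (\<tau> - l)) * l powr (-1 - s))) \<in> borel_measurable (borel \<Otimes>\<^sub>M borel)"
    by measurable
  then show ?thesis by (simp add: borel_prod lborel_prod)
qed

lemma tail_reflect:
  assumes "s > 0"
  shows "integrable lborel (\<lambda>l. tail s (\<tau> - l))" "(LINT l|lborel. tail s (\<tau> - l)) = (LINT l|lborel. tail s l)"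
proof -
  have i: "integrable lborel (tail s)" using mixing_tail[OF assms] by (simp add: mixing_def)
  show "integrable lborel (\<lambda>l. tail s (\<tau> - l))"
    using lborel_integrable_real_affine[OF i, of "-1" \<tau>] by simp
  show "(LINT l|lborel. tail s (\<tau> - l)) = (LINT l|lborel. tail s l)"
    using lborel_integral_real_affine[of "-1" "tail s" \<tau>] by simp
qed

definition levy_bound :: "real \<Rightarrow> real" where
  "levy_bound s = 100 * ((LINT l|lborel. levy_majorant s l) + (LINT l|lborel. tail s l))"

lemma levy_kernel_integral:
  assumes s: "0 < s" "s < 1"
  defines "H \<equiv> \<lambda>\<tau> l. indicator {0<..} l * ((dens s \<tau> - dens s (\<tau> - l)) * l powr (-1 - s))"
  shows "integrable lborel (H \<tau>)" and "(LINT l|lborel. norm (H \<tau> l)) \<le> levy_bound s * tail s \<tau>"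
proof -
  let ?M = "\<lambda>l. 100 * tail s \<tau> * (levy_majorant s l + tail s (\<tau> - l))"
  have mi: "integrable lborel ?M"
    using levy_majorant_integrable[OF s] tail_reflect(1)[OF s(1)] by simp
  have le: "norm (H \<tau> l) \<le> ?M l" for l
    using levy_kernel_bound[OF s, of l \<tau>] by (cases "l > 0") (auto simp: H_def abs_mult)
  have [measurable]: "H \<tau> \<in> borel_measurable borel" unfolding H_def by measurable
  show i: "integrable lborel (H \<tau>)"
    by (rule Bochner_Integration.integrable_bound[OF mi]) (auto intro!: AE_I2 order_trans[OF le] simp del: real_norm_def, simp)
  have "(LINT l|lborel. norm (H \<tau> l)) \<le> (LINT l|lborel. ?M l)"
    using i by (intro integral_mono mi le) auto
  also have "\<dots> = 100 * tail s \<tau> * ((LINT l|lborel. levy_majorant s l) + (LINT l|lborel. tail s (\<tau> - l)))"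
    using levy_majorant_integrable[OF s] tail_reflect(1)[OF s(1)] by simp
  finally show "(LINT l|lborel. norm (H \<tau> l)) \<le> levy_bound s * tail s \<tau>"
    by (simp add: tail_reflect(2)[OF s(1)] levy_bound_def mult_ac)
qed

lemma fdens_measurable [measurable]: "fdens s \<in> borel_measurable borel"
proof -
  have "(\<lambda>\<tau>. LINT l|lborel. indicator {0<..} l * ((dens s \<tau> - dens s (\<tau> - l)) * l powr (-1 - s))) \<in> borel_measurable lborel"
    using lborel.borel_measurable_lebesgue_integral[OF levy_kernel_measurable] by simp
  then have "(\<lambda>\<tau>. LINT l|lborel. indicator {0<..} l * ((dens s \<tau> - dens s (\<tau> - l)) * l powr (-1 - s))) \<in> borel_measurable borel"
    by simp
  then show ?thesis unfolding fdens_def[abs_def] by measurable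
qed

lemma fdens_le:
  assumes s: "0 < s" "s < 1"
  shows "\<bar>fdens s \<tau>\<bar> \<le> (inverse (levy_const s) * levy_bound s) * tail s \<tau>"
proof -
  let ?H = "\<lambda>l. indicator {0<..} l * ((dens s \<tau> - dens s (\<tau> - l)) * l powr (-1 - s))"
  have "norm (LINT l|lborel. ?H l) \<le> (LINT l|lborel. norm (?H l))" by (rule integral_norm_bound)
  also have "\<dots> \<le> levy_bound s * tail s \<tau>" by (rule levy_kernel_integral(2)[OF s])
  finally have "\<bar>LINT l|lborel. ?H l\<bar> \<le> levy_bound s * tail s \<tau>" by simp
  from mult_left_mono[OF this, of "inverse (levy_const s)"] show ?thesis
    using levy_const_pos[OF s] by (simp only: fdens_def abs_mult abs_of_pos mult.assoc positive_imp_inverse_positive less_imp_le)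
qed

lemma dens_diff_laplace:
  assumes s: "0 < s" and \<rho>: "\<rho> \<ge> 0"
  shows "integrable lborel (\<lambda>\<tau>. dens s \<tau> * exp (- \<tau> * \<rho>))"
    and "integrable lborel (\<lambda>\<tau>. dens s (\<tau> - l) * exp (- \<tau> * \<rho>))"
    and "(LINT \<tau>|lborel. dens s (\<tau> - l) * exp (- \<tau> * \<rho>)) = exp (- l * \<rho>) * (LINT \<tau>|lborel. dens s \<tau> * exp (- \<tau> * \<rho>))"
proof -
  have ki: "integrable lborel (tail s)" using mixing_tail[OF s(1)] by (simp add: mixing_def)
  show ni: "integrable lborel (\<lambda>\<tau>. dens s \<tau> * exp (- \<tau> * \<rho>))"
  proof (rule Bochner_Integration.integrable_bound[OF ki])
    show "AE \<tau> in lborel. norm (dens s \<tau> * exp (- \<tau> * \<rho>)) \<le> norm (tail s \<tau>)"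
    proof (rule AE_I2)
      fix \<tau>
      show "norm (dens s \<tau> * exp (- \<tau> * \<rho>)) \<le> norm (tail s \<tau>)"
      proof (cases "\<tau> \<ge> 1")
        case True
        then have "exp (- \<tau> * \<rho>) \<le> 1" using \<rho> by simp
        from mult_mono[OF dens_le_tail[of s \<tau>] this] show ?thesis by (simp add: abs_mult)
      qed (simp add: dens_def)
    qed
  qed measurable
  have sh: "dens s (\<tau> - l) * exp (- \<tau> * \<rho>) = exp (- l * \<rho>) * (dens s (- l + 1 * \<tau>) * exp (- (- l + 1 * \<tau>) * \<rho>))" for \<tau>
    by (simp add: algebra_simps flip: exp_add)
  show "integrable lborel (\<lambda>\<tau>. dens s (\<tau> - l) * exp (- \<tau> * \<rho>))"
    unfolding sh by (intro integrable_mult_right lborel_integrable_real_affine[OF ni]) simp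
  show "(LINT \<tau>|lborel. dens s (\<tau> - l) * exp (- \<tau> * \<rho>)) = exp (- l * \<rho>) * (LINT \<tau>|lborel. dens s \<tau> * exp (- \<tau> * \<rho>))"
    unfolding sh integral_mult_right_zero
    using lborel_integral_real_affine[of 1 "\<lambda>\<tau>. dens s \<tau> * exp (- \<tau> * \<rho>)" "- l"] by simp
qed

text \<open>A shift of the density by l multiplies its Laplace transform by exp (- l \<rho>). After
  Fubini only the integral of (1 - exp (- l \<rho>)) l^(-1-s) is left, and that is
  \<open>levy_laplace\<close>.\<close>

lemma fdens_laplace:
  assumes s: "0 < s" "s < 1" and \<rho>: "\<rho> \<ge> 0"
  shows "(LINT \<tau>|lborel. fdens s \<tau> * exp (- \<tau> * \<rho>)) = \<rho> powr s * (LINT \<tau>|lborel. dens s \<tau> * exp (- \<tau> * \<rho>))"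
proof -
  let ?H = "\<lambda>\<tau> l. indicator {0<..} l * ((dens s \<tau> - dens s (\<tau> - l)) * l powr (-1 - s))"
  let ?K = "\<lambda>\<tau> l. ?H \<tau> l * exp (- \<tau> * \<rho>)"
  define N where "N = (LINT \<tau>|lborel. dens s \<tau> * exp (- \<tau> * \<rho>))"
  have ki: "integrable lborel (tail s)" using mixing_tail[OF s(1)] by (simp add: mixing_def)
  have Kint: "integrable (lborel \<Otimes>\<^sub>M lborel) (case_prod ?K)"
  proof (rule lborel_pair.Fubini_integrable)
    have "case_prod ?K \<in> borel_measurable (borel \<Otimes>\<^sub>M borel)" by measurable
    then show m: "case_prod ?K \<in> borel_measurable (lborel \<Otimes>\<^sub>M lborel)"
      by (simp add: borel_prod lborel_prod)
    show "AE \<tau> in lborel. integrable lborel (\<lambda>l. case (\<tau>, l) of (\<tau>, l) \<Rightarrow> ?K \<tau> l)"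
      using levy_kernel_integral(1)[OF s] by simp
    have "integrable lborel (\<lambda>\<tau>. levy_bound s * tail s \<tau>)" using ki by simp
    then show "integrable lborel (\<lambda>\<tau>. LINT l|lborel. norm (case (\<tau>, l) of (\<tau>, l) \<Rightarrow> ?K \<tau> l))"
    proof (rule Bochner_Integration.integrable_bound)
      have "(\<lambda>z. norm (case_prod ?K z)) \<in> borel_measurable (lborel \<Otimes>\<^sub>M lborel)" by (rule measurable_compose[OF m borel_measurable_norm])
      then show "(\<lambda>\<tau>. LINT l|lborel. norm (case (\<tau>, l) of (\<tau>, l) \<Rightarrow> ?K \<tau> l)) \<in> borel_measurable lborel"
        by (intro lborel.borel_measurable_lebesgue_integral) (simp add: case_prod_beta')
      show "AE \<tau> in lborel. norm (LINT l|lborel. norm (case (\<tau>, l) of (\<tau>, l) \<Rightarrow> ?K \<tau> l)) \<le> norm (levy_bound s * tail s \<tau>)"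
      proof (rule AE_I2)
        fix \<tau>
        define X where "X = (LINT l|lborel. norm (?H \<tau> l))"
        have X0: "X \<ge> 0" unfolding X_def by simp
        have XB: "X \<le> levy_bound s * tail s \<tau>" unfolding X_def by (rule levy_kernel_integral(2)[OF s])
        have "(LINT l|lborel. norm (case (\<tau>, l) of (\<tau>, l) \<Rightarrow> ?K \<tau> l)) = X * exp (- \<tau> * \<rho>)"
          unfolding X_def by (simp add: abs_mult flip: integral_mult_left_zero)
        \<comment> \<open>The exponential may exceed 1 for negative \<tau>, but below 1 the bound
          \<open>XB\<close> by the tail forces X = 0.\<close>
        moreover have "X * exp (- \<tau> * \<rho>) \<le> levy_bound s * tail s \<tau>"
        proof (cases "\<tau> \<ge> 1")
          case True
          then have "X * exp (- \<tau> * \<rho>) \<le> X * 1" using \<rho> X0 by (intro mult_left_mono) auto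
          then show ?thesis using XB by simp
        next
          case False
          then have "X = 0" using XB X0 by (simp add: tail_def)
          then show ?thesis using XB by simp
        qed
        ultimately show "norm (LINT l|lborel. norm (case (\<tau>, l) of (\<tau>, l) \<Rightarrow> ?K \<tau> l)) \<le> norm (levy_bound s * tail s \<tau>)"
          using mult_nonneg_nonneg[OF X0 exp_ge_zero, of "- \<tau> * \<rho>"] unfolding real_norm_def by linarith
      qed
    qed
  qed
  have inner: "(LINT \<tau>|lborel. ?K \<tau> l) = N * (indicator {0<..} l * ((1 - exp (- l * \<rho>)) * l powr (-1 - s)))" for l
  proof -
    have "(LINT \<tau>|lborel. ?K \<tau> l) = (LINT \<tau>|lborel. (indicator {0<..} l * l powr (-1 - s)) * (dens s \<tau> * exp (- \<tau> * \<rho>) - dens s (\<tau> - l) * exp (- \<tau> * \<rho>)))"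
      by (intro Bochner_Integration.integral_cong) (auto simp: algebra_simps)
    also have "\<dots> = (indicator {0<..} l * l powr (-1 - s)) * (N - exp (- l * \<rho>) * N)"
      unfolding integral_mult_right_zero Bochner_Integration.integral_diff[OF dens_diff_laplace(1,2)[OF s(1) \<rho>]] dens_diff_laplace(3)[OF s(1) \<rho>] N_def ..
    finally show ?thesis by (simp add: algebra_simps)
  qed
  have "(LINT \<tau>|lborel. fdens s \<tau> * exp (- \<tau> * \<rho>)) = inverse (levy_const s) * (LINT \<tau>|lborel. LINT l|lborel. ?K \<tau> l)"
    unfolding fdens_def integral_mult_left_zero mult.assoc[of "inverse (levy_const s)"] integral_mult_right_zero ..
  also have "(LINT \<tau>|lborel. LINT l|lborel. ?K \<tau> l) = (LINT l|lborel. LINT \<tau>|lborel. ?K \<tau> l)"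
    by (rule lborel_pair.Fubini_integral[symmetric, OF Kint])
  also have "\<dots> = N * (levy_const s * \<rho> powr s)"
    unfolding inner integral_mult_right_zero levy_laplace[OF s \<rho>] ..
  finally show ?thesis using levy_const_pos[OF s] by (simp add: N_def)
qed

lemma dens_has_derivative:
  assumes "\<tau> \<noteq> 1" "s > 0"
  shows "(dens s has_real_derivative dens' s \<tau>) (at \<tau>)"
proof (cases "\<tau> > 1")
  case True
  have "((\<lambda>\<tau>. \<tau> powr (-1 - s) - \<tau> powr (-2 - s)) has_real_derivative dens' s \<tau>) (at \<tau>)"
  proof -
    have "0 < \<tau>" using True by simp
    from DERIV_diff[OF has_real_derivative_powr[OF this, of "-1 - s"] has_real_derivative_powr[OF this, of "-2 - s"]]
    have "((\<lambda>\<tau>. \<tau> powr (-1 - s) - \<tau> powr (-2 - s)) has_real_derivative (-1 - s) * \<tau> powr (-1 - s - 1) - (-2 - s) * \<tau> powr (-2 - s - 1)) (at \<tau>)" .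
    moreover have "-1 - s - 1 = -2 - s" "-2 - s - 1 = -3 - s" by auto
    moreover have "dens' s \<tau> = (-1 - s) * \<tau> powr (-2 - s) - (-2 - s) * \<tau> powr (-3 - s)"
      using True by (simp add: dens'_def algebra_simps)
    ultimately show ?thesis by (simp only:)
  qed
  then show ?thesis
    by (rule has_field_derivative_transform_within_open[of _ _ _ "{1<..}"]) (use True in \<open>auto simp: dens_def\<close>)
next
  case False
  then have "\<tau> < 1" using assms by simp
  have "((\<lambda>_. 0) has_real_derivative dens' s \<tau>) (at \<tau>)" using \<open>\<tau> < 1\<close> by (simp add: dens'_def)
  then show ?thesis
    by (rule has_field_derivative_transform_within_open[of _ _ _ "{..<1}"]) (use \<open>\<tau> < 1\<close> in \<open>auto simp: dens_def\<close>)
qed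

text \<open>Instead of an integration by parts, backward difference quotients pass to the limit:
  \<open>dens_diff_small\<close> dominates them, also across the corner at 1, and their transforms
  carry the factor (1 - exp (- l \<rho>))/l, which tends to \<rho>.\<close>

lemma dens'_laplace:
  assumes s: "0 < s" "s < 1" and \<rho>: "\<rho> \<ge> 0"
  shows "(LINT \<tau>|lborel. dens' s \<tau> * exp (- \<tau> * \<rho>)) = \<rho> * (LINT \<tau>|lborel. dens s \<tau> * exp (- \<tau> * \<rho>))"
proof -
  define N where "N = (LINT \<tau>|lborel. dens s \<tau> * exp (- \<tau> * \<rho>))"
  \<comment> \<open>The double \<open>Suc\<close> keeps the step sizes at most 1/2, as
    \<open>dens_diff_small\<close> requires.\<close>
  let ?l = "\<lambda>i. inverse (real (Suc (Suc i)))"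
  have l: "0 < ?l i" "?l i \<le> 1/2" for i by (auto simp: field_simps)
  have l0: "?l \<longlonglongrightarrow> 0" using LIMSEQ_Suc[OF LIMSEQ_inverse_real_of_nat] .
  let ?q = "\<lambda>i \<tau>. (dens s \<tau> - dens s (\<tau> - ?l i)) / ?l i * exp (- \<tau> * \<rho>)"
  have ki: "integrable lborel (\<lambda>\<tau>. 100 * tail s \<tau>)" using mixing_tail[OF s(1)] by (simp add: mixing_def)
  have "(\<lambda>i. LINT \<tau>|lborel. ?q i \<tau>) \<longlonglongrightarrow> (LINT \<tau>|lborel. dens' s \<tau> * exp (- \<tau> * \<rho>))"
  proof (rule integral_dominated_convergence[OF _ _ ki])
    show "AE \<tau> in lborel. (\<lambda>i. ?q i \<tau>) \<longlonglongrightarrow> dens' s \<tau> * exp (- \<tau> * \<rho>)"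
      using AE_lborel_singleton[of 1]
    proof eventually_elim
      case (elim \<tau>)
      have "((\<lambda>h. (dens s (\<tau> + h) - dens s \<tau>) / h) \<longlongrightarrow> dens' s \<tau>) (at 0)"
        using dens_has_derivative[OF elim s(1)] by (simp add: DERIV_def)
      moreover have "filterlim (\<lambda>i. - ?l i) (at 0) sequentially"
        using tendsto_minus[OF l0] by (auto simp: filterlim_at)
      ultimately have "(\<lambda>i. (dens s (\<tau> + - ?l i) - dens s \<tau>) / - ?l i) \<longlonglongrightarrow> dens' s \<tau>"
        by (rule filterlim_compose)
      moreover have "(dens s (\<tau> + - ?l i) - dens s \<tau>) / - ?l i = (dens s \<tau> - dens s (\<tau> - ?l i)) / ?l i" for i
        by (metis add_uminus_conv_diff minus_diff_eq minus_divide_divide)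
      ultimately have "(\<lambda>i. (dens s \<tau> - dens s (\<tau> - ?l i)) / ?l i) \<longlonglongrightarrow> dens' s \<tau>" by (simp only:)
      then show ?case by (rule tendsto_mult[OF _ tendsto_const])
    qed
    show "AE \<tau> in lborel. norm (?q i \<tau>) \<le> 100 * tail s \<tau>" for i
    proof (rule AE_I2)
      fix \<tau>
      show "norm (?q i \<tau>) \<le> 100 * tail s \<tau>"
      proof (cases "\<tau> \<ge> 1")
        case True
        have "\<bar>dens s \<tau> - dens s (\<tau> - ?l i)\<bar> / ?l i \<le> 100 * tail s \<tau>"
          using dens_diff_small[OF s l, of \<tau> i] l(1)[of i] by (simp only: pos_divide_le_eq mult_ac)
        then have "\<bar>dens s \<tau> - dens s (\<tau> - ?l i)\<bar> / ?l i * exp (- \<tau> * \<rho>) \<le> 100 * tail s \<tau> * 1"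
          using True \<rho> by (intro mult_mono) auto
        then show ?thesis using l(1)[of i] by (simp only: real_norm_def abs_mult abs_divide abs_of_pos exp_gt_zero)
      next
        case False
        then have "\<tau> - ?l i < 1" using l(1)[of i] by linarith
        then have "dens s (\<tau> - ?l i) = 0" unfolding dens_def by (simp only: indicator_def atLeast_iff) simp
        moreover have "dens s \<tau> = 0" using False by (simp add: dens_def)
        ultimately show ?thesis by (simp only:) simp
      qed
    qed
  qed measurable
  moreover have "(LINT \<tau>|lborel. ?q i \<tau>) = N * ((1 - exp (- ?l i * \<rho>)) / ?l i)" for i
  proof -
    have "(LINT \<tau>|lborel. ?q i \<tau>) = (LINT \<tau>|lborel. inverse (?l i) * (dens s \<tau> * exp (- \<tau> * \<rho>) - dens s (\<tau> - ?l i) * exp (- \<tau> * \<rho>)))"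
      by (intro Bochner_Integration.integral_cong) (auto simp: algebra_simps divide_inverse)
    also have "\<dots> = inverse (?l i) * (N - exp (- ?l i * \<rho>) * N)"
      unfolding integral_mult_right_zero Bochner_Integration.integral_diff[OF dens_diff_laplace(1,2)[OF s(1) \<rho>]] dens_diff_laplace(3)[OF s(1) \<rho>] N_def ..
    finally show ?thesis by (simp add: divide_inverse algebra_simps)
  qed
  moreover have "(\<lambda>i. N * ((1 - exp (- ?l i * \<rho>)) / ?l i)) \<longlonglongrightarrow> N * \<rho>"
  proof (rule tendsto_mult[OF tendsto_const])
    have "((\<lambda>h. - exp (- h * \<rho>)) has_real_derivative \<rho>) (at 0)"
      by (auto intro!: derivative_eq_intros)
    then have "((\<lambda>h. (1 - exp (- h * \<rho>)) / h) \<longlongrightarrow> \<rho>) (at 0)" by (simp add: DERIV_def)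
    moreover have "filterlim ?l (at 0) sequentially"
      using l0 by (auto simp: filterlim_at)
    ultimately show "(\<lambda>i. (1 - exp (- ?l i * \<rho>)) / ?l i) \<longlonglongrightarrow> \<rho>" by (rule filterlim_compose)
  qed
  ultimately have "(LINT \<tau>|lborel. dens' s \<tau> * exp (- \<tau> * \<rho>)) = N * \<rho>"
    by (intro LIMSEQ_unique) (simp_all only:)
  then show ?thesis by (simp add: N_def mult.commute)
qed

section \<open>A profile dominating its fractional Laplacian\<close>

lemma gaussian_le_shift:
  assumes "\<tau> \<ge> 1"
  shows "gaussian \<tau> (x::'a::euclidean_space) \<le> 2 powr (real DIM('a) / 2) * gaussian (\<tau> + 1) x"
proof -
  have "(4 * pi * \<tau>) powr (- real DIM('a) / 2) = (2 * (4 * pi * \<tau>)) powr (- real DIM('a) / 2) * 2 powr (real DIM('a) / 2)"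
    using assms by (subst powr_mult) (auto simp: mult.commute mult.left_commute simp flip: powr_add)
  also have "\<dots> \<le> (4 * pi * (\<tau> + 1)) powr (- real DIM('a) / 2) * 2 powr (real DIM('a) / 2)"
    using assms by (intro mult_right_mono powr_mono2') auto
  finally have 1: "(4 * pi * \<tau>) powr (- real DIM('a) / 2) \<le> (4 * pi * (\<tau> + 1)) powr (- real DIM('a) / 2) * 2 powr (real DIM('a) / 2)" .
  have "(norm x)\<^sup>2 / (4 * (\<tau> + 1)) \<le> (norm x)\<^sup>2 / (4 * \<tau>)"
    using assms by (intro divide_left_mono) auto
  then have 2: "exp (- (norm x)\<^sup>2 / (4 * \<tau>)) \<le> exp (- (norm x)\<^sup>2 / (4 * (\<tau> + 1)))" by simp
  show ?thesis unfolding gaussian_def using mult_mono[OF 1 2] by (simp add: mult_ac)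
qed

text \<open>A pointwise bound of the tail by the density fails near \<tau> = 1, where the density
  vanishes. For \<tau> < 2 the mass is therefore compared with the density at \<tau> + 1, at the
  price of the factor 2^(n/2) between the two heat kernels.\<close>

lemma mix_tail_le_dens:
  assumes s: "0 < s" "s < 1"
  shows "\<exists>C\<ge>0. \<forall>x::'a::euclidean_space. mix (tail s) x \<le> C * mix (dens s) x"
proof -
  define K where "K = 2 powr (real DIM('a) / 2) * 18"
  have K0: "K \<ge> 0" by (simp add: K_def)
  have pt: "tail s \<tau> * gaussian \<tau> x \<le> K * (dens s (1 + 1 * \<tau>) * gaussian (1 + 1 * \<tau>) x) + 2 * (dens s \<tau> * gaussian \<tau> x)" for \<tau> and x :: 'a
  proof (cases "\<tau> \<ge> 1")
    case t: True
    show ?thesis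
    proof (cases "\<tau> \<ge> 2")
      case True
      have "\<tau> powr (-2 - s) = \<tau> powr (-1 - s) / \<tau>"
        using True powr_diff[of \<tau> "-1 - s" 1] by simp
      also have "\<dots> \<le> \<tau> powr (-1 - s) / 2" using True by (intro divide_left_mono) auto
      finally have "tail s \<tau> \<le> 2 * dens s \<tau>" using t by (simp add: tail_def dens_def)
      then have "tail s \<tau> * gaussian \<tau> x \<le> 2 * dens s \<tau> * gaussian \<tau> x" by (intro mult_right_mono) auto
      moreover have "0 \<le> K * (dens s (1 + 1 * \<tau>) * gaussian (1 + 1 * \<tau>) x)" using K0 by simp
      ultimately show ?thesis by simp
    next
      case False
      have "\<tau> powr (-1 - s) \<le> 1 powr (-1 - s)" using t s by (intro powr_mono2') auto
      then have k1: "tail s \<tau> \<le> 1" using t by (simp add: tail_def)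
      \<comment> \<open>From 1 + \<tau> \<ge> 2 at least half of the leading power survives the
        subtraction, and 1 + \<tau> \<le> 3 bounds that power below by 1/9; hence 18.\<close>
      have n1: "1 \<le> 18 * dens s (1 + \<tau>)"
      proof -
        have "(1 + \<tau>) powr (-2 - s) = (1 + \<tau>) powr (-1 - s) / (1 + \<tau>)"
          using t powr_diff[of "1 + \<tau>" "-1 - s" 1] by simp
        also have "\<dots> \<le> (1 + \<tau>) powr (-1 - s) / 2" using t by (intro divide_left_mono) auto
        finally have "dens s (1 + \<tau>) \<ge> (1 + \<tau>) powr (-1 - s) / 2" using t by (simp add: dens_def)
        moreover have "(1 + \<tau>) powr (-1 - s) \<ge> 3 powr (-2)"
        proof -
          have "3 powr (-2) \<le> (1 + \<tau>) powr (-2)" using t False by (intro powr_mono2') auto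
          also have "\<dots> \<le> (1 + \<tau>) powr (-1 - s)" using t s by (intro powr_mono) auto
          finally show ?thesis .
        qed
        moreover have "3 powr (-2) = (1/9::real)" by (simp add: powr_minus)
        ultimately show ?thesis by linarith
      qed
      have "tail s \<tau> * gaussian \<tau> x \<le> 1 * gaussian \<tau> x" using k1 by (intro mult_right_mono) auto
      also have "\<dots> \<le> 1 * (2 powr (real DIM('a) / 2) * gaussian (\<tau> + 1) x)"
        using gaussian_le_shift[OF t] by simp
      also have "\<dots> \<le> (18 * dens s (1 + \<tau>)) * (2 powr (real DIM('a) / 2) * gaussian (\<tau> + 1) x)"
        using n1 by (intro mult_right_mono) auto
      also have "\<dots> = K * (dens s (1 + 1 * \<tau>) * gaussian (1 + 1 * \<tau>) x)"
        by (simp add: K_def mult_ac add.commute)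
      moreover have "0 \<le> 2 * (dens s \<tau> * gaussian \<tau> x)" by simp
      ultimately show ?thesis by linarith
    qed
  next
    case False
    then show ?thesis using K0 by (simp add: tail_def)
  qed
  have "mix (tail s) x \<le> (K + 2) * mix (dens s) x" for x :: 'a
  proof -
    have ni: "integrable lborel (\<lambda>\<tau>. dens s \<tau> * gaussian \<tau> x)" by (rule mixing_integrable[OF mixing_dens[OF s(1)]])
    have nsi: "integrable lborel (\<lambda>\<tau>. dens s (1 + 1 * \<tau>) * gaussian (1 + 1 * \<tau>) x)"
      by (rule lborel_integrable_real_affine[OF ni]) simp
    have nsI: "(LINT \<tau>|lborel. dens s (1 + 1 * \<tau>) * gaussian (1 + 1 * \<tau>) x) = mix (dens s) x"
      unfolding mix_def using lborel_integral_real_affine[of 1 "\<lambda>\<tau>. dens s \<tau> * gaussian \<tau> x" 1] by simp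
    have "mix (tail s) x \<le> (LINT \<tau>|lborel. K * (dens s (1 + 1 * \<tau>) * gaussian (1 + 1 * \<tau>) x) + 2 * (dens s \<tau> * gaussian \<tau> x))"
      unfolding mix_def
      by (intro integral_mono pt mixing_integrable[OF mixing_tail[OF s(1)]] Bochner_Integration.integrable_add integrable_mult_right ni nsi)
    also have "\<dots> = K * (LINT \<tau>|lborel. dens s (1 + 1 * \<tau>) * gaussian (1 + 1 * \<tau>) x) + 2 * (LINT \<tau>|lborel. dens s \<tau> * gaussian \<tau> x)"
      by (subst Bochner_Integration.integral_add) (use ni nsi in auto)
    also have "\<dots> = K * mix (dens s) x + 2 * mix (dens s) x" unfolding nsI by (simp add: mix_def)
    finally show ?thesis by (simp add: algebra_simps)
  qed
  then show ?thesis using K0 by (intro exI[of _ "K + 2"]) auto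
qed

text \<open>\<open>W\<close> and \<open>L\<close> are \<open>(-\<Delta>)^(\<sigma>/2) \<Phi>\<close> and \<open>-\<Delta> \<Phi>\<close>; B and C are the constants of the pointwise bounds.\<close>

locale test_profile =
  fixes \<sigma> :: real and \<Phi> W L :: "'a::euclidean_space \<Rightarrow> real" and C B :: real
  assumes \<sigma>: "0 < \<sigma>" "\<sigma> < 2"
    and \<Phi>_lim: "X \<longlonglongrightarrow> 0 \<Longrightarrow> (\<lambda>i. \<Phi> (X i)) \<longlonglongrightarrow> \<Phi> 0"
    and integrable: "integrable lborel \<Phi>" "integrable lborel W" "integrable lborel L"
    and \<Phi>_nonneg: "0 \<le> \<Phi> x" and \<Phi>_le: "\<Phi> x \<le> B" and \<Phi>_0: "0 < \<Phi> 0"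
    and C: "0 \<le> C" and W_le: "\<bar>W x\<bar> \<le> C * \<Phi> x" and L_le: "\<bar>L x\<bar> \<le> C * \<Phi> x"
    and fourier_W: "fourier_L1 W \<xi> = of_real (norm \<xi> powr \<sigma>) * fourier_L1 \<Phi> \<xi>"
    and fourier_L: "fourier_L1 L \<xi> = of_real ((norm \<xi>)\<^sup>2) * fourier_L1 \<Phi> \<xi>"

text \<open>The profile mixes \<open>dens s\<close> with s = \<sigma>/2. The densities
  \<open>fdens s\<close> and \<open>dens' s\<close> multiply its Laplace transform by \<rho>^s and
  \<rho>, and both are bounded by the tail, which \<open>mix_tail_le_dens\<close> bounds, after
  mixing, by the profile.\<close>

lemma test_profile_exists:
  assumes \<sigma>: "0 < \<sigma>" "\<sigma> < 2"
  shows "\<exists>\<Phi> W (L :: 'a::euclidean_space \<Rightarrow> real) C B. test_profile \<sigma> \<Phi> W L C B"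
proof -
  define s where "s = \<sigma> / 2"
  have s: "0 < s" "s < 1" using \<sigma> by (auto simp: s_def)
  obtain C0 where C0: "C0 \<ge> 0" "\<And>x::'a. mix (tail s) x \<le> C0 * mix (dens s) x"
    using mix_tail_le_dens[OF s] by blast
  define Co where "Co = inverse (levy_const s) * levy_bound s"
  have fdens: "mixing (fdens s)" by (rule mixing_if_le_tail[OF s(1) fdens_measurable fdens_le[OF s]])
  have dens': "mixing (dens' s)" by (rule mixing_if_le_tail[OF s(1) dens'_measurable dens'_le[OF s]])
  note dens = mixing_dens[OF s(1)] and tail = mixing_tail[OF s(1)]
  \<comment> \<open>The constant 5 is that of \<open>dens'_le\<close>, and \<open>Co\<close> is that
    of \<open>fdens_le\<close>.\<close>
  define K where "K = max 5 \<bar>Co\<bar>"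
  have K: "K \<ge> 0" by (simp add: K_def)
  have le: "\<bar>mix f x\<bar> \<le> (K * C0) * mix (dens s) x" if f: "mixing f" "\<And>\<tau>. \<bar>f \<tau>\<bar> \<le> D * tail s \<tau>" and D: "D \<le> K" for f D and x :: 'a
  proof -
    have "\<bar>f \<tau>\<bar> \<le> K * tail s \<tau>" for \<tau>
      using f(2)[of \<tau>] mult_right_mono[OF D tail_nonneg[of s \<tau>]] by linarith
    from mix_abs_le[OF f(1) tail this] have "\<bar>mix f x\<bar> \<le> K * mix (tail s) x" .
    also have "\<dots> \<le> K * (C0 * mix (dens s) x)" by (intro mult_left_mono C0 K)
    finally show ?thesis by simp
  qed
  have nonneg: "0 \<le> mix (dens s) x" for x :: 'a
    unfolding mix_def by (intro Bochner_Integration.integral_nonneg) simp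
  have pos: "0 < mix (dens s) (0::'a)"
  proof -
    have "mix (dens s) (0::'a) \<noteq> 0"
    proof
      assume "mix (dens s) (0::'a) = 0"
      then have "AE \<tau> in lborel. dens s \<tau> * gaussian \<tau> (0::'a) = 0"
        unfolding mix_def using integral_nonneg_eq_0_iff_AE[OF mixing_integrable[OF dens, of "0::'a"]] by simp
      then have "AE \<tau> in lborel. \<tau> \<notin> {1<..<2::real}"
      proof eventually_elim
        case (elim \<tau>)
        show ?case
        proof
          assume t: "\<tau> \<in> {1<..<2}"
          then have "\<tau> powr (-2 - s) < \<tau> powr (-1 - s)" by (intro powr_less_mono) auto
          then show False using elim t by (simp add: dens_def gaussian_def)
        qed
      qed
      then have "emeasure lborel {\<tau>::real. \<tau> \<in> {1<..<2}} = 0"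
        by (subst (asm) AE_iff_measurable[OF _ refl]) auto
      moreover have "{\<tau>::real. \<tau> \<in> {1<..<2}} = {1<..<2}" by auto
      ultimately show False by simp
    qed
    then show ?thesis using nonneg[of 0] by simp
  qed
  have "test_profile \<sigma> (mix (dens s) :: 'a \<Rightarrow> real) (mix (fdens s)) (mix (dens' s)) (K * C0) (LINT \<tau>|lborel. \<bar>dens s \<tau>\<bar>)"
  proof
    show "mix (dens s) x \<le> (LINT \<tau>|lborel. \<bar>dens s \<tau>\<bar>)" for x :: 'a
      using mix_bounded[OF dens, of x] by simp
    show "\<bar>mix (fdens s) x\<bar> \<le> K * C0 * mix (dens s) x" for x :: 'a
      by (rule le[OF fdens fdens_le[OF s]]) (simp add: K_def Co_def)
    show "\<bar>mix (dens' s) x\<bar> \<le> K * C0 * mix (dens s) x" for x :: 'a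
      by (rule le[OF dens' dens'_le[OF s]]) (simp add: K_def)
    show "fourier_L1 (mix (fdens s)) \<xi> = of_real (norm \<xi> powr \<sigma>) * fourier_L1 (mix (dens s)) \<xi>" for \<xi> :: 'a
    proof -
      have "((norm \<xi>)\<^sup>2) powr s = norm \<xi> powr \<sigma>"
      proof (cases "\<xi> = 0")
        case False
        then have "(norm \<xi>)\<^sup>2 = norm \<xi> powr 2" by (simp add: powr_numeral)
        then show ?thesis by (simp only: powr_powr s_def) simp
      qed simp
      then have "(LINT \<tau>|lborel. fdens s \<tau> * exp (- \<tau> * (norm \<xi>)\<^sup>2)) = norm \<xi> powr \<sigma> * (LINT \<tau>|lborel. dens s \<tau> * exp (- \<tau> * (norm \<xi>)\<^sup>2))"
        using fdens_laplace[OF s, of "(norm \<xi>)\<^sup>2"] by simp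
      then show ?thesis
        unfolding fourier_L1_mix[OF fdens] fourier_L1_mix[OF dens] by (simp only: of_real_mult mult_ac)
    qed
    show "fourier_L1 (mix (dens' s)) \<xi> = of_real ((norm \<xi>)\<^sup>2) * fourier_L1 (mix (dens s)) \<xi>" for \<xi> :: 'a
      unfolding fourier_L1_mix[OF dens'] fourier_L1_mix[OF dens] dens'_laplace[OF s zero_le_power2] by (simp only: of_real_mult mult_ac)
  qed (use \<sigma> nonneg pos K C0 mix_tendsto[OF dens] mix_integrable[OF dens] mix_integrable[OF fdens] mix_integrable[OF dens'] in auto)
  then show ?thesis by blast
qed

section \<open>Rescaled profiles and the operators of the weak formulation\<close>

lemma fourier_L1_scale:
  fixes f :: "'a::euclidean_space \<Rightarrow> real"
  assumes [measurable]: "f \<in> borel_measurable borel" and R: "R > 0"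
  shows "fourier_L1 (\<lambda>x. f (x /\<^sub>R R)) \<xi> = of_real (R ^ DIM('a)) * fourier_L1 f (R *\<^sub>R \<xi>)"
proof -
  have "(LINT x|lborel. cis (- (x \<bullet> \<xi>)) * complex_of_real (f (x /\<^sub>R R))) =
      R ^ DIM('a) *\<^sub>R (LINT z|lborel. cis (- ((0 + R *\<^sub>R z) \<bullet> \<xi>)) * complex_of_real (f ((0 + R *\<^sub>R z) /\<^sub>R R)))"
    by (rule lborel_integral_affine) (use R in measurable)
  also have "\<dots> = of_real (R ^ DIM('a)) * (LINT z|lborel. cis (- (z \<bullet> (R *\<^sub>R \<xi>))) * complex_of_real (f z))"
    using R by (simp add: scaleR_conv_of_real)
  finally show ?thesis unfolding fourier_L1_def by (simp only: mult_ac)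
qed

text \<open>A candidate w with the right transform shows that the choice in
  \<open>frac_laplacian\<close> is not vacuous; injectivity then identifies the chosen function with
  w.\<close>

lemma frac_laplacian_eq:
  assumes w: "w \<in> Lspace 2"
    and eq: "AE \<xi> in lborel. fourier_L2 w \<xi> = of_real (norm \<xi> powr (2 * s)) * fourier_L2 f \<xi>"
  shows "frac_laplacian s f \<in> Lspace 2" and "AE x in lborel. frac_laplacian s f x = w x"
proof -
  let ?P = "\<lambda>w. w \<in> Lspace 2 \<and> (AE \<xi> in lborel. fourier_L2 w \<xi> = of_real (norm \<xi> powr (2 * s)) * fourier_L2 f \<xi>)"
  have "?P (frac_laplacian s f)"
    unfolding frac_laplacian_def by (rule someI[of ?P]) (use w eq in auto)
  then have 1: "frac_laplacian s f \<in> Lspace 2"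
    and 2: "AE \<xi> in lborel. fourier_L2 (frac_laplacian s f) \<xi> = of_real (norm \<xi> powr (2 * s)) * fourier_L2 f \<xi>"
    by auto
  show "frac_laplacian s f \<in> Lspace 2" by (rule 1)
  show "AE x in lborel. frac_laplacian s f x = w x"
    by (rule fourier_L2_inj[OF 1 w]) (use 2 eq in eventually_elim, simp)
qed

lemma fourier_L2_cmult:
  assumes "f \<in> Lspace 2"
  shows "AE \<xi> in lborel. fourier_L2 (\<lambda>x. c * f x) \<xi> = of_real c * fourier_L2 f \<xi>"
  by (rule fourier_L2_AE_eq[OF has_fourier_L2_cmult[OF has_fourier_L2_fourier_L2[OF assms]]])

lemma fourier_L2_measurable:
  "f \<in> Lspace 2 \<Longrightarrow> fourier_L2 f \<in> borel_measurable borel"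
  using has_fourier_L2_fourier_L2[of f] by (simp add: has_fourier_L2_def)

lemma Hnorm_cmult:
  assumes f: "f \<in> Lspace 2"
  shows "Hnorm s (\<lambda>x. c * f x) = \<bar>c\<bar> * Hnorm s f"
proof -
  have [measurable]: "fourier_L2 f \<in> borel_measurable borel" "fourier_L2 (\<lambda>x. c * f x) \<in> borel_measurable borel"
    by (intro fourier_L2_measurable f Lspace_2_cmult)+
  have "(LINT \<xi>|lborel. (1 + (norm \<xi>)\<^sup>2) powr s * (cmod (fourier_L2 (\<lambda>x. c * f x) \<xi>))\<^sup>2) =
      (LINT \<xi>|lborel. c\<^sup>2 * ((1 + (norm \<xi>)\<^sup>2) powr s * (cmod (fourier_L2 f \<xi>))\<^sup>2))"
  proof (rule integral_cong_AE)
    show "AE \<xi> in lborel. (1 + (norm \<xi>)\<^sup>2) powr s * (cmod (fourier_L2 (\<lambda>x. c * f x) \<xi>))\<^sup>2 =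
        c\<^sup>2 * ((1 + (norm \<xi>)\<^sup>2) powr s * (cmod (fourier_L2 f \<xi>))\<^sup>2)"
      using fourier_L2_cmult[OF f, of c] by eventually_elim (simp add: norm_mult power_mult_distrib)
  qed measurable
  then show ?thesis unfolding Hnorm_def by (simp add: real_sqrt_mult)
qed

lemma Hspace_cmult:
  assumes f: "f \<in> Hspace s"
  shows "(\<lambda>x. c * f x) \<in> Hspace s"
proof -
  have f2: "f \<in> Lspace 2" and i: "integrable lborel (\<lambda>\<xi>. (1 + (norm \<xi>)\<^sup>2) powr s * (cmod (fourier_L2 f \<xi>))\<^sup>2)"
    using f by (auto simp: Hspace_def)
  have [measurable]: "fourier_L2 f \<in> borel_measurable borel" "fourier_L2 (\<lambda>x. c * f x) \<in> borel_measurable borel"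
    by (intro fourier_L2_measurable f2 Lspace_2_cmult)+
  have "integrable lborel (\<lambda>\<xi>. (1 + (norm \<xi>)\<^sup>2) powr s * (cmod (fourier_L2 (\<lambda>x. c * f x) \<xi>))\<^sup>2)
    \<longleftrightarrow> integrable lborel (\<lambda>\<xi>. c\<^sup>2 * ((1 + (norm \<xi>)\<^sup>2) powr s * (cmod (fourier_L2 f \<xi>))\<^sup>2))"
  proof (rule integrable_cong_AE)
    show "AE \<xi> in lborel. (1 + (norm \<xi>)\<^sup>2) powr s * (cmod (fourier_L2 (\<lambda>x. c * f x) \<xi>))\<^sup>2 =
        c\<^sup>2 * ((1 + (norm \<xi>)\<^sup>2) powr s * (cmod (fourier_L2 f \<xi>))\<^sup>2)"
      using fourier_L2_cmult[OF f2, of c] by eventually_elim (simp add: norm_mult power_mult_distrib)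
  qed measurable
  then show ?thesis using i Lspace_2_cmult[OF f2] by (simp add: Hspace_def)
qed

text \<open>With r = |\<xi>|^2, (1 + r)^s \<le> (1 + r)^2 \<le> 2 + 2 r^2. One statement thus covers
  both the H^2 and the H^\<sigma> condition on test functions.\<close>

lemma Hspace_if_laplacian_L2:
  assumes f: "f \<in> Lspace 2" and l: "l \<in> Lspace 2"
    and eq: "AE \<xi> in lborel. fourier_L2 l \<xi> = of_real ((norm \<xi>)\<^sup>2) * fourier_L2 f \<xi>"
    and s: "s \<le> 2"
  shows "f \<in> Hspace s"
proof -
  have [measurable]: "fourier_L2 f \<in> borel_measurable borel" "fourier_L2 l \<in> borel_measurable borel"
    by (intro fourier_L2_measurable f l)+
  have "integrable lborel (\<lambda>\<xi>. (1 + (norm \<xi>)\<^sup>2) powr s * (cmod (fourier_L2 f \<xi>))\<^sup>2)"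
  proof (rule Bochner_Integration.integrable_bound)
    show "integrable lborel (\<lambda>\<xi>. 2 * (cmod (fourier_L2 f \<xi>))\<^sup>2 + 2 * (cmod (fourier_L2 l \<xi>))\<^sup>2)"
      using has_fourier_L2_fourier_L2[OF f] has_fourier_L2_fourier_L2[OF l] by (simp add: has_fourier_L2_def)
    show "AE \<xi> in lborel. norm ((1 + (norm \<xi>)\<^sup>2) powr s * (cmod (fourier_L2 f \<xi>))\<^sup>2) \<le>
        norm (2 * (cmod (fourier_L2 f \<xi>))\<^sup>2 + 2 * (cmod (fourier_L2 l \<xi>))\<^sup>2)"
      using eq
    proof eventually_elim
      case (elim \<xi>)
      define r where "r = (norm \<xi>)\<^sup>2"
      have r: "r \<ge> 0" by (simp add: r_def)
      have "(1 + r) powr s \<le> (1 + r) powr 2" using s r by (intro powr_mono) auto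
      also have "\<dots> = (1 + r)\<^sup>2" using r by (simp add: powr_numeral)
      also have "\<dots> \<le> 2 + 2 * r\<^sup>2" using sum_squares_bound[of 1 r] by (simp add: power2_sum)
      finally have "(1 + r) powr s * (cmod (fourier_L2 f \<xi>))\<^sup>2 \<le> (2 + 2 * r\<^sup>2) * (cmod (fourier_L2 f \<xi>))\<^sup>2"
        by (intro mult_right_mono) auto
      also have "\<dots> = 2 * (cmod (fourier_L2 f \<xi>))\<^sup>2 + 2 * (cmod (fourier_L2 l \<xi>))\<^sup>2"
        unfolding elim r_def[symmetric] norm_mult by (simp add: power_mult_distrib algebra_simps)
      finally show ?case by (simp add: r_def[symmetric])
    qed
  qed measurable
  then show ?thesis using f by (simp add: Hspace_def)
qed

context test_profile
begin

lemma measurable_profile [measurable]: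
  "\<Phi> \<in> borel_measurable borel" "W \<in> borel_measurable borel" "L \<in> borel_measurable borel"
  using integrable by auto

lemma scaled_L1_L2:
  assumes [measurable]: "f \<in> borel_measurable borel" and f: "\<And>x. \<bar>f x\<bar> \<le> D * \<Phi> x" and R: "R > 0"
  shows "integrable lborel (\<lambda>x. f (x /\<^sub>R R))" and "(\<lambda>x. f (x /\<^sub>R R)) \<in> Lspace 2"
proof -
  have "integrable lborel (\<lambda>x. D * \<Phi> x)" using integrable by simp
  then have i: "integrable lborel f"
    by (rule Bochner_Integration.integrable_bound) (auto intro!: AE_I2 order_trans[OF f])
  have i2: "integrable lborel (\<lambda>x. (f x)\<^sup>2)"
  proof (rule Bochner_Integration.integrable_bound)
    show "integrable lborel (\<lambda>x. (\<bar>D\<bar> * B) * f x)" using i by simp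
    show "AE x in lborel. norm ((f x)\<^sup>2) \<le> norm ((\<bar>D\<bar> * B) * f x)"
    proof (rule AE_I2)
      fix x
      have B: "B \<ge> 0" using \<Phi>_nonneg[of x] \<Phi>_le[of x] by linarith
      have "\<bar>f x\<bar> \<le> \<bar>D\<bar> * B"
        using f[of x] mult_mono[OF abs_ge_self \<Phi>_le abs_ge_zero \<Phi>_nonneg, of D x] by linarith
      then have "\<bar>f x\<bar> * \<bar>f x\<bar> \<le> (\<bar>D\<bar> * B) * \<bar>f x\<bar>" by (intro mult_right_mono) auto
      then show "norm ((f x)\<^sup>2) \<le> norm ((\<bar>D\<bar> * B) * f x)" using B by (simp add: power2_eq_square abs_mult)
    qed
  qed measurable
  have "0 + inverse R *\<^sub>R x = x /\<^sub>R R" for x :: 'a by simp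
  then show "integrable lborel (\<lambda>x. f (x /\<^sub>R R))" and "(\<lambda>x. f (x /\<^sub>R R)) \<in> Lspace 2"
    using lborel_integrable_affine[of f "inverse R" 0] lborel_integrable_affine[of "\<lambda>x. (f x)\<^sup>2" "inverse R" 0] i i2 R
    by (simp_all add: Lspace_2_iff)
qed

lemma \<Phi>_scaled: "R > 0 \<Longrightarrow> integrable lborel (\<lambda>x. \<Phi> (x /\<^sub>R R))" "R > 0 \<Longrightarrow> (\<lambda>x. \<Phi> (x /\<^sub>R R)) \<in> Lspace 2"
  using scaled_L1_L2[of \<Phi> 1 R] \<Phi>_nonneg by auto

lemma W_scaled: "R > 0 \<Longrightarrow> integrable lborel (\<lambda>x. W (x /\<^sub>R R))" "R > 0 \<Longrightarrow> (\<lambda>x. W (x /\<^sub>R R)) \<in> Lspace 2"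
  using scaled_L1_L2[of W C R] W_le by auto

lemma L_scaled: "R > 0 \<Longrightarrow> integrable lborel (\<lambda>x. L (x /\<^sub>R R))" "R > 0 \<Longrightarrow> (\<lambda>x. L (x /\<^sub>R R)) \<in> Lspace 2"
  using scaled_L1_L2[of L C R] L_le by auto

text \<open>The factor c, later the value of a cut-off at a fixed time, stays inside because
  \<open>frac_laplacian\<close> is a choice and not linear by definition. The factor R^(-e)
  compensates the symbol at R \<xi>.\<close>

lemma fourier_scaled:
  assumes R: "R > 0" and w: "w \<in> borel_measurable borel" "integrable lborel (\<lambda>x. w (x /\<^sub>R R))" "(\<lambda>x. w (x /\<^sub>R R)) \<in> Lspace 2"
    and eq: "\<And>\<xi>. fourier_L1 w \<xi> = of_real (norm \<xi> powr e) * fourier_L1 \<Phi> \<xi>"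
  shows "AE \<xi> in lborel. fourier_L2 (\<lambda>x. c * (R powr (- e) * w (x /\<^sub>R R))) \<xi> =
    of_real (norm \<xi> powr e) * fourier_L2 (\<lambda>x. c * \<Phi> (x /\<^sub>R R)) \<xi>"
  using fourier_L2_cmult[OF w(3), of "c * R powr (- e)"] fourier_L2_cmult[OF \<Phi>_scaled(2)[OF R], of c]
    fourier_L2_L1[OF \<Phi>_scaled[OF R]] fourier_L2_L1[OF w(2,3)]
proof eventually_elim
  case (elim \<xi>)
  have n: "norm (R *\<^sub>R \<xi>) powr e = R powr e * norm \<xi> powr e" using R by (simp add: powr_mult)
  have one: "complex_of_real (R powr (- e)) * of_real (R powr e) = 1"
    using R by (simp flip: of_real_mult powr_add)
  have "fourier_L2 (\<lambda>x. c * (R powr (- e) * w (x /\<^sub>R R))) \<xi> =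
      of_real c * of_real (R powr (- e)) * (of_real (R ^ DIM('a)) * (of_real (R powr e * norm \<xi> powr e) * fourier_L1 \<Phi> (R *\<^sub>R \<xi>)))"
    unfolding mult.assoc[symmetric, of c] elim(1) elim(4) fourier_L1_scale[OF w(1) R] eq n by (simp only: of_real_mult mult.assoc)
  also have "\<dots> = (of_real (R powr (- e)) * of_real (R powr e)) * (of_real (norm \<xi> powr e) * (of_real c * (of_real (R ^ DIM('a)) * fourier_L1 \<Phi> (R *\<^sub>R \<xi>))))"
    by (simp add: mult_ac)
  also have "\<dots> = of_real (norm \<xi> powr e) * fourier_L2 (\<lambda>x. c * \<Phi> (x /\<^sub>R R)) \<xi>"
    unfolding one elim(2) elim(3) fourier_L1_scale[OF measurable_profile(1) R] by simp
  finally show ?case .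
qed

lemma frac_laplacian_scaled:
  assumes R: "R > 0"
  shows "frac_laplacian (\<sigma> / 2) (\<lambda>x. c * \<Phi> (x /\<^sub>R R)) \<in> Lspace 2"
    and "AE x in lborel. frac_laplacian (\<sigma> / 2) (\<lambda>x. c * \<Phi> (x /\<^sub>R R)) x = c * (R powr (- \<sigma>) * W (x /\<^sub>R R))"
  using fourier_scaled[OF R _ W_scaled[OF R] fourier_W]
    frac_laplacian_eq[of "\<lambda>x. c * (R powr (- \<sigma>) * W (x /\<^sub>R R))" "\<sigma> / 2" "\<lambda>x. c * \<Phi> (x /\<^sub>R R)"]
    Lspace_2_cmult[OF Lspace_2_cmult[OF W_scaled(2)[OF R], of "R powr (- \<sigma>)"], of c] by auto

lemma laplacian_fourier_scaled:
  assumes R: "R > 0"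
  shows "AE \<xi> in lborel. fourier_L2 (\<lambda>x. c * (R powr (- 2) * L (x /\<^sub>R R))) \<xi> =
    of_real (norm \<xi> powr 2) * fourier_L2 (\<lambda>x. c * \<Phi> (x /\<^sub>R R)) \<xi>"
  using abs_powr_two[of "norm _"] by (intro fourier_scaled[OF R _ L_scaled[OF R]]) (auto simp: fourier_L)

lemma laplacian_scaled:
  assumes R: "R > 0"
  shows "frac_laplacian 1 (\<lambda>x. c * \<Phi> (x /\<^sub>R R)) \<in> Lspace 2"
    and "AE x in lborel. frac_laplacian 1 (\<lambda>x. c * \<Phi> (x /\<^sub>R R)) x = c * (R powr (- 2) * L (x /\<^sub>R R))"
  using laplacian_fourier_scaled[OF R]
    frac_laplacian_eq[of "\<lambda>x. c * (R powr (- 2) * L (x /\<^sub>R R))" 1 "\<lambda>x. c * \<Phi> (x /\<^sub>R R)"]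
    Lspace_2_cmult[OF Lspace_2_cmult[OF L_scaled(2)[OF R], of "R powr (- 2)"], of c] by auto

lemma \<Phi>_scaled_Hspace:
  assumes R: "R > 0" and s: "s \<le> 2"
  shows "(\<lambda>x. \<Phi> (x /\<^sub>R R)) \<in> Hspace s"
proof (rule Hspace_if_laplacian_L2[OF \<Phi>_scaled(2)[OF R] _ _ s])
  show "(\<lambda>x. 1 * (R powr (- 2) * L (x /\<^sub>R R))) \<in> Lspace 2"
    by (intro Lspace_2_cmult L_scaled R)
  show "AE \<xi> in lborel. fourier_L2 (\<lambda>x. 1 * (R powr (- 2) * L (x /\<^sub>R R))) \<xi> = of_real ((norm \<xi>)\<^sup>2) * fourier_L2 (\<lambda>x. \<Phi> (x /\<^sub>R R)) \<xi>"
    using laplacian_fourier_scaled[OF R, of 1] abs_powr_two[of "norm _"] by simp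
qed

end

section \<open>Separated test functions and the memory kernel\<close>

text \<open>On the line spanned by one profile a homogeneous N is a multiple of the absolute value,
  so regularity of the curve is that of the scalar \<eta>. Keeping X and N abstract serves the
  Sobolev and the Lebesgue norms at once.\<close>

lemma sep_C0_curve:
  assumes X: "\<And>c. (\<lambda>x. c * \<Psi> x) \<in> X" and N: "\<And>c. N (\<lambda>x. c * \<Psi> x) = \<bar>c\<bar> * N \<Psi>"
    and \<eta>: "continuous_on {0..T} \<eta>"
  shows "C0_curve X N T (\<lambda>t x. \<eta> t * \<Psi> x)"
  unfolding C0_curve_def
proof (intro ballI conjI X)
  fix t assume t: "t \<in> {0..T}"
  have "((\<lambda>r. \<bar>\<eta> r - \<eta> t\<bar> * N \<Psi>) \<longlongrightarrow> \<bar>\<eta> t - \<eta> t\<bar> * N \<Psi>) (at t within {0..T})"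
    using \<eta> t by (intro tendsto_intros) (auto simp: continuous_on)
  moreover have "N (\<lambda>x. \<eta> r * \<Psi> x - \<eta> t * \<Psi> x) = \<bar>\<eta> r - \<eta> t\<bar> * N \<Psi>" for r
    unfolding left_diff_distrib[symmetric] N ..
  ultimately show "((\<lambda>r. N (\<lambda>x. \<eta> r * \<Psi> x - \<eta> t * \<Psi> x)) \<longlongrightarrow> 0) (at t within {0..T})" by simp
qed

lemma sep_C1_curve:
  assumes X: "\<And>c. (\<lambda>x. c * \<Psi> x) \<in> X" and N: "\<And>c. N (\<lambda>x. c * \<Psi> x) = \<bar>c\<bar> * N \<Psi>"
    and \<eta>: "\<And>t. t \<in> {0..T} \<Longrightarrow> (\<eta> has_real_derivative \<eta>' t) (at t within {0..T})"
    and \<eta>': "continuous_on {0..T} \<eta>'"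
  shows "C1_curve X N T (\<lambda>t x. \<eta> t * \<Psi> x) (\<lambda>t x. \<eta>' t * \<Psi> x)"
  unfolding C1_curve_def
proof (intro ballI conjI sep_C0_curve X N \<eta>')
  show "continuous_on {0..T} \<eta>" using \<eta> by (rule DERIV_continuous_on)
  fix t assume t: "t \<in> {0..T}"
  have "((\<lambda>r. (\<eta> r - \<eta> t) / (r - t)) \<longlongrightarrow> \<eta>' t) (at t within {0..T})"
    using \<eta>[OF t] by (simp add: has_field_derivative_iff)
  then have "((\<lambda>r. \<bar>(\<eta> r - \<eta> t) / (r - t) - \<eta>' t\<bar> * N \<Psi>) \<longlongrightarrow> \<bar>\<eta>' t - \<eta>' t\<bar> * N \<Psi>) (at t within {0..T})"
    by (intro tendsto_intros)
  moreover have "N (\<lambda>x. (\<eta> r * \<Psi> x - \<eta> t * \<Psi> x) / (r - t) - \<eta>' t * \<Psi> x) = \<bar>(\<eta> r - \<eta> t) / (r - t) - \<eta>' t\<bar> * N \<Psi>" for r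
    unfolding N[symmetric] by (rule arg_cong[where f = N]) (simp add: fun_eq_iff left_diff_distrib diff_divide_distrib)
  ultimately show "((\<lambda>r. N (\<lambda>x. (\<eta> r * \<Psi> x - \<eta> t * \<Psi> x) / (r - t) - \<eta>' t * \<Psi> x)) \<longlongrightarrow> 0) (at t within {0..T})"
    by simp
qed

lemma Lnorm_2_cmult: "Lnorm 2 (\<lambda>x. c * f x) = \<bar>c\<bar> * Lnorm 2 f"
  unfolding Lnorm_def by (simp add: power_mult_distrib powr_mult)

text \<open>With exponent k + 2, the function and its first derivative vanish at T, and two
  derivatives still leave the factor (1 - t/T)^k.\<close>

definition cutoff :: "nat \<Rightarrow> real \<Rightarrow> real \<Rightarrow> real" where
  "cutoff k T t = (1 - t / T) ^ (k + 2)"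

definition cutoff' :: "nat \<Rightarrow> real \<Rightarrow> real \<Rightarrow> real" where
  "cutoff' k T t = - (real (k + 2) / T) * (1 - t / T) ^ (k + 1)"

definition cutoff'' :: "nat \<Rightarrow> real \<Rightarrow> real \<Rightarrow> real" where
  "cutoff'' k T t = real (k + 2) * real (k + 1) / T\<^sup>2 * (1 - t / T) ^ k"

lemma cutoff_has_derivative:
  assumes "T > 0"
  shows "(cutoff k T has_real_derivative cutoff' k T t) (at t within S)"
    and "(cutoff' k T has_real_derivative cutoff'' k T t) (at t within S)"
proof -
  have b: "((\<lambda>t. 1 - t / T) has_real_derivative - (1 / T)) (at t within S)"
    using assms by (auto intro!: derivative_eq_intros)
  show "(cutoff k T has_real_derivative cutoff' k T t) (at t within S)"
    using DERIV_power[OF b, of "k + 2"] by (simp add: cutoff_def[abs_def] cutoff'_def)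
  show "(cutoff' k T has_real_derivative cutoff'' k T t) (at t within S)"
    using DERIV_cmult[OF DERIV_power[OF b, of "k + 1"], of "- (real (k + 2) / T)"]
    by (simp add: cutoff'_def[abs_def] cutoff''_def power2_eq_square mult_ac)
qed

lemma cutoff_continuous_on:
  "continuous_on S (cutoff k T)" "continuous_on S (cutoff' k T)" "continuous_on S (cutoff'' k T)"
  unfolding cutoff_def[abs_def] cutoff'_def[abs_def] cutoff''_def[abs_def] divide_inverse by (intro continuous_intros)+

lemma (in test_profile) test_function_sep:
  assumes R: "R > 0" and T: "T > 0"
  shows "test_function \<sigma> T (\<lambda>t x. cutoff k T t * \<Phi> (x /\<^sub>R R)) (\<lambda>t x. cutoff' k T t * \<Phi> (x /\<^sub>R R)) (\<lambda>t x. cutoff'' k T t * \<Phi> (x /\<^sub>R R))"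
  unfolding test_function_def C2_curve_def
proof (intro conjI)
  note H = Hspace_cmult[OF \<Phi>_scaled_Hspace[OF R]] Hnorm_cmult[OF \<Phi>_scaled(2)[OF R]]
  note D = cutoff_has_derivative[OF T, of k]
  show "C0_curve (Hspace 2) (Hnorm 2) T (\<lambda>t x. cutoff k T t * \<Phi> (x /\<^sub>R R))"
    by (rule sep_C0_curve[OF _ _ cutoff_continuous_on(1)]) (auto intro: H)
  show "C1_curve (Hspace \<sigma>) (Hnorm \<sigma>) T (\<lambda>t x. cutoff k T t * \<Phi> (x /\<^sub>R R)) (\<lambda>t x. cutoff' k T t * \<Phi> (x /\<^sub>R R))"
    by (rule sep_C1_curve[OF _ _ D(1) cutoff_continuous_on(2)]) (use \<sigma> in \<open>auto intro: H\<close>)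
  show "C1_curve (Lspace 2) (Lnorm 2) T (\<lambda>t x. cutoff k T t * \<Phi> (x /\<^sub>R R)) (\<lambda>t x. cutoff' k T t * \<Phi> (x /\<^sub>R R))"
    by (rule sep_C1_curve[OF _ _ D(1) cutoff_continuous_on(2)])
      (auto intro: Lspace_2_cmult[OF \<Phi>_scaled(2)[OF R]] Lnorm_2_cmult)
  show "C1_curve (Lspace 2) (Lnorm 2) T (\<lambda>t x. cutoff' k T t * \<Phi> (x /\<^sub>R R)) (\<lambda>t x. cutoff'' k T t * \<Phi> (x /\<^sub>R R))"
    by (rule sep_C1_curve[OF _ _ D(2) cutoff_continuous_on(3)])
      (auto intro: Lspace_2_cmult[OF \<Phi>_scaled(2)[OF R]] Lnorm_2_cmult)
qed (use T in \<open>auto simp: cutoff_def cutoff'_def\<close>)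

text \<open>In the iterated Bochner integrals of the weak formulation a divergent inner integral
  counts as 0. Finiteness of the nonnegative integral confines such points to null sets, so that
  Tonelli's theorem can be used on the right side.\<close>

lemma iterated_integral_eq_nn_integral:
  fixes f :: "real \<times> 'a::euclidean_space \<times> real \<Rightarrow> real"
  assumes f [measurable]: "f \<in> borel_measurable (borel \<Otimes>\<^sub>M (borel \<Otimes>\<^sub>M borel))"
    and nn: "\<And>z. 0 \<le> f z"
    and fin: "(\<integral>\<^sup>+t. \<integral>\<^sup>+x. \<integral>\<^sup>+s. ennreal (f (t, x, s)) \<partial>lborel \<partial>lborel \<partial>lborel) < \<infinity>"
  shows "(LINT t|lborel. LINT x|lborel. LINT s|lborel. f (t, x, s)) =
    enn2real (\<integral>\<^sup>+t. \<integral>\<^sup>+x. \<integral>\<^sup>+s. ennreal (f (t, x, s)) \<partial>lborel \<partial>lborel \<partial>lborel)"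
proof -
  define J where "J = (\<lambda>t x. \<integral>\<^sup>+s. ennreal (f (t, x, s)) \<partial>lborel)"
  have Jm [measurable]: "(\<lambda>(t, x). J t x) \<in> borel_measurable (borel \<Otimes>\<^sub>M borel)"
    unfolding J_def by measurable
  have 1: "(LINT s|lborel. f (t, x, s)) = enn2real (J t x)" for t x
    unfolding J_def by (rule integral_eq_nn_integral) (auto simp: nn)
  have 2: "(LINT x|lborel. enn2real (J t x)) = enn2real (\<integral>\<^sup>+x. ennreal (enn2real (J t x)) \<partial>lborel)" for t
    by (rule integral_eq_nn_integral) auto
  have "AE t in lborel. (\<integral>\<^sup>+x. J t x \<partial>lborel) \<noteq> \<infinity>"
    by (rule nn_integral_PInf_AE) (use fin in \<open>auto simp: J_def\<close>)
  then have 3: "AE t in lborel. ennreal (enn2real (\<integral>\<^sup>+x. ennreal (enn2real (J t x)) \<partial>lborel)) = (\<integral>\<^sup>+x. J t x \<partial>lborel)"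
  proof eventually_elim
    case (elim t)
    have "AE x in lborel. J t x \<noteq> \<infinity>"
      by (rule nn_integral_PInf_AE) (use elim in auto)
    then have "(\<integral>\<^sup>+x. ennreal (enn2real (J t x)) \<partial>lborel) = (\<integral>\<^sup>+x. J t x \<partial>lborel)"
      by (intro nn_integral_cong_AE) (auto simp: less_top)
    then show ?case using elim by (simp add: less_top)
  qed
  have "(LINT t|lborel. LINT x|lborel. LINT s|lborel. f (t, x, s)) =
      enn2real (\<integral>\<^sup>+t. ennreal (enn2real (\<integral>\<^sup>+x. ennreal (enn2real (J t x)) \<partial>lborel)) \<partial>lborel)"
    unfolding 1 2 by (rule integral_eq_nn_integral) auto
  also have "(\<integral>\<^sup>+t. ennreal (enn2real (\<integral>\<^sup>+x. ennreal (enn2real (J t x)) \<partial>lborel)) \<partial>lborel) = (\<integral>\<^sup>+t. \<integral>\<^sup>+x. J t x \<partial>lborel \<partial>lborel)"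
    by (rule nn_integral_cong_AE[OF 3])
  finally show ?thesis by (simp add: J_def)
qed

lemma nn_integral_reorder3:
  fixes f :: "real \<times> 'a::euclidean_space \<times> real \<Rightarrow> ennreal"
  assumes f [measurable]: "f \<in> borel_measurable (borel \<Otimes>\<^sub>M (borel \<Otimes>\<^sub>M borel))"
  shows "(\<integral>\<^sup>+t. \<integral>\<^sup>+x. \<integral>\<^sup>+s. f (t, x, s) \<partial>lborel \<partial>lborel \<partial>lborel) =
    (\<integral>\<^sup>+s. \<integral>\<^sup>+x. \<integral>\<^sup>+t. f (t, x, s) \<partial>lborel \<partial>lborel \<partial>lborel)"
proof -
  have "(\<integral>\<^sup>+t. \<integral>\<^sup>+x. \<integral>\<^sup>+s. f (t, x, s) \<partial>lborel \<partial>lborel \<partial>lborel) = (\<integral>\<^sup>+t. \<integral>\<^sup>+s. \<integral>\<^sup>+x. f (t, x, s) \<partial>lborel \<partial>lborel \<partial>lborel)"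
    by (intro nn_integral_cong lborel_pair.Fubini') (simp add: lborel_prod borel_prod[symmetric])
  also have "\<dots> = (\<integral>\<^sup>+s. \<integral>\<^sup>+t. \<integral>\<^sup>+x. f (t, x, s) \<partial>lborel \<partial>lborel \<partial>lborel)"
    by (intro lborel_pair.Fubini') (simp add: lborel_prod borel_prod[symmetric])
  also have "\<dots> = (\<integral>\<^sup>+s. \<integral>\<^sup>+x. \<integral>\<^sup>+t. f (t, x, s) \<partial>lborel \<partial>lborel \<partial>lborel)"
    by (intro nn_integral_cong lborel_pair.Fubini') (simp add: lborel_prod borel_prod[symmetric])
  finally show ?thesis .
qed

lemma memory_kernel_integral:
  assumes \<alpha>: "\<alpha> > 0" and sT: "0 < s" "s < T"
  shows "(\<integral>\<^sup>+t. ennreal (indicator {s<..<T} t * ((t - s) powr (\<alpha> - 1) * cutoff k T t)) \<partial>lborel) =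
    ennreal (Beta \<alpha> (real k + 3) * T powr \<alpha> * (1 - s / T) powr (real k + 2 + \<alpha>))"
proof -
  have T: "T > 0" using sT by simp
  \<comment> \<open>The substitution t = s + c r maps (0,1) onto (s,T) and gives 1 - t/T = (c/T)(1 -
    r). What remains is a Beta integral whose second parameter is the exponent k + 2 plus 1.\<close>
  define c where "c = T - s"
  have c: "c > 0" using sT by (simp add: c_def)
  have "((\<lambda>r. r powr (\<alpha> - 1) * (1 - r) powr (real k + 3 - 1)) has_integral Beta \<alpha> (real k + 3)) {0..1}"
    using \<alpha> by (intro has_integral_Beta_real) auto
  then have "((\<lambda>r. if r \<in> {0<..<1} then r powr (\<alpha> - 1) * (1 - r) powr (real k + 3 - 1) else 0) has_integral Beta \<alpha> (real k + 3)) UNIV"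
    by (subst has_integral_restrict_UNIV) (simp add: has_integral_Icc_iff_Ioo)
  also have "(\<lambda>r::real. if r \<in> {0<..<1} then r powr (\<alpha> - 1) * (1 - r) powr (real k + 3 - 1) else 0) =
      (\<lambda>r. indicator {0<..<1} r * (r powr (\<alpha> - 1) * (1 - r) ^ (k + 2)))"
  proof
    fix r :: real
    have "(1 - r) powr (real k + 3 - 1) = (1 - r) ^ (k + 2)" if "r < 1"
    proof -
      have "real k + 3 - 1 = real (k + 2)" by simp
      then show ?thesis using that by (simp only: powr_realpow diff_gt_0_iff_gt)
    qed
    then show "(if r \<in> {0<..<1} then r powr (\<alpha> - 1) * (1 - r) powr (real k + 3 - 1) else 0) =
      indicator {0<..<1} r * (r powr (\<alpha> - 1) * (1 - r) ^ (k + 2))" by (auto simp: indicator_def)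
  qed
  finally have "((\<lambda>r. indicator {0<..<1} r * (r powr (\<alpha> - 1) * (1 - r) ^ (k + 2))) has_integral Beta \<alpha> (real k + 3)) UNIV" .
  from nn_integral_has_integral_lborel[OF _ _ this]
  have beta: "(\<integral>\<^sup>+r. ennreal (indicator {0<..<1} r * (r powr (\<alpha> - 1) * (1 - r) ^ (k + 2))) \<partial>lborel) = ennreal (Beta \<alpha> (real k + 3))"
    by (auto simp: indicator_def)
  have "(\<integral>\<^sup>+t. ennreal (indicator {s<..<T} t * ((t - s) powr (\<alpha> - 1) * cutoff k T t)) \<partial>lborel) =
      ennreal \<bar>c\<bar> * (\<integral>\<^sup>+r. ennreal (indicator {s<..<T} (s + c * r) * ((s + c * r - s) powr (\<alpha> - 1) * cutoff k T (s + c * r))) \<partial>lborel)"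
    using c by (intro nn_integral_real_affine) (auto simp: cutoff_def)
  also have "\<dots> = ennreal c * (\<integral>\<^sup>+r. ennreal (c powr (\<alpha> - 1) * (c / T) ^ (k + 2)) * ennreal (indicator {0<..<1} r * (r powr (\<alpha> - 1) * (1 - r) ^ (k + 2))) \<partial>lborel)"
  proof -
    have "indicator {s<..<T} (s + c * r) * ((s + c * r - s) powr (\<alpha> - 1) * cutoff k T (s + c * r)) =
        (c powr (\<alpha> - 1) * (c / T) ^ (k + 2)) * (indicator {0<..<1} r * (r powr (\<alpha> - 1) * (1 - r) ^ (k + 2)))" for r
    proof -
      have "T = s + c" by (simp add: c_def)
      then have "s + c * r < T \<longleftrightarrow> c * r < c * 1" by linarith
      then have 1: "s + c * r \<in> {s<..<T} \<longleftrightarrow> r \<in> {0<..<1}" using c by (auto simp: zero_less_mult_iff)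
      have 2: "1 - (s + c * r) / T = (c / T) * (1 - r)"
        using T by (simp add: c_def field_simps)
      show ?thesis
      proof (cases "r \<in> {0<..<1}")
        case True
        have 3: "cutoff k T (s + c * r) = (c / T) ^ (k + 2) * (1 - r) ^ (k + 2)"
          unfolding cutoff_def 2 power_mult_distrib ..
        show ?thesis using c 1 True unfolding 3 by (simp add: powr_mult)
      next
        case False
        then have "s + c * r \<notin> {s<..<T}" using 1 by blast
        with False show ?thesis by (simp only: indicator_simps mult_zero_left mult_zero_right not_False_eq_True)
      qed
    qed
    then show ?thesis using c T by (simp only: abs_of_pos) (subst ennreal_mult, auto simp: indicator_def)
  qed
  also have "\<dots> = ennreal c * (ennreal (c powr (\<alpha> - 1) * (c / T) ^ (k + 2)) * ennreal (Beta \<alpha> (real k + 3)))"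
  proof -
    have "(\<lambda>r. ennreal (indicator {0<..<1} r * (r powr (\<alpha> - 1) * (1 - r) ^ (k + 2)))) \<in> borel_measurable lborel"
      by measurable
    from nn_integral_cmult[OF this] show ?thesis by (simp only: beta)
  qed
  also have "\<dots> = ennreal (Beta \<alpha> (real k + 3) * (c * c powr (\<alpha> - 1) * (c / T) ^ (k + 2)))"
  proof -
    have "0 \<le> c powr (\<alpha> - 1) * (c / T) ^ (k + 2)" using c T by simp
    then have "ennreal c * (ennreal (c powr (\<alpha> - 1) * (c / T) ^ (k + 2)) * ennreal (Beta \<alpha> (real k + 3))) =
        ennreal (c * ((c powr (\<alpha> - 1) * (c / T) ^ (k + 2)) * Beta \<alpha> (real k + 3)))"
      using c by (simp only: ennreal_mult' less_imp_le)
    also have "c * ((c powr (\<alpha> - 1) * (c / T) ^ (k + 2)) * Beta \<alpha> (real k + 3)) = Beta \<alpha> (real k + 3) * (c * c powr (\<alpha> - 1) * (c / T) ^ (k + 2))"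
      by (simp only: mult_ac)
    finally show ?thesis .
  qed
  also have "c * c powr (\<alpha> - 1) * (c / T) ^ (k + 2) = T powr \<alpha> * (1 - s / T) powr (real k + 2 + \<alpha>)"
  proof -
    have q: "c / T > 0" "1 - s / T = c / T" using c T by (auto simp: c_def field_simps)
    have "c * c powr (\<alpha> - 1) = c powr \<alpha>" using powr_mult_base[of c "\<alpha> - 1"] c by simp
    also have "\<dots> = T powr \<alpha> * (c / T) powr \<alpha>" using c T by (simp flip: powr_mult)
    finally have "c * c powr (\<alpha> - 1) * (c / T) ^ (k + 2) = T powr \<alpha> * ((c / T) powr \<alpha> * (c / T) powr (real (k + 2)))"
      using q(1) by (simp only: powr_realpow mult.assoc)
    then show ?thesis unfolding q(2) by (simp add: add_ac flip: powr_add)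
  qed
  finally show ?thesis by (simp add: mult.assoc)
qed

section \<open>The weak formulation for a separated test function\<close>

text \<open>Young's inequality without its sharp constant: above the threshold e^(-1/(p-1)) one has
  e a^(p-1) \<ge> 1, and below it the second summand alone suffices.\<close>

lemma le_powr_add:
  fixes a e p :: real
  assumes a: "0 \<le> a" and e: "0 < e" and p: "1 < p"
  shows "a \<le> e * a powr p + e powr (- (1 / (p - 1)))"
proof (cases "a \<le> e powr (- (1 / (p - 1)))")
  case True
  then show ?thesis using e by (simp add: add_increasing)
next
  case False
  then have ap: "a > 0" using e by (smt (verit) powr_ge_zero)
  have "(e powr (- (1 / (p - 1)))) powr (p - 1) \<le> a powr (p - 1)"
    using False p by (intro powr_mono2) auto
  moreover have "(e powr (- (1 / (p - 1)))) powr (p - 1) = inverse e"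
    unfolding powr_powr using p e by (simp add: powr_minus)
  ultimately have "e * inverse e \<le> e * a powr (p - 1)"
    using e by (intro mult_left_mono) auto
  then have "1 * a \<le> (e * a powr (p - 1)) * a"
    using e a by (intro mult_right_mono) auto
  also have "\<dots> = e * a powr p" using powr_mult_base[of a "p - 1"] a by (simp add: mult.assoc mult.commute[of "a powr _"])
  finally show ?thesis using powr_ge_zero[of e "- (1 / (p - 1))"] by linarith
qed

text \<open>For f in L^(2p) the power |f|^p lies in L^2, so Cauchy-Schwarz applies. The factor with
  \<open>Lnorm (2 * p) f\<close> is exactly what membership in \<open>Lcurve T p (2 * p)\<close>
  makes integrable in time.\<close>

lemma nn_integral_powr_mult_le:
  fixes f g :: "'a::euclidean_space \<Rightarrow> real"
  assumes p: "p > 0" and f: "f \<in> Lspace (2 * p)" and g: "g \<in> Lspace 2" and g0: "\<And>x. 0 \<le> g x"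
  shows "(\<integral>\<^sup>+x. ennreal (\<bar>f x\<bar> powr p * g x) \<partial>lborel) \<le> ennreal (Lnorm (2 * p) f powr p * sqrt (LINT x|lborel. (g x)\<^sup>2))"
proof -
  have [measurable]: "f \<in> borel_measurable borel" "g \<in> borel_measurable borel"
    and fi: "integrable lborel (\<lambda>x. \<bar>f x\<bar> powr (2 * p))" and gi: "integrable lborel (\<lambda>x. (g x)\<^sup>2)"
    using f g by (auto simp: Lspace_def)
  define Z where "Z = (LINT x|lborel. \<bar>f x\<bar> powr (2 * p))"
  define N where "N = (LINT x|lborel. (g x)\<^sup>2)"
  define X where "X = (\<integral>\<^sup>+x. ennreal (\<bar>f x\<bar> powr p * g x) \<partial>lborel)"
  have Z0: "Z \<ge> 0" and N0: "N \<ge> 0" by (auto simp: Z_def N_def)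
  have "X\<^sup>2 = (\<integral>\<^sup>+x. ennreal (\<bar>f x\<bar> powr p) * ennreal (g x) \<partial>lborel)\<^sup>2"
    unfolding X_def by (simp add: ennreal_mult g0)
  also have "\<dots> \<le> (\<integral>\<^sup>+x. (ennreal (\<bar>f x\<bar> powr p))\<^sup>2 \<partial>lborel) * (\<integral>\<^sup>+x. (ennreal (g x))\<^sup>2 \<partial>lborel)"
    by (rule Cauchy_Schwarz_nn_integral) measurable
  also have "(\<integral>\<^sup>+x. (ennreal (\<bar>f x\<bar> powr p))\<^sup>2 \<partial>lborel) = ennreal Z"
  proof -
    have "(\<bar>f x\<bar> powr p)\<^sup>2 = \<bar>f x\<bar> powr (2 * p)" for x
      by (simp add: power2_eq_square flip: powr_add)
    then show ?thesis unfolding Z_def by (simp add: ennreal_power nn_integral_eq_integral[OF fi])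
  qed
  also have "(\<integral>\<^sup>+x. (ennreal (g x))\<^sup>2 \<partial>lborel) = ennreal N"
    unfolding N_def by (simp add: ennreal_power g0 nn_integral_eq_integral[OF gi])
  finally have X2: "X\<^sup>2 \<le> ennreal (Z * N)" using Z0 N0 by (simp add: ennreal_mult)
  then have "X \<noteq> \<infinity>" by (auto simp: power2_eq_square ennreal_mult_top top_unique)
  then obtain x where x: "x \<ge> 0" "X = ennreal x" by (cases X) auto
  then have "x\<^sup>2 \<le> Z * N" using X2 Z0 N0 by (simp add: ennreal_power)
  then have "x \<le> sqrt (Z * N)" by (rule real_le_rsqrt)
  also have "\<dots> = Lnorm (2 * p) f powr p * sqrt N"
  proof -
    have "Lnorm (2 * p) f powr p = Z powr (1 / 2)"
      unfolding Lnorm_def Z_def[symmetric] powr_powr using p by simp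
    then show ?thesis using Z0 by (simp add: powr_half_sqrt real_sqrt_mult)
  qed
  finally show ?thesis unfolding X_def[symmetric] N_def[symmetric] x(2) by (rule ennreal_leI)
qed

context test_profile
begin

text \<open>The space-time integrals need a Borel function on all of space-time, whereas
  \<open>Lcurve\<close> gives joint measurability only on the strip (0,T). Hence U, which agrees
  with u on that strip.\<close>

context
  fixes \<mu> \<gamma> p \<alpha> T R :: real and k :: nat
    and U :: "real \<times> 'a \<Rightarrow> real" and u :: "real \<Rightarrow> 'a \<Rightarrow> real" and u0 u1 :: "'a \<Rightarrow> real"
  assumes R: "0 < R" and T: "0 < T" and \<mu>: "0 < \<mu>" and \<alpha>: "0 < \<alpha>" "\<alpha> < 1" "\<alpha> = 1 - \<gamma>" and p: "1 < p"
    and U [measurable]: "U \<in> borel_measurable borel"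
    and U_eq: "\<forall>t x. 0 < t \<longrightarrow> t < T \<longrightarrow> U (t, x) = u t x"
    and weak: "weak_solution \<mu> \<sigma> \<gamma> p u0 u1 T u"
    and u1: "u1 \<in> Lspace 2" and u0: "integrable lborel u0"
    and data: "integrable lborel (\<lambda>x. u1 x + \<mu> * frac_laplacian (\<sigma> / 2) u0 x)"
begin

lemma Uu: "0 < t \<Longrightarrow> t < T \<Longrightarrow> U (t, x) = u t x"
  using U_eq by blast

lemma upow_integrable:
  "integrable lborel (\<lambda>z. indicator {0<..<T} (fst z) * (\<bar>U z\<bar> powr p * \<Phi> (snd z /\<^sub>R R)))"
proof (rule integrableI_nonneg)
  define N where "N = sqrt (LINT x|lborel. (\<Phi> (x /\<^sub>R R))\<^sup>2)"
  have N0: "N \<ge> 0" by (simp add: N_def)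
  have "(\<lambda>z. indicator {0<..<T} (fst z) * (\<bar>U z\<bar> powr p * \<Phi> (snd z /\<^sub>R R))) \<in> borel_measurable borel"
    unfolding borel_prod[symmetric] using U[unfolded borel_prod[symmetric]] by measurable
  then show "(\<lambda>z. indicator {0<..<T} (fst z) * (\<bar>U z\<bar> powr p * \<Phi> (snd z /\<^sub>R R))) \<in> borel_measurable lborel"
    by simp
  then have m: "(\<lambda>z. ennreal (indicator {0<..<T} (fst z) * (\<bar>U z\<bar> powr p * \<Phi> (snd z /\<^sub>R R)))) \<in> borel_measurable (lborel \<Otimes>\<^sub>M lborel)"
    unfolding lborel_prod by (rule measurable_compose[OF _ measurable_ennreal])
  have set: "set_integrable lborel {0<..<T} (\<lambda>t. Lnorm (2 * p) (u t) powr p)"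
    and ae: "AE t in lborel. t \<in> {0<..<T} \<longrightarrow> u t \<in> Lspace (2 * p)"
    using weak by (auto simp: weak_solution_def Lcurve_def)
  have "(\<integral>\<^sup>+z. ennreal (indicator {0<..<T} (fst z) * (\<bar>U z\<bar> powr p * \<Phi> (snd z /\<^sub>R R))) \<partial>lborel) =
      (\<integral>\<^sup>+t. \<integral>\<^sup>+x. ennreal (indicator {0<..<T} t * (\<bar>U (t, x)\<bar> powr p * \<Phi> (x /\<^sub>R R))) \<partial>lborel \<partial>lborel)"
    unfolding lborel_prod[symmetric] lborel.nn_integral_fst[OF m, symmetric] by simp
  also have "\<dots> \<le> (\<integral>\<^sup>+t. ennreal (indicator {0<..<T} t * (Lnorm (2 * p) (u t) powr p * N)) \<partial>lborel)"
  proof (rule nn_integral_mono_AE)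
    show "AE t in lborel. (\<integral>\<^sup>+x. ennreal (indicator {0<..<T} t * (\<bar>U (t, x)\<bar> powr p * \<Phi> (x /\<^sub>R R))) \<partial>lborel) \<le>
        ennreal (indicator {0<..<T} t * (Lnorm (2 * p) (u t) powr p * N))"
      using ae
    proof eventually_elim
      case (elim t)
      show ?case
      proof (cases "t \<in> {0<..<T}")
        case True
        with nn_integral_powr_mult_le[OF _ _ \<Phi>_scaled(2)[OF R] \<Phi>_nonneg, of p "u t"] elim p Uu[of t]
        show ?thesis by (simp add: N_def)
      qed simp
    qed
  qed
  also have "\<dots> < \<infinity>"
  proof -
    have "integrable lborel (\<lambda>t. (indicator {0<..<T} t * (Lnorm (2 * p) (u t) powr p)) * N)"
      using set unfolding set_integrable_def by simp
    then have i: "integrable lborel (\<lambda>t. indicator {0<..<T} t * (Lnorm (2 * p) (u t) powr p * N))"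
      by (simp only: mult.assoc)
    show ?thesis by (subst nn_integral_eq_integral[OF i]) (auto simp: N0)
  qed
  finally show "(\<integral>\<^sup>+z. ennreal (indicator {0<..<T} (fst z) * (\<bar>U z\<bar> powr p * \<Phi> (snd z /\<^sub>R R))) \<partial>lborel) < \<infinity>" .
qed (simp add: \<Phi>_nonneg)

text \<open>The exponent k + 2 + \<alpha> is what the memory kernel makes of the cut-off; the
  exponent k of \<open>lin_dens\<close> is what two time derivatives leave of it.\<close>

definition pow_dens :: "real \<times> 'a \<Rightarrow> real" where
  "pow_dens z = indicator {0<..<T} (fst z) * (\<bar>U z\<bar> powr p * (1 - fst z / T) powr (real k + 2 + \<alpha>) * \<Phi> (snd z /\<^sub>R R))"

definition lin_dens :: "real \<times> 'a \<Rightarrow> real" where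
  "lin_dens z = indicator {0<..<T} (fst z) * (\<bar>U z\<bar> * (1 - fst z / T) ^ k * \<Phi> (snd z /\<^sub>R R))"

lemma dens_measurable [measurable]: "pow_dens \<in> borel_measurable borel" "lin_dens \<in> borel_measurable borel"
  unfolding pow_dens_def[abs_def] lin_dens_def[abs_def] borel_prod[symmetric]
  using U[unfolded borel_prod[symmetric]] by measurable

lemma dens_nonneg: "0 \<le> pow_dens z" "0 \<le> lin_dens z"
  unfolding pow_dens_def lin_dens_def using T \<Phi>_nonneg by (auto simp: indicator_def field_simps)

lemma pow_dens_integrable: "integrable lborel pow_dens"
proof (rule Bochner_Integration.integrable_bound[OF upow_integrable])
  show "AE z in lborel. norm (pow_dens z) \<le> norm (indicator {0<..<T} (fst z) * (\<bar>U z\<bar> powr p * \<Phi> (snd z /\<^sub>R R)))"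
  proof (rule AE_I2)
    fix z :: "real \<times> 'a"
    have "\<bar>U z\<bar> powr p * (1 - fst z / T) powr (real k + 2 + \<alpha>) * \<Phi> (snd z /\<^sub>R R) \<le> \<bar>U z\<bar> powr p * 1 * \<Phi> (snd z /\<^sub>R R)"
      if "0 < fst z" "fst z < T"
    proof (intro mult_right_mono mult_left_mono)
      have "0 < 1 - fst z / T" "1 - fst z / T < 1" using that T by auto
      then have "(1 - fst z / T) powr (real k + 2 + \<alpha>) \<le> 1 powr (real k + 2 + \<alpha>)" using \<alpha> by (intro powr_mono2) auto
      then show "(1 - fst z / T) powr (real k + 2 + \<alpha>) \<le> 1" by simp
    qed (auto simp: \<Phi>_nonneg)
    then show "norm (pow_dens z) \<le> norm (indicator {0<..<T} (fst z) * (\<bar>U z\<bar> powr p * \<Phi> (snd z /\<^sub>R R)))"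
      using \<Phi>_nonneg[of "snd z /\<^sub>R R"] by (auto simp: pow_dens_def indicator_def abs_mult)
  qed
qed measurable

lemma cylinder_integrable: "integrable lborel (\<lambda>z. indicator {0<..<T} (fst z) * \<Phi> (snd z /\<^sub>R R))"
proof -
  have "integrable (lborel \<Otimes>\<^sub>M lborel) (\<lambda>(t, x). indicat_real {0<..<T} t * \<Phi> (x /\<^sub>R R))"
    by (intro integrable_pair_mult sigma_finite_lborel \<Phi>_scaled R integrable_real_indicator) (use T in auto)
  then show ?thesis by (simp add: lborel_prod case_prod_unfold)
qed

lemma cylinder_integral: "(LINT z|lborel. indicator {0<..<T} (fst z) * \<Phi> (snd z /\<^sub>R R)) = T * R ^ DIM('a) * (LINT x|lborel. \<Phi> x)"
proof -
  have i: "integrable (lborel \<Otimes>\<^sub>M lborel) (\<lambda>(t, x). indicat_real {0<..<T} t * \<Phi> (x /\<^sub>R R))"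
    by (intro integrable_pair_mult sigma_finite_lborel \<Phi>_scaled R integrable_real_indicator) (use T in auto)
  have "(LINT z|lborel. indicator {0<..<T} (fst z) * \<Phi> (snd z /\<^sub>R R)) = (LINT t|lborel. LINT x|lborel. indicat_real {0<..<T} t * \<Phi> (x /\<^sub>R R))"
    using lborel_pair.integral_fst[OF i] by (simp add: lborel_prod case_prod_unfold)
  also have "\<dots> = T * (LINT x|lborel. \<Phi> (x /\<^sub>R R))"
    using T by (simp add: measure_def)
  also have "(LINT x|lborel. \<Phi> (x /\<^sub>R R)) = R ^ DIM('a) * (LINT x|lborel. \<Phi> x)"
    using lborel_integral_affine[of "\<lambda>x. \<Phi> (x /\<^sub>R R)" R 0] R by simp
  finally show ?thesis by simp
qed

lemma lin_dens_integrable: "integrable lborel lin_dens"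
proof (rule Bochner_Integration.integrable_bound)
  show "integrable lborel (\<lambda>z. indicator {0<..<T} (fst z) * (\<bar>U z\<bar> powr p * \<Phi> (snd z /\<^sub>R R)) + indicator {0<..<T} (fst z) * \<Phi> (snd z /\<^sub>R R))"
    by (intro Bochner_Integration.integrable_add upow_integrable cylinder_integrable)
  show "AE z in lborel. norm (lin_dens z) \<le> norm (indicator {0<..<T} (fst z) * (\<bar>U z\<bar> powr p * \<Phi> (snd z /\<^sub>R R)) + indicator {0<..<T} (fst z) * \<Phi> (snd z /\<^sub>R R))"
  proof (rule AE_I2)
    fix z :: "real \<times> 'a"
    have "\<bar>U z\<bar> * (1 - fst z / T) ^ k * \<Phi> (snd z /\<^sub>R R) \<le> (\<bar>U z\<bar> powr p + 1) * \<Phi> (snd z /\<^sub>R R)"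
      if "0 < fst z" "fst z < T"
    proof (rule mult_right_mono)
      have "0 < 1 - fst z / T" "1 - fst z / T < 1" using that T by auto
      then have "\<bar>U z\<bar> * (1 - fst z / T) ^ k \<le> \<bar>U z\<bar> * 1" by (intro mult_left_mono power_le_one) auto
      also have "\<dots> \<le> \<bar>U z\<bar> powr p + 1" using le_powr_add[of "\<bar>U z\<bar>" 1 p] p by simp
      finally show "\<bar>U z\<bar> * (1 - fst z / T) ^ k \<le> \<bar>U z\<bar> powr p + 1" .
    qed (rule \<Phi>_nonneg)
    then show "norm (lin_dens z) \<le> norm (indicator {0<..<T} (fst z) * (\<bar>U z\<bar> powr p * \<Phi> (snd z /\<^sub>R R)) + indicator {0<..<T} (fst z) * \<Phi> (snd z /\<^sub>R R))"
      using \<Phi>_nonneg[of "snd z /\<^sub>R R"] dens_nonneg(2)[of z] by (auto simp: lin_dens_def indicator_def distrib_right)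
  qed
qed measurable

text \<open>One estimate for all three terms on the right: c is the cut-off or one of its
  derivatives, g a rescaled \<Phi>, L or W. Domination by \<open>lin_dens\<close> justifies
  Fubini.\<close>

lemma space_time_term_le:
  assumes [measurable]: "c \<in> borel_measurable borel" "g \<in> borel_measurable borel"
    and le: "\<And>t x. 0 < t \<Longrightarrow> t < T \<Longrightarrow> \<bar>c t * g x\<bar> \<le> D * ((1 - t / T) ^ k * \<Phi> (x /\<^sub>R R))"
  shows "\<bar>LINT t:{0<..<T}|lborel. LINT x|lborel. u t x * (c t * g x)\<bar> \<le> D * (LINT z|lborel. lin_dens z)"
proof -
  let ?q = "\<lambda>z. indicator {0<..<T} (fst z) * (U z * (c (fst z) * g (snd z)))"
  have le': "norm (?q z) \<le> D * lin_dens z" for z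
  proof (cases "fst z \<in> {0<..<T}")
    case True
    then have "\<bar>U z\<bar> * \<bar>c (fst z) * g (snd z)\<bar> \<le> \<bar>U z\<bar> * (D * ((1 - fst z / T) ^ k * \<Phi> (snd z /\<^sub>R R)))"
      by (intro mult_left_mono le) auto
    then show ?thesis using True by (simp add: lin_dens_def abs_mult mult_ac)
  qed (simp add: lin_dens_def)
  have qm: "?q \<in> borel_measurable borel"
    unfolding borel_prod[symmetric] using U[unfolded borel_prod[symmetric]] by measurable
  have De: "integrable lborel (\<lambda>z. D * lin_dens z)" using lin_dens_integrable by simp
  have qi: "integrable lborel ?q"
  proof (rule Bochner_Integration.integrable_bound[OF De])
    show "AE z in lborel. norm (?q z) \<le> norm (D * lin_dens z)"
      by (rule AE_I2, rule order_trans[OF le']) simp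
  qed (use qm in simp)
  have "(LINT t:{0<..<T}|lborel. LINT x|lborel. u t x * (c t * g x)) = (LINT t|lborel. LINT x|lborel. ?q (t, x))"
    unfolding set_lebesgue_integral_def
  proof (intro Bochner_Integration.integral_cong refl)
    fix t
    show "indicator {0<..<T} t *\<^sub>R (LINT x|lborel. u t x * (c t * g x)) = (LINT x|lborel. ?q (t, x))"
      using Uu[of t] by (cases "t \<in> {0<..<T}") auto
  qed
  also have "\<dots> = (LINT z|lborel. ?q z)"
    using lborel_pair.integral_fst'[of ?q] qi by (simp add: lborel_prod)
  also have "\<bar>\<dots>\<bar> \<le> (LINT z|lborel. norm (?q z))" using integral_norm_bound[of lborel ?q] by simp
  also have "\<dots> \<le> (LINT z|lborel. D * lin_dens z)"
    using qi by (intro integral_mono De le') auto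
  finally show ?thesis by simp
qed

text \<open>Tonelli makes the t-integral innermost, where it is
  \<open>memory_kernel_integral\<close>. Integrability of \<open>pow_dens\<close> gives the
  finiteness needed to return to the iterated Bochner integral.\<close>

lemma memory_term:
  "Gamma \<alpha> * (LINT t:{0<..<T}|lborel. LINT x|lborel. RL_integral \<alpha> (\<lambda>s. \<bar>u s x\<bar> powr p) t * (cutoff k T t * \<Phi> (x /\<^sub>R R))) =
    Beta \<alpha> (real k + 3) * T powr \<alpha> * (LINT z|lborel. pow_dens z)"
proof -
  define K where "K = Beta \<alpha> (real k + 3) * T powr \<alpha>"
  have K0: "K \<ge> 0" using \<alpha> by (auto simp: K_def Beta_def Gamma_real_pos intro!: mult_nonneg_nonneg divide_nonneg_nonneg less_imp_le)
  have G: "Gamma \<alpha> > 0" using \<alpha> by (simp add: Gamma_real_pos)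
  define f where "f = (\<lambda>(t, x, s). indicator {0<..<T} t * (indicator {0<..<t} s * ((t - s) powr (\<alpha> - 1) * \<bar>U (s, x)\<bar> powr p * (cutoff k T t * \<Phi> (x /\<^sub>R R)))))"
  have cut [measurable]: "cutoff k T \<in> borel_measurable borel" unfolding cutoff_def[abs_def] by measurable
  have fm [measurable]: "f \<in> borel_measurable (borel \<Otimes>\<^sub>M (borel \<Otimes>\<^sub>M borel))"
    unfolding f_def using U[unfolded borel_prod[symmetric]]
    by (simp add: indicator_def greaterThanLessThan_def) measurable
  have cut0: "0 \<le> cutoff k T t" if "t < T" for t using that T by (simp add: cutoff_def)
  have fnn: "0 \<le> f z" for z
    unfolding f_def using cut0 \<Phi>_nonneg by (auto simp: indicator_def split: prod.splits)
  have "(\<integral>\<^sup>+t. \<integral>\<^sup>+x. \<integral>\<^sup>+s. ennreal (f (t, x, s)) \<partial>lborel \<partial>lborel \<partial>lborel) = (\<integral>\<^sup>+s. \<integral>\<^sup>+x. \<integral>\<^sup>+t. ennreal (f (t, x, s)) \<partial>lborel \<partial>lborel \<partial>lborel)"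
    by (rule nn_integral_reorder3) measurable
  also have "\<dots> = (\<integral>\<^sup>+s. \<integral>\<^sup>+x. ennreal (K * pow_dens (s, x)) \<partial>lborel \<partial>lborel)"
  proof (intro nn_integral_cong)
    fix s :: real and x :: 'a
    show "(\<integral>\<^sup>+t. ennreal (f (t, x, s)) \<partial>lborel) = ennreal (K * pow_dens (s, x))"
    proof (cases "s \<in> {0<..<T}")
      case True
      have "f (t, x, s) = (\<bar>U (s, x)\<bar> powr p * \<Phi> (x /\<^sub>R R)) * (indicator {s<..<T} t * ((t - s) powr (\<alpha> - 1) * cutoff k T t))" for t
        unfolding f_def using True by (auto simp: indicator_def)
      then have "(\<integral>\<^sup>+t. ennreal (f (t, x, s)) \<partial>lborel) = (\<integral>\<^sup>+t. ennreal (\<bar>U (s, x)\<bar> powr p * \<Phi> (x /\<^sub>R R)) * ennreal (indicator {s<..<T} t * ((t - s) powr (\<alpha> - 1) * cutoff k T t)) \<partial>lborel)"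
        using cut0 \<Phi>_nonneg by (intro nn_integral_cong) (simp add: ennreal_mult')
      also have "\<dots> = ennreal (\<bar>U (s, x)\<bar> powr p * \<Phi> (x /\<^sub>R R)) * ennreal (K * (1 - s / T) powr (real k + 2 + \<alpha>))"
        using True \<alpha>(1) by (subst nn_integral_cmult) (auto simp: memory_kernel_integral K_def)
      also have "\<dots> = ennreal (K * pow_dens (s, x))"
        using True K0 \<Phi>_nonneg by (simp add: pow_dens_def mult_ac flip: ennreal_mult')
      finally show ?thesis .
    next
      case False
      then have "f (t, x, s) = 0" for t unfolding f_def by (auto simp: indicator_def)
      then show ?thesis using False by (simp add: pow_dens_def)
    qed
  qed
  also have "\<dots> = (\<integral>\<^sup>+z. ennreal (K * pow_dens z) \<partial>lborel)"
    by (subst lborel.nn_integral_fst) (auto simp: lborel_prod)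
  also have "\<dots> = ennreal (LINT z|lborel. K * pow_dens z)"
    using pow_dens_integrable K0 dens_nonneg by (intro nn_integral_eq_integral) auto
  finally have nn: "(\<integral>\<^sup>+t. \<integral>\<^sup>+x. \<integral>\<^sup>+s. ennreal (f (t, x, s)) \<partial>lborel \<partial>lborel \<partial>lborel) = ennreal (K * (LINT z|lborel. pow_dens z))"
    by simp
  have "Gamma \<alpha> * (LINT t:{0<..<T}|lborel. LINT x|lborel. RL_integral \<alpha> (\<lambda>s. \<bar>u s x\<bar> powr p) t * (cutoff k T t * \<Phi> (x /\<^sub>R R))) =
      (LINT t|lborel. LINT x|lborel. LINT s|lborel. f (t, x, s))"
    unfolding set_lebesgue_integral_def integral_mult_right_zero[symmetric]
  proof (intro Bochner_Integration.integral_cong refl)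
    fix t
    show "Gamma \<alpha> * (indicator {0<..<T} t *\<^sub>R (LINT x|lborel. RL_integral \<alpha> (\<lambda>s. \<bar>u s x\<bar> powr p) t * (cutoff k T t * \<Phi> (x /\<^sub>R R)))) =
      (LINT x|lborel. LINT s|lborel. f (t, x, s))"
    proof (cases "t \<in> {0<..<T}")
      case True
      have "Gamma \<alpha> * (RL_integral \<alpha> (\<lambda>s. \<bar>u s x\<bar> powr p) t * (cutoff k T t * \<Phi> (x /\<^sub>R R))) = (LINT s|lborel. f (t, x, s))" for x
      proof -
        have "Gamma \<alpha> * (RL_integral \<alpha> (\<lambda>s. \<bar>u s x\<bar> powr p) t * (cutoff k T t * \<Phi> (x /\<^sub>R R))) =
            (LINT s|lborel. indicator {0<..<t} s *\<^sub>R ((t - s) powr (- (1 - \<alpha>)) * \<bar>u s x\<bar> powr p)) * (cutoff k T t * \<Phi> (x /\<^sub>R R))"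
          unfolding RL_integral_def set_lebesgue_integral_def using G by simp
        also have "\<dots> = (LINT s|lborel. indicator {0<..<t} s *\<^sub>R ((t - s) powr (- (1 - \<alpha>)) * \<bar>u s x\<bar> powr p) * (cutoff k T t * \<Phi> (x /\<^sub>R R)))"
          by (rule integral_mult_left_zero[symmetric])
        also have "\<dots> = (LINT s|lborel. f (t, x, s))"
        proof (intro Bochner_Integration.integral_cong refl)
          fix s
          show "indicator {0<..<t} s *\<^sub>R ((t - s) powr (- (1 - \<alpha>)) * \<bar>u s x\<bar> powr p) * (cutoff k T t * \<Phi> (x /\<^sub>R R)) = f (t, x, s)"
            using True Uu[of s x] by (cases "s \<in> {0<..<t}") (auto simp: f_def)
        qed
        finally show ?thesis .
      qed
      then show ?thesis using True by (simp only: integral_mult_right_zero[symmetric] indicator_simps scaleR_one)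
    next
      case False
      then have "f (t, x, s) = 0" for x s unfolding f_def by auto
      then show ?thesis using False by simp
    qed
  qed
  also have "\<dots> = K * (LINT z|lborel. pow_dens z)"
    by (subst iterated_integral_eq_nn_integral[OF fm fnn]) (use nn K0 dens_nonneg in \<open>auto intro!: mult_nonneg_nonneg Bochner_Integration.integral_nonneg\<close>)
  finally show ?thesis by (simp add: K_def)
qed

lemma u_measurable: "0 < t \<Longrightarrow> t < T \<Longrightarrow> u t \<in> borel_measurable borel"
proof -
  assume t: "0 < t" "t < T"
  have "(\<lambda>x. U (t, x)) \<in> borel_measurable borel"
    using U[unfolded borel_prod[symmetric]] by measurable
  moreover have "(\<lambda>x. U (t, x)) = u t" using Uu[OF t] by auto
  ultimately show ?thesis by simp
qed

text \<open>At each fixed time the chosen operator agrees with the explicit formula outside a null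
  set, which the integral over x does not see.\<close>

lemma laplacian_term:
  "(LINT t:{0<..<T}|lborel. LINT x|lborel. u t x * laplacian (\<lambda>x. cutoff k T t * \<Phi> (x /\<^sub>R R)) x) =
    (LINT t:{0<..<T}|lborel. LINT x|lborel. u t x * (cutoff k T t * - (R powr (- 2) * L (x /\<^sub>R R))))"
proof (intro set_lebesgue_integral_cong allI impI)
  fix t assume "t \<in> {0<..<T}"
  then have [measurable]: "u t \<in> borel_measurable borel" by (intro u_measurable) auto
  have [measurable]: "frac_laplacian 1 (\<lambda>x. cutoff k T t * \<Phi> (x /\<^sub>R R)) \<in> borel_measurable borel"
    using laplacian_scaled(1)[OF R] by (simp add: Lspace_2_iff)
  show "(LINT x|lborel. u t x * laplacian (\<lambda>x. cutoff k T t * \<Phi> (x /\<^sub>R R)) x) =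
      (LINT x|lborel. u t x * (cutoff k T t * - (R powr (- 2) * L (x /\<^sub>R R))))"
    unfolding laplacian_def
  proof (rule integral_cong_AE)
    show "AE x in lborel. u t x * - frac_laplacian 1 (\<lambda>x. cutoff k T t * \<Phi> (x /\<^sub>R R)) x = u t x * (cutoff k T t * - (R powr (- 2) * L (x /\<^sub>R R)))"
      using laplacian_scaled(2)[OF R, of "cutoff k T t"] by eventually_elim simp
  qed measurable
qed simp

lemma frac_laplacian_term:
  "(LINT t:{0<..<T}|lborel. LINT x|lborel. u t x * frac_laplacian (\<sigma> / 2) (\<lambda>x. cutoff' k T t * \<Phi> (x /\<^sub>R R)) x) =
    (LINT t:{0<..<T}|lborel. LINT x|lborel. u t x * (cutoff' k T t * (R powr (- \<sigma>) * W (x /\<^sub>R R))))"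
proof (intro set_lebesgue_integral_cong allI impI)
  fix t assume "t \<in> {0<..<T}"
  then have [measurable]: "u t \<in> borel_measurable borel" by (intro u_measurable) auto
  have [measurable]: "frac_laplacian (\<sigma> / 2) (\<lambda>x. cutoff' k T t * \<Phi> (x /\<^sub>R R)) \<in> borel_measurable borel"
    using frac_laplacian_scaled(1)[OF R] by (simp add: Lspace_2_iff)
  show "(LINT x|lborel. u t x * frac_laplacian (\<sigma> / 2) (\<lambda>x. cutoff' k T t * \<Phi> (x /\<^sub>R R)) x) =
      (LINT x|lborel. u t x * (cutoff' k T t * (R powr (- \<sigma>) * W (x /\<^sub>R R))))"
  proof (rule integral_cong_AE)
    show "AE x in lborel. u t x * frac_laplacian (\<sigma> / 2) (\<lambda>x. cutoff' k T t * \<Phi> (x /\<^sub>R R)) x = u t x * (cutoff' k T t * (R powr (- \<sigma>) * W (x /\<^sub>R R)))"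
      using frac_laplacian_scaled(2)[OF R, of "cutoff' k T t"] by eventually_elim simp
  qed measurable
qed simp

text \<open>Integrability is assumed for the sum u1 + \<mu>
  \<open>frac_laplacian (\<sigma> / 2) u0\<close>, while u1 times the profile is integrable as a
  product of L^2 functions. The fractional term is therefore obtained as a difference.\<close>

lemma data_term:
  "(LINT x|lborel. u1 x * \<Phi> (x /\<^sub>R R)) + \<mu> * (LINT x|lborel. frac_laplacian (\<sigma> / 2) u0 x * \<Phi> (x /\<^sub>R R)) =
    (LINT x|lborel. (u1 x + \<mu> * frac_laplacian (\<sigma> / 2) u0 x) * \<Phi> (x /\<^sub>R R))"
proof -
  let ?g = "frac_laplacian (\<sigma> / 2) u0"
  have [measurable]: "u1 \<in> borel_measurable borel" using u1 by (simp add: Lspace_2_iff)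
  have i1: "integrable lborel (\<lambda>x. u1 x * \<Phi> (x /\<^sub>R R))"
    using u1 \<Phi>_scaled(2)[OF R] by (intro integrable_mult_L2) (auto simp: Lspace_2_iff)
  have i2: "integrable lborel (\<lambda>x. (u1 x + \<mu> * ?g x) * \<Phi> (x /\<^sub>R R))"
  proof (rule Bochner_Integration.integrable_bound)
    show "integrable lborel (\<lambda>x. (u1 x + \<mu> * ?g x) * B)" using data by simp
    have [measurable]: "(\<lambda>x. u1 x + \<mu> * ?g x) \<in> borel_measurable borel" using data by auto
    show "(\<lambda>x. (u1 x + \<mu> * ?g x) * \<Phi> (x /\<^sub>R R)) \<in> borel_measurable lborel" by measurable
    show "AE x in lborel. norm ((u1 x + \<mu> * ?g x) * \<Phi> (x /\<^sub>R R)) \<le> norm ((u1 x + \<mu> * ?g x) * B)"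
    proof (rule AE_I2)
      fix x
      have "\<bar>\<Phi> (x /\<^sub>R R)\<bar> \<le> \<bar>B\<bar>" using \<Phi>_nonneg[of "x /\<^sub>R R"] \<Phi>_le[of "x /\<^sub>R R"] by linarith
      then show "norm ((u1 x + \<mu> * ?g x) * \<Phi> (x /\<^sub>R R)) \<le> norm ((u1 x + \<mu> * ?g x) * B)"
        unfolding real_norm_def abs_mult by (rule mult_left_mono) simp
    qed
  qed
  have "\<mu> * (LINT x|lborel. ?g x * \<Phi> (x /\<^sub>R R)) = (LINT x|lborel. (u1 x + \<mu> * ?g x) * \<Phi> (x /\<^sub>R R) - u1 x * \<Phi> (x /\<^sub>R R))"
    unfolding integral_mult_right_zero[symmetric] by (intro Bochner_Integration.integral_cong) (auto simp: algebra_simps)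
  also have "\<dots> = (LINT x|lborel. (u1 x + \<mu> * ?g x) * \<Phi> (x /\<^sub>R R)) - (LINT x|lborel. u1 x * \<Phi> (x /\<^sub>R R))"
    by (rule Bochner_Integration.integral_diff[OF i2 i1])
  finally show ?thesis by simp
qed

lemma weak_test_inequality:
  "Beta \<alpha> (real k + 3) * T powr \<alpha> * (LINT z|lborel. pow_dens z)
    + (LINT x|lborel. (u1 x + \<mu> * frac_laplacian (\<sigma> / 2) u0 x) * \<Phi> (x /\<^sub>R R))
    + real (k + 2) / T * (LINT x|lborel. u0 x * \<Phi> (x /\<^sub>R R))
    \<le> (real (k + 2) * real (k + 1) / T\<^sup>2 + C * R powr (- 2) + \<mu> * (real (k + 2) / T * (C * R powr (- \<sigma>)))) * (LINT z|lborel. lin_dens z)"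
proof -
  have [measurable]: "cutoff k T \<in> borel_measurable borel" "cutoff' k T \<in> borel_measurable borel" "cutoff'' k T \<in> borel_measurable borel"
    using cutoff_continuous_on[of UNIV k T] by (auto intro: borel_measurable_continuous_onI)
  let ?E = "LINT z|lborel. lin_dens z"
  let ?T1 = "LINT t:{0<..<T}|lborel. LINT x|lborel. u t x * (cutoff'' k T t * \<Phi> (x /\<^sub>R R))"
  let ?T2 = "LINT t:{0<..<T}|lborel. LINT x|lborel. u t x * (cutoff k T t * - (R powr (- 2) * L (x /\<^sub>R R)))"
  let ?T3 = "LINT t:{0<..<T}|lborel. LINT x|lborel. u t x * (cutoff' k T t * (R powr (- \<sigma>) * W (x /\<^sub>R R)))"
  have unit: "0 < 1 - t / T" "1 - t / T < 1" if "0 < t" "t < T" for t using that T by auto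
  have T1: "\<bar>?T1\<bar> \<le> (real (k + 2) * real (k + 1) / T\<^sup>2) * ?E"
  proof (rule space_time_term_le)
    fix t x assume t: "0 < t" "t < T"
    show "\<bar>cutoff'' k T t * \<Phi> (x /\<^sub>R R)\<bar> \<le> real (k + 2) * real (k + 1) / T\<^sup>2 * ((1 - t / T) ^ k * \<Phi> (x /\<^sub>R R))"
      using unit[OF t] \<Phi>_nonneg[of "x /\<^sub>R R"] unfolding cutoff''_def by (simp add: abs_mult mult.assoc)
  qed measurable
  have T2: "\<bar>?T2\<bar> \<le> (C * R powr (- 2)) * ?E"
  proof (rule space_time_term_le)
    fix t x assume t: "0 < t" "t < T"
    have "(1 - t / T) ^ (k + 2) \<le> (1 - t / T) ^ k" using unit[OF t] by (intro power_decreasing) auto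
    then have "\<bar>cutoff k T t\<bar> * (R powr (- 2) * \<bar>L (x /\<^sub>R R)\<bar>) \<le> (1 - t / T) ^ k * (R powr (- 2) * (C * \<Phi> (x /\<^sub>R R)))"
      using unit[OF t] L_le[of "x /\<^sub>R R"] by (intro mult_mono) (auto simp: cutoff_def power_abs)
    then show "\<bar>cutoff k T t * - (R powr (- 2) * L (x /\<^sub>R R))\<bar> \<le> C * R powr (- 2) * ((1 - t / T) ^ k * \<Phi> (x /\<^sub>R R))"
      by (simp add: abs_mult mult_ac)
  qed measurable
  have T3: "\<bar>?T3\<bar> \<le> (real (k + 2) / T * (C * R powr (- \<sigma>))) * ?E"
  proof (rule space_time_term_le)
    fix t x assume t: "0 < t" "t < T"
    have "(1 - t / T) ^ (k + 1) \<le> (1 - t / T) ^ k" using unit[OF t] by (intro power_decreasing) auto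
    then have "(real (k + 2) / T * (1 - t / T) ^ (k + 1)) * (R powr (- \<sigma>) * \<bar>W (x /\<^sub>R R)\<bar>) \<le> (real (k + 2) / T * (1 - t / T) ^ k) * (R powr (- \<sigma>) * (C * \<Phi> (x /\<^sub>R R)))"
      using unit[OF t] W_le[of "x /\<^sub>R R"] T by (intro mult_mono mult_left_mono) auto
    moreover have "\<bar>cutoff' k T t\<bar> = real (k + 2) / T * (1 - t / T) ^ (k + 1)"
      using unit[OF t] T by (simp add: cutoff'_def abs_mult power_abs)
    ultimately show "\<bar>cutoff' k T t * (R powr (- \<sigma>) * W (x /\<^sub>R R))\<bar> \<le> real (k + 2) / T * (C * R powr (- \<sigma>)) * ((1 - t / T) ^ k * \<Phi> (x /\<^sub>R R))"
      by (simp only: abs_mult abs_of_nonneg powr_ge_zero mult_ac)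
  qed measurable
  have "Gamma \<alpha> * (LINT t:{0<..<T}|lborel. LINT x|lborel. RL_integral \<alpha> (\<lambda>s. \<bar>u s x\<bar> powr p) t * (cutoff k T t * \<Phi> (x /\<^sub>R R)))
      + (LINT x|lborel. u1 x * (cutoff k T 0 * \<Phi> (x /\<^sub>R R)))
      - (LINT x|lborel. u0 x * (cutoff' k T 0 * \<Phi> (x /\<^sub>R R)))
      + \<mu> * (LINT x|lborel. frac_laplacian (\<sigma> / 2) u0 x * (cutoff k T 0 * \<Phi> (x /\<^sub>R R)))
    = (LINT t:{0<..<T}|lborel. LINT x|lborel. u t x * (cutoff'' k T t * \<Phi> (x /\<^sub>R R)))
      - (LINT t:{0<..<T}|lborel. LINT x|lborel. u t x * laplacian (\<lambda>x. cutoff k T t * \<Phi> (x /\<^sub>R R)) x)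
      - \<mu> * (LINT t:{0<..<T}|lborel. LINT x|lborel. u t x * frac_laplacian (\<sigma> / 2) (\<lambda>x. cutoff' k T t * \<Phi> (x /\<^sub>R R)) x)"
    using weak test_function_sep[OF R T, of k] unfolding weak_solution_def Let_def \<alpha>(3)[symmetric] by blast
  then have eq: "Beta \<alpha> (real k + 3) * T powr \<alpha> * (LINT z|lborel. pow_dens z)
      + (LINT x|lborel. u1 x * (cutoff k T 0 * \<Phi> (x /\<^sub>R R)))
      - (LINT x|lborel. u0 x * (cutoff' k T 0 * \<Phi> (x /\<^sub>R R)))
      + \<mu> * (LINT x|lborel. frac_laplacian (\<sigma> / 2) u0 x * (cutoff k T 0 * \<Phi> (x /\<^sub>R R)))
    = ?T1 - ?T2 - \<mu> * ?T3"
    unfolding memory_term laplacian_term frac_laplacian_term .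
  have c0: "cutoff k T 0 = 1" by (simp add: cutoff_def)
  \<comment> \<open>The derivative of the cut-off at 0 is -(k + 2)/T, so this term of the data
    carries a factor 1/T and disappears in the limit.\<close>
  have c1: "(LINT x|lborel. u0 x * (cutoff' k T 0 * \<Phi> (x /\<^sub>R R))) = - (real (k + 2) / T * (LINT x|lborel. u0 x * \<Phi> (x /\<^sub>R R)))"
  proof -
    have "u0 x * (cutoff' k T 0 * \<Phi> (x /\<^sub>R R)) = - (real (k + 2) / T) * (u0 x * \<Phi> (x /\<^sub>R R))" for x
      by (simp add: cutoff'_def)
    then show ?thesis by (simp only: integral_mult_right_zero)
  qed
  have "\<mu> * \<bar>?T3\<bar> \<le> \<mu> * ((real (k + 2) / T * (C * R powr (- \<sigma>))) * ?E)"
    using T3 \<mu> by (intro mult_left_mono) auto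
  moreover have "- (\<mu> * ?T3) \<le> \<mu> * \<bar>?T3\<bar>"
    using \<mu> abs_ge_minus_self[of ?T3] mult_left_mono[of "- ?T3" "\<bar>?T3\<bar>" \<mu>] by simp
  ultimately have "- (\<mu> * ?T3) \<le> (\<mu> * (real (k + 2) / T * (C * R powr (- \<sigma>)))) * ?E"
    by (simp only: mult.assoc)
  \<comment> \<open>The bookkeeping is stated for real variables, so that the arithmetic does not
    meet the integrals; the double negation matches the sign produced by \<open>c1\<close>.\<close>
  moreover have "A + D + Z \<le> (a + b + c) * E"
    if "A + X - - Z + Y = t1 - t2 - t3" "X + Y = D" "\<bar>t1\<bar> \<le> a * E" "\<bar>t2\<bar> \<le> b * E" "- t3 \<le> c * E"
    for A D Z X Y t1 t2 t3 a b c E :: real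
    unfolding distrib_right using that by linarith
  ultimately show ?thesis
    using eq[unfolded c0 mult_1 c1] data_term T1 T2 by blast
qed

end

end

section \<open>Vanishing of global solutions\<close>

text \<open>If the minimum is l y, the claim is trivial; otherwise it is \<open>le_powr_add\<close>
  with e = L/l. The minimum keeps two virtues together: it vanishes as l \<longrightarrow> 0, and it
  is dominated by L y^p independently of l.\<close>

lemma mult_le_min_powr_add:
  fixes y l L p :: real
  assumes y: "0 \<le> y" and l: "0 < l" and L: "0 < L" and p: "1 < p"
  shows "l * y \<le> min (l * y) (L * y powr p) + l powr (p / (p - 1)) * L powr (- (1 / (p - 1)))"
proof -
  have "l * y \<le> L * y powr p + l powr (p / (p - 1)) * L powr (- (1 / (p - 1)))"
  proof -
    have "l * y \<le> l * ((L / l) * y powr p + (L / l) powr (- (1 / (p - 1))))"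
      using le_powr_add[OF y _ p, of "L / l"] l L by (intro mult_left_mono) auto
    also have "\<dots> = L * y powr p + l * (L / l) powr (- (1 / (p - 1)))"
      using l by (simp add: algebra_simps)
    also have "l * (L / l) powr (- (1 / (p - 1))) = (l * l powr (1 / (p - 1))) * L powr (- (1 / (p - 1)))"
      using l L by (simp add: powr_divide powr_minus field_simps)
    also have "l * l powr (1 / (p - 1)) = l powr (1 + 1 / (p - 1))"
      using powr_mult_base[of l "1 / (p - 1)"] l by simp
    also have "1 + 1 / (p - 1) = p / (p - 1)" using p by (simp add: field_simps)
    finally show ?thesis .
  qed
  then show ?thesis by (auto simp: min_def)
qed

context test_profile
begin

context
  fixes \<mu> \<gamma> p \<alpha> \<kappa> Bd :: real and k :: nat
    and U :: "real \<times> 'a \<Rightarrow> real" and u :: "real \<Rightarrow> 'a \<Rightarrow> real" and u0 u1 :: "'a \<Rightarrow> real"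
  assumes \<mu>: "0 < \<mu>" and \<alpha>: "0 < \<alpha>" "\<alpha> < 1" "\<alpha> = 1 - \<gamma>" and p: "1 < p" and \<kappa>: "0 < \<kappa>"
    \<comment> \<open>k is so large that \<open>((1 - t/T)^k)^p \<le> (1 - t/T)^(k+2+\<alpha>)\<close>\<close>
    and k: "real k + 2 + \<alpha> \<le> real k * p"
    and U [measurable]: "U \<in> borel_measurable borel"
    and Uu: "\<And>t x. 0 < t \<Longrightarrow> U (t, x) = u t x"
    and weak: "\<And>T. 0 < T \<Longrightarrow> weak_solution \<mu> \<sigma> \<gamma> p u0 u1 T u"
    and u1: "u1 \<in> Lspace 2" and u0: "integrable lborel u0"
    and data: "integrable lborel (\<lambda>x. u1 x + \<mu> * frac_laplacian (\<sigma> / 2) u0 x)"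
    and data_pos: "0 < (LINT x|lborel. u1 x + \<mu> * frac_laplacian (\<sigma> / 2) u0 x)"
    and growth: "\<And>T. 1 \<le> T \<Longrightarrow>
      (T powr (- \<alpha>) * (T powr (- 2) + T powr (- 2 * \<kappa>) + T powr (- 1 - \<sigma> * \<kappa>))) powr (p / (p - 1)) *
      (T * (T powr \<kappa>) ^ DIM('a)) \<le> Bd"
begin

text \<open>Limits are taken along integer times; starting at 1 puts all of them in the range of
  \<open>growth\<close>.\<close>

definition time :: "nat \<Rightarrow> real" where "time j = real (Suc j)"

definition radius :: "nat \<Rightarrow> real" where "radius j = time j powr \<kappa>"

text \<open>The factor \<lambda> of the overview, up to the constants, which
  \<open>remainder_const\<close> and \<open>beta_const\<close> collect.\<close>

definition decay :: "nat \<Rightarrow> real" where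
  "decay j = time j powr (- \<alpha>) * (time j powr (- 2) + time j powr (- 2 * \<kappa>) + time j powr (- 1 - \<sigma> * \<kappa>))"

abbreviation pdens where "pdens j \<equiv> pow_dens p \<alpha> (time j) (radius j) k U"
abbreviation ldens where "ldens j \<equiv> lin_dens (time j) (radius j) k U"
abbreviation cyl :: "nat \<Rightarrow> real \<times> 'a \<Rightarrow> real" where
  "cyl j z \<equiv> indicator {0<..<time j} (fst z) * \<Phi> (snd z /\<^sub>R radius j)"

lemma time_ge_1: "time j \<ge> 1" and time_pos: "time j > 0" and radius_pos: "radius j > 0"
  by (auto simp: time_def radius_def)

lemma decay_pos: "decay j > 0"
  unfolding decay_def using time_pos[of j] by (intro mult_pos_pos add_pos_pos) auto

lemma time_at_top: "filterlim time at_top sequentially"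
  unfolding time_def[abs_def] by (rule filterlim_compose[OF filterlim_real_sequentially filterlim_Suc])

lemma time_powr_neg: "e > 0 \<Longrightarrow> (\<lambda>j. time j powr (- e)) \<longlonglongrightarrow> 0"
  by (rule tendsto_neg_powr[OF _ time_at_top]) simp

lemma decay_tendsto_0: "decay \<longlonglongrightarrow> 0"
proof -
  have "(\<lambda>j. time j powr (- \<alpha>) * 3) \<longlonglongrightarrow> 0 * 3"
    by (intro tendsto_mult time_powr_neg \<alpha> tendsto_const)
  then have l: "(\<lambda>j. time j powr (- \<alpha>) * 3) \<longlonglongrightarrow> 0" by simp
  have le: "decay j \<le> time j powr (- \<alpha>) * 3" for j
  proof -
    have e: "time j powr e \<le> 1" if "e \<le> 0" for e
      using powr_mono[OF that time_ge_1[of j]] time_pos[of j] by simp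
    have "0 \<le> \<sigma> * \<kappa>" using \<sigma> \<kappa> by simp
    then have "time j powr (- 2) + time j powr (- 2 * \<kappa>) + time j powr (- 1 - \<sigma> * \<kappa>) \<le> 1 + 1 + 1"
      using \<kappa> by (intro add_mono e) auto
    then show ?thesis unfolding decay_def by (intro mult_left_mono) auto
  qed
  show ?thesis
    by (rule tendsto_sandwich[OF _ _ tendsto_const l]) (use decay_pos le in \<open>auto intro!: always_eventually less_imp_le\<close>)
qed

lemma radius_lim: "(\<lambda>j. \<Phi> (x /\<^sub>R radius j)) \<longlonglongrightarrow> \<Phi> 0"
proof (rule \<Phi>_lim)
  have "(\<lambda>j. time j powr (- \<kappa>) *\<^sub>R x) \<longlonglongrightarrow> 0 *\<^sub>R x"
    by (intro tendsto_scaleR time_powr_neg \<kappa> tendsto_const)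
  then show "(\<lambda>j. x /\<^sub>R radius j) \<longlonglongrightarrow> 0" by (simp add: radius_def powr_minus)
qed

lemma integral_profile_tendsto:
  assumes h: "integrable lborel h"
  shows "(\<lambda>j. LINT x|lborel. h x * \<Phi> (x /\<^sub>R radius j)) \<longlonglongrightarrow> (LINT x|lborel. h x * \<Phi> 0)"
proof (rule integral_dominated_convergence[where w = "\<lambda>x. \<bar>h x\<bar> * B"])
  have [measurable]: "h \<in> borel_measurable borel" using h by simp
  show "(\<lambda>x. h x * \<Phi> 0) \<in> borel_measurable lborel" "(\<lambda>x. h x * \<Phi> (x /\<^sub>R radius j)) \<in> borel_measurable lborel" for j
    by measurable
  show "integrable lborel (\<lambda>x. \<bar>h x\<bar> * B)" using h by simp
  show "AE x in lborel. (\<lambda>j. h x * \<Phi> (x /\<^sub>R radius j)) \<longlonglongrightarrow> h x * \<Phi> 0"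
    by (intro AE_I2 tendsto_mult tendsto_const radius_lim)
  show "AE x in lborel. norm (h x * \<Phi> (x /\<^sub>R radius j)) \<le> \<bar>h x\<bar> * B" for j
  proof (rule AE_I2)
    fix x
    have "\<bar>\<Phi> (x /\<^sub>R radius j)\<bar> \<le> B" using \<Phi>_nonneg[of "x /\<^sub>R radius j"] \<Phi>_le[of "x /\<^sub>R radius j"] by simp
    then show "norm (h x * \<Phi> (x /\<^sub>R radius j)) \<le> \<bar>h x\<bar> * B" unfolding real_norm_def abs_mult by (rule mult_left_mono) simp
  qed
qed

lemma Uu': "\<forall>t x. 0 < t \<longrightarrow> t < T \<longrightarrow> U (t, x) = u t x"
  using Uu by blast

text \<open>The assumptions of the single-time context in their order, at time \<open>time j\<close>
  and radius \<open>radius j\<close>, for instantiating its results.\<close>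

lemmas standing = radius_pos time_pos \<mu> \<alpha> p U Uu' weak[OF time_pos] u1 u0 data

lemma pdens_integrable: "integrable lborel (pdens j)"
  by (rule pow_dens_integrable[OF standing])

lemma ldens_integrable: "integrable lborel (ldens j)"
  by (rule lin_dens_integrable[OF standing])

lemma pdens_nonneg: "0 \<le> pdens j z" and ldens_nonneg: "0 \<le> ldens j z"
  by (rule dens_nonneg[OF standing])+

lemma cyl_integrable: "integrable lborel (cyl j)"
  by (rule cylinder_integrable[OF standing])

definition mass where "mass = (LINT x|lborel. \<Phi> x)"

lemma mass_nonneg: "0 \<le> mass"
  unfolding mass_def using \<Phi>_nonneg by (intro Bochner_Integration.integral_nonneg) auto

text \<open>The Young remainder is bounded uniformly in j; this is where \<open>growth\<close>
  enters. No decay is claimed, which is what admits the critical exponent.\<close>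

lemma decay_cyl: "decay j powr (p / (p - 1)) * (LINT z|lborel. cyl j z) \<le> Bd * mass"
proof -
  have "decay j powr (p / (p - 1)) * (LINT z|lborel. cyl j z) = (decay j powr (p / (p - 1)) * (time j * radius j ^ DIM('a))) * mass"
    unfolding cylinder_integral[OF standing] mass_def by (simp only: mult.assoc)
  also have "\<dots> \<le> Bd * mass"
    using growth[OF time_ge_1[of j]] mass_nonneg unfolding decay_def radius_def by (intro mult_right_mono)
  finally show ?thesis .
qed

definition beta_const where "beta_const = Beta \<alpha> (real k + 3)"

lemma beta_const_pos: "beta_const > 0"
  unfolding beta_const_def Beta_def using \<alpha>(1) by (intro divide_pos_pos mult_pos_pos Gamma_real_pos) auto

definition remainder_const where "remainder_const = real (k + 2) * real (k + 1) + C + \<mu> * (real (k + 2) * C)"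

lemma remainder_const_pos: "remainder_const > 0"
  unfolding remainder_const_def using C \<mu> by (intro add_pos_nonneg mult_nonneg_nonneg) auto

definition datum :: "nat \<Rightarrow> real" where
  "datum j = (LINT x|lborel. (u1 x + \<mu> * frac_laplacian (\<sigma> / 2) u0 x) * \<Phi> (x /\<^sub>R radius j))
    + real (k + 2) / time j * (LINT x|lborel. u0 x * \<Phi> (x /\<^sub>R radius j))"

text \<open>The limit is the data integral times \<open>\<Phi> 0\<close>, since the contribution of
  u0 carries the factor 1/T.\<close>

lemma datum_pos: "\<forall>\<^sub>F j in sequentially. datum j > 0"
proof -
  have "(\<lambda>j. time j powr (- 1)) \<longlonglongrightarrow> 0" by (rule time_powr_neg) simp
  then have "(\<lambda>j. real (k + 2) * time j powr (- 1)) \<longlonglongrightarrow> real (k + 2) * 0"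
    by (rule tendsto_mult[OF tendsto_const])
  moreover have "real (k + 2) * time j powr (- 1) = real (k + 2) / time j" for j
    using time_pos[of j] by (simp add: powr_minus divide_inverse)
  ultimately have "(\<lambda>j. real (k + 2) / time j) \<longlonglongrightarrow> real (k + 2) * 0" by (simp only:)
  then have "datum \<longlonglongrightarrow> (LINT x|lborel. (u1 x + \<mu> * frac_laplacian (\<sigma> / 2) u0 x) * \<Phi> 0) + real (k + 2) * 0 * (LINT x|lborel. u0 x * \<Phi> 0)"
    unfolding datum_def[abs_def] by (intro tendsto_add tendsto_mult integral_profile_tendsto data u0)
  then have "datum \<longlonglongrightarrow> (LINT x|lborel. u1 x + \<mu> * frac_laplacian (\<sigma> / 2) u0 x) * \<Phi> 0" by simp
  then show ?thesis by (rule order_tendstoD) (intro mult_pos_pos data_pos \<Phi>_0)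
qed

text \<open>Multiplying \<open>weak_test_inequality\<close> by T^(-\<alpha>) moves the gain of the
  memory term into \<open>decay\<close>. Each of the three prefactors is bounded by the sum of the
  three powers, so the constants add up to \<open>remainder_const\<close>.\<close>

lemma main_inequality: "beta_const * (LINT z|lborel. pdens j z) + time j powr (- \<alpha>) * datum j \<le> remainder_const * (decay j * (LINT z|lborel. ldens j z))"
proof -
  define T where "T = time j"
  have T: "T > 0" unfolding T_def by (rule time_pos)
  define \<delta> where "\<delta> = T powr (- 2) + T powr (- 2 * \<kappa>) + T powr (- 1 - \<sigma> * \<kappa>)"
  let ?A = "LINT z|lborel. pdens j z" and ?E = "LINT z|lborel. ldens j z"
  let ?D = "real (k + 2) * real (k + 1) / T\<^sup>2 + C * radius j powr (- 2) + \<mu> * (real (k + 2) / T * (C * radius j powr (- \<sigma>)))"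
  have E0: "?E \<ge> 0" using ldens_nonneg by (intro Bochner_Integration.integral_nonneg) auto
  have base: "beta_const * T powr \<alpha> * ?A + datum j \<le> ?D * ?E"
    using weak_test_inequality[OF radius_pos[of j] time_pos[of j] \<mu> \<alpha> p U Uu' weak[OF time_pos] u1 u0 data, of k] unfolding beta_const_def datum_def T_def by (simp only: add.assoc)
  have D: "?D \<le> remainder_const * \<delta>"
  proof -
    have 1: "real (k + 2) * real (k + 1) / T\<^sup>2 = (real (k + 2) * real (k + 1)) * T powr (- 2)"
      using T by (simp add: powr_minus powr_numeral divide_inverse)
    have 2: "radius j powr (- 2) = T powr (- 2 * \<kappa>)"
      unfolding radius_def powr_powr T_def by (simp add: mult.commute)
    have 3: "\<mu> * (real (k + 2) / T * (C * radius j powr (- \<sigma>))) = (\<mu> * (real (k + 2) * C)) * T powr (- 1 - \<sigma> * \<kappa>)"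
    proof -
      have "radius j powr (- \<sigma>) = T powr (- \<sigma> * \<kappa>)" unfolding radius_def powr_powr T_def by (simp add: mult.commute)
      moreover have "T powr (- 1 - \<sigma> * \<kappa>) = T powr (- 1) * T powr (- \<sigma> * \<kappa>)"
        unfolding powr_add[symmetric] by simp
      moreover have "T powr (- 1) = inverse T" using T by (simp add: powr_minus)
      ultimately show ?thesis by (simp add: divide_inverse mult_ac)
    qed
    have d: "T powr (- 2) \<le> \<delta>" "T powr (- 2 * \<kappa>) \<le> \<delta>" "T powr (- 1 - \<sigma> * \<kappa>) \<le> \<delta>"
      by (auto simp: \<delta>_def add_increasing add_increasing2)
    have "?D \<le> (real (k + 2) * real (k + 1)) * \<delta> + C * \<delta> + (\<mu> * (real (k + 2) * C)) * \<delta>"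
      unfolding 1 2 3 using d C \<mu> by (intro add_mono mult_left_mono) auto
    then show ?thesis by (simp add: remainder_const_def algebra_simps)
  qed
  have "beta_const * T powr \<alpha> * ?A + datum j \<le> remainder_const * \<delta> * ?E"
    using base mult_right_mono[OF D E0] by linarith
  then have "T powr (- \<alpha>) * (beta_const * T powr \<alpha> * ?A + datum j) \<le> T powr (- \<alpha>) * (remainder_const * \<delta> * ?E)"
    by (intro mult_left_mono) auto
  moreover have "T powr (- \<alpha>) * T powr \<alpha> = 1" using T by (simp flip: powr_add)
  then have "T powr (- \<alpha>) * (beta_const * T powr \<alpha> * ?A + datum j) = beta_const * ?A + T powr (- \<alpha>) * datum j"
    by (simp add: algebra_simps)
  moreover have "T powr (- \<alpha>) * (remainder_const * \<delta> * ?E) = remainder_const * (decay j * ?E)"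
    unfolding decay_def T_def[symmetric] \<delta>_def by (simp only: mult_ac)
  ultimately show ?thesis unfolding T_def by linarith
qed

section \<open>Splitting the linear term\<close>

definition wt :: "nat \<Rightarrow> real \<times> 'a \<Rightarrow> real" where
  "wt j z = (1 - fst z / time j) powr (real k + 2 + \<alpha>)"

lemma pdens_eq: "pdens j z = cyl j z * (\<bar>U z\<bar> powr p * wt j z)"
  unfolding pow_dens_def[OF standing] wt_def by (simp add: mult_ac)

text \<open>With the weight, the term is at most c' times \<open>pdens\<close> and can be absorbed
  into the left side at the same time j. Without it, the term is larger, but has a majorant
  independent of j and so suits dominated convergence.\<close>

abbreviation weighted_min where
  "weighted_min c' j z \<equiv> cyl j z * min (decay j * \<bar>U z\<bar>) (c' * (\<bar>U z\<bar> powr p * wt j z))"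
abbreviation plain_min where
  "plain_min c' j z \<equiv> cyl j z * min (decay j * \<bar>U z\<bar>) (c' * \<bar>U z\<bar> powr p)"

text \<open>\<open>mult_le_min_powr_add\<close> at the weighted value |U| (1 - t/T)^k with l =
  \<open>decay j\<close> and L = c'. The choice of k bounds the p-th power of that value by the
  weight of \<open>pdens\<close>.\<close>

lemma ldens_split:
  assumes c': "0 < c'"
  shows "decay j * ldens j z \<le> weighted_min c' j z
    + (decay j powr (p / (p - 1)) * c' powr (- (1 / (p - 1)))) * cyl j z"
proof (cases "fst z \<in> {0<..<time j}")
  case True
  define b where "b = 1 - fst z / time j"
  have b: "0 < b" "b < 1" using True time_pos[of j] by (auto simp: b_def)
  let ?y = "\<bar>U z\<bar> * b ^ k"
  have bk: "b ^ k \<le> 1" "0 \<le> b ^ k" using b by (auto intro: power_le_one)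
  have y1: "?y \<le> \<bar>U z\<bar>" using mult_left_mono[OF bk(1), of "\<bar>U z\<bar>"] by simp
  have y2: "?y powr p \<le> \<bar>U z\<bar> powr p * wt j z"
  proof -
    have "(b ^ k) powr p = b powr (real k * p)" using b by (simp add: powr_powr flip: powr_realpow)
    also have "\<dots> \<le> b powr (real k + 2 + \<alpha>)" using b k by (intro powr_mono') auto
    finally have "(b ^ k) powr p \<le> wt j z" by (simp add: wt_def b_def)
    then show ?thesis using bk by (simp add: powr_mult mult_left_mono)
  qed
  have "decay j * ?y \<le> min (decay j * ?y) (c' * ?y powr p) + decay j powr (p / (p - 1)) * c' powr (- (1 / (p - 1)))"
    using bk by (intro mult_le_min_powr_add decay_pos c' p) auto
  also have "\<dots> \<le> min (decay j * \<bar>U z\<bar>) (c' * (\<bar>U z\<bar> powr p * wt j z)) + decay j powr (p / (p - 1)) * c' powr (- (1 / (p - 1)))"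
    using y1 y2 decay_pos[of j] c' by (intro add_right_mono min.mono mult_left_mono) auto
  finally have "(decay j * ?y) * \<Phi> (snd z /\<^sub>R radius j) \<le> (min (decay j * \<bar>U z\<bar>) (c' * (\<bar>U z\<bar> powr p * wt j z)) + decay j powr (p / (p - 1)) * c' powr (- (1 / (p - 1)))) * \<Phi> (snd z /\<^sub>R radius j)"
    by (rule mult_right_mono) (rule \<Phi>_nonneg)
  then show ?thesis using True unfolding lin_dens_def[OF standing] b_def by (simp add: algebra_simps)
qed (simp add: lin_dens_def[OF standing])

lemma wt_bounds: "fst z \<in> {0<..<time j} \<Longrightarrow> 0 \<le> wt j z" "fst z \<in> {0<..<time j} \<Longrightarrow> wt j z \<le> 1"
proof -
  assume z: "fst z \<in> {0<..<time j}"
  show "0 \<le> wt j z" by (simp add: wt_def)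
  have "0 < 1 - fst z / time j" "1 - fst z / time j < 1" using z time_pos[of j] by auto
  then have "(1 - fst z / time j) powr (real k + 2 + \<alpha>) \<le> 1 powr (real k + 2 + \<alpha>)" using \<alpha> by (intro powr_mono2) auto
  then show "wt j z \<le> 1" by (simp add: wt_def)
qed

lemma U_measurable' [measurable]: "U \<in> borel_measurable (borel \<Otimes>\<^sub>M borel)"
  using U by (simp add: borel_prod)

lemma min_term_measurable:
  "(weighted_min c' j) \<in> borel_measurable lborel"
  "(plain_min c' j) \<in> borel_measurable lborel"
proof -
  have "(weighted_min c' j) \<in> borel_measurable borel"
    unfolding borel_prod[symmetric] wt_def by measurable
  then show "(weighted_min c' j) \<in> borel_measurable lborel" by simp
  have "(plain_min c' j) \<in> borel_measurable borel"
    unfolding borel_prod[symmetric] by measurable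
  then show "(plain_min c' j) \<in> borel_measurable lborel" by simp
qed

lemma weighted_min_integrable:
  assumes c': "0 < c'"
  shows "integrable lborel (weighted_min c' j)"
proof (rule Bochner_Integration.integrable_bound)
  show "integrable lborel (\<lambda>z. c' * pdens j z)" using pdens_integrable by simp
  show "AE z in lborel. norm (weighted_min c' j z) \<le> norm (c' * pdens j z)"
  proof (rule AE_I2)
    fix z
    show "norm (weighted_min c' j z) \<le> norm (c' * pdens j z)"
    proof (cases "fst z \<in> {0<..<time j}")
      case True
      have c0: "0 \<le> cyl j z" using \<Phi>_nonneg by simp
      have m0: "0 \<le> min (decay j * \<bar>U z\<bar>) (c' * (\<bar>U z\<bar> powr p * wt j z))"
        using decay_pos[of j] wt_bounds(1)[OF True] c' by (auto intro!: mult_nonneg_nonneg)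
      have "weighted_min c' j z \<le> cyl j z * (c' * (\<bar>U z\<bar> powr p * wt j z))"
        using c0 by (intro mult_left_mono) auto
      also have "\<dots> = c' * pdens j z" unfolding pdens_eq by (simp only: mult_ac)
      finally show ?thesis using mult_nonneg_nonneg[OF c0 m0] unfolding real_norm_def by linarith
    qed simp
  qed
qed (rule min_term_measurable)

text \<open>Integrating \<open>ldens_split\<close> and dropping the nonnegative datum gives a right
  side in which j enters only through the integral of the minimum.\<close>

lemma pdens_le_weighted_min:
  assumes c': "0 < c'" and d: "0 \<le> datum j"
  shows "beta_const * (LINT z|lborel. pdens j z) \<le> remainder_const * (integral\<^sup>L lborel (weighted_min c' j)
    + c' powr (- (1 / (p - 1))) * (Bd * mass))"
proof -
  let ?m = "\<lambda>z. weighted_min c' j z"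
  let ?l = "decay j powr (p / (p - 1)) * c' powr (- (1 / (p - 1)))"
  have "decay j * (LINT z|lborel. ldens j z) = (LINT z|lborel. decay j * ldens j z)" by simp
  also have "\<dots> \<le> (LINT z|lborel. ?m z + ?l * cyl j z)"
    by (intro integral_mono ldens_split c' Bochner_Integration.integrable_add weighted_min_integrable integrable_mult_right ldens_integrable cyl_integrable)
  also have "\<dots> = (LINT z|lborel. ?m z) + ?l * (LINT z|lborel. cyl j z)"
    unfolding integral_mult_right_zero[of _ ?l, symmetric]
    by (intro Bochner_Integration.integral_add weighted_min_integrable c' integrable_mult_right cyl_integrable)
  also have "?l * (LINT z|lborel. cyl j z) = c' powr (- (1 / (p - 1))) * (decay j powr (p / (p - 1)) * (LINT z|lborel. cyl j z))"
    by (simp only: mult_ac)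
  also have "\<dots> \<le> c' powr (- (1 / (p - 1))) * (Bd * mass)" by (intro mult_left_mono decay_cyl) simp
  finally have "decay j * (LINT z|lborel. ldens j z) \<le> (LINT z|lborel. ?m z) + c' powr (- (1 / (p - 1))) * (Bd * mass)"
    by simp
  then have "remainder_const * (decay j * (LINT z|lborel. ldens j z)) \<le> remainder_const * ((LINT z|lborel. ?m z) + c' powr (- (1 / (p - 1))) * (Bd * mass))"
    using remainder_const_pos by (intro mult_left_mono) auto
  moreover have "0 \<le> time j powr (- \<alpha>) * datum j" using d by simp
  ultimately show ?thesis using main_inequality[of j] by linarith
qed

section \<open>Integrability and vanishing of the p-th power\<close>

definition u_pow :: "real \<times> 'a \<Rightarrow> real" where "u_pow z = indicator {0<..} (fst z) * \<bar>U z\<bar> powr p"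

lemma u_pow_measurable [measurable]: "u_pow \<in> borel_measurable borel"
  unfolding u_pow_def[abs_def] borel_prod[symmetric] by measurable

lemma u_pow_nonneg: "0 \<le> u_pow z"
  by (simp add: u_pow_def)

text \<open>As times and radii diverge, the temporal weights tend to 1 and the profile to
  \<open>\<Phi> 0\<close>. Fatou's lemma turns bounds along the sequence into one over all positive
  times.\<close>

lemma fatou_u_pow:
  assumes le: "\<forall>\<^sub>F j in sequentially. (LINT z|lborel. pdens j z) \<le> c j" and c: "c \<longlonglongrightarrow> c0"
  shows "(\<integral>\<^sup>+z. ennreal (u_pow z * \<Phi> 0) \<partial>lborel) \<le> ennreal c0"
proof -
  have "(\<integral>\<^sup>+z. ennreal (u_pow z * \<Phi> 0) \<partial>lborel) = (\<integral>\<^sup>+z. liminf (\<lambda>j. ennreal (pdens j z)) \<partial>lborel)"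
  proof (intro nn_integral_cong lim_imp_Liminf[symmetric] trivial_limit_sequentially tendsto_ennrealI)
    fix z :: "real \<times> 'a"
    show "(\<lambda>j. pdens j z) \<longlonglongrightarrow> u_pow z * \<Phi> 0"
    proof (cases "fst z > 0")
      case True
      have "(\<lambda>j. time j powr (- 1)) \<longlonglongrightarrow> 0" by (rule time_powr_neg) simp
      then have "(\<lambda>j. 1 - fst z * time j powr (- 1)) \<longlonglongrightarrow> 1 - fst z * 0"
        by (intro tendsto_intros)
      moreover have "fst z * time j powr (- 1) = fst z / time j" for j
        using time_pos[of j] by (simp add: powr_minus divide_inverse)
      ultimately have "(\<lambda>j. 1 - fst z / time j) \<longlonglongrightarrow> 1" by (simp only:) simp
      then have w: "(\<lambda>j. wt j z) \<longlonglongrightarrow> 1 powr (real k + 2 + \<alpha>)"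
        unfolding wt_def by (intro tendsto_powr tendsto_const) auto
      have "\<forall>\<^sub>F j in sequentially. fst z < time j"
        using time_at_top by (simp add: filterlim_at_top_dense)
      then have "\<forall>\<^sub>F j in sequentially. indicator {0<..<time j} (fst z) = (1::real)"
        by eventually_elim (use True in simp)
      then have i: "(\<lambda>j. indicator {0<..<time j} (fst z)) \<longlonglongrightarrow> (1::real)" by (rule tendsto_eventually)
      have "(\<lambda>j. pdens j z) \<longlonglongrightarrow> 1 * \<Phi> 0 * (\<bar>U z\<bar> powr p * 1 powr (real k + 2 + \<alpha>))"
        unfolding pdens_eq by (intro tendsto_mult i radius_lim w tendsto_const)
      then show ?thesis using True by (simp add: u_pow_def mult.commute)
    next
      case False
      then show ?thesis by (simp add: pdens_eq u_pow_def)
    qed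
  qed
  also have "\<dots> \<le> liminf (\<lambda>j. \<integral>\<^sup>+z. ennreal (pdens j z) \<partial>lborel)"
    by (rule nn_integral_liminf) (use pdens_integrable in auto)
  also have "\<dots> \<le> liminf (\<lambda>j. ennreal (c j))"
  proof (rule Liminf_mono)
    show "\<forall>\<^sub>F j in sequentially. (\<integral>\<^sup>+z. ennreal (pdens j z) \<partial>lborel) \<le> ennreal (c j)"
      using le by eventually_elim (simp add: nn_integral_eq_integral pdens_integrable pdens_nonneg ennreal_leI)
  qed
  also have "\<dots> = ennreal c0"
    by (intro lim_imp_Liminf trivial_limit_sequentially tendsto_ennrealI c)
  finally show ?thesis .
qed

lemma datum_nonneg: "\<forall>\<^sub>F j in sequentially. 0 \<le> datum j"
  using datum_pos by eventually_elim simp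

lemma u_pow_integrable: "integrable lborel u_pow"
proof -
  \<comment> \<open>With this c' the minimum contributes at most half of the left side, which is
    finite and can be subtracted.\<close>
  define c' where "c' = beta_const / (2 * remainder_const)"
  have c': "c' > 0" using beta_const_pos remainder_const_pos by (simp add: c'_def)
  define c where "c = 2 / beta_const * (remainder_const * (c' powr (- (1 / (p - 1))) * (Bd * mass)))"
  have "\<forall>\<^sub>F j in sequentially. (LINT z|lborel. pdens j z) \<le> c"
    using datum_nonneg
  proof eventually_elim
    case (elim j)
    have "integral\<^sup>L lborel (weighted_min c' j) \<le> (LINT z|lborel. c' * pdens j z)"
    proof (intro integral_mono weighted_min_integrable c' integrable_mult_right pdens_integrable)
      fix z
      have "weighted_min c' j z \<le> cyl j z * (c' * (\<bar>U z\<bar> powr p * wt j z))"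
        using \<Phi>_nonneg by (intro mult_left_mono) auto
      also have "\<dots> = c' * pdens j z" unfolding pdens_eq by (simp only: mult_ac)
      finally show "weighted_min c' j z \<le> c' * pdens j z" .
    qed
    then have "remainder_const * (integral\<^sup>L lborel (weighted_min c' j) + c' powr (- (1 / (p - 1))) * (Bd * mass))
        \<le> remainder_const * (c' * (LINT z|lborel. pdens j z) + c' powr (- (1 / (p - 1))) * (Bd * mass))"
      using remainder_const_pos by (intro mult_left_mono add_right_mono) auto
    with pdens_le_weighted_min[OF c' elim] have "beta_const * (LINT z|lborel. pdens j z) \<le> remainder_const * (c' * (LINT z|lborel. pdens j z) + c' powr (- (1 / (p - 1))) * (Bd * mass))"
      by (rule order_trans)
    also have "\<dots> = beta_const / 2 * (LINT z|lborel. pdens j z) + remainder_const * (c' powr (- (1 / (p - 1))) * (Bd * mass))"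
      using remainder_const_pos by (simp add: c'_def distrib_left)
    finally have "beta_const / 2 * (LINT z|lborel. pdens j z) \<le> remainder_const * (c' powr (- (1 / (p - 1))) * (Bd * mass))"
      by simp
    then show ?case using beta_const_pos by (simp add: c_def field_simps)
  qed
  from fatou_u_pow[OF this tendsto_const]
  have "(\<integral>\<^sup>+z. ennreal (u_pow z * \<Phi> 0) \<partial>lborel) < \<infinity>" by (rule order.strict_trans1) simp
  then have "integrable lborel (\<lambda>z. u_pow z * \<Phi> 0)"
    using u_pow_nonneg \<Phi>_nonneg by (intro integrableI_nonneg) auto
  then show ?thesis using \<Phi>_0 by simp
qed

lemma plain_min_bounds:
  assumes c': "0 < c'"
  shows "0 \<le> plain_min c' j z" and "plain_min c' j z \<le> B * c' * u_pow z" and "plain_min c' j z \<le> B * (decay j * \<bar>U z\<bar>)"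
    and "integrable lborel (plain_min c' j)"
proof -
  have B: "0 \<le> B" using \<Phi>_le[of 0] \<Phi>_0 by linarith
  show nn: "0 \<le> plain_min c' j z" for z
    using \<Phi>_nonneg decay_pos[of j] c' by (intro mult_nonneg_nonneg) auto
  show le: "plain_min c' j z \<le> B * c' * u_pow z" for z
  proof -
    have "plain_min c' j z \<le> (indicator {0<..} (fst z) * B) * (c' * \<bar>U z\<bar> powr p)"
      using \<Phi>_nonneg \<Phi>_le B c' decay_pos[of j] by (intro mult_mono) (auto simp: indicator_def)
    then show ?thesis by (simp add: u_pow_def mult_ac)
  qed
  show "plain_min c' j z \<le> B * (decay j * \<bar>U z\<bar>)"
    using \<Phi>_nonneg \<Phi>_le B c' decay_pos[of j] by (intro mult_mono) (auto simp: indicator_def)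
  show "integrable lborel (plain_min c' j)"
  proof (rule Bochner_Integration.integrable_bound)
    show "integrable lborel (\<lambda>z. B * c' * u_pow z)" using u_pow_integrable by simp
    show "AE z in lborel. norm (plain_min c' j z) \<le> norm (B * c' * u_pow z)"
    proof (rule AE_I2)
      fix z
      show "norm (plain_min c' j z) \<le> norm (B * c' * u_pow z)"
        using le[of z] nn[of z] unfolding real_norm_def by linarith
    qed
  qed (rule min_term_measurable)
qed

text \<open>The first entry of the minimum tends to 0 with \<open>decay\<close>, and the second
  gives a multiple of \<open>u_pow\<close> as majorant; the integrability from the first pass is
  used here.\<close>

lemma plain_min_tendsto_0:
  assumes c': "0 < c'"
  shows "(\<lambda>j. integral\<^sup>L lborel (plain_min c' j)) \<longlonglongrightarrow> 0"
proof -
  have "(\<lambda>j. integral\<^sup>L lborel (plain_min c' j)) \<longlonglongrightarrow> (LINT z::real \<times> 'a|lborel. 0)"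
  proof (rule integral_dominated_convergence[where w = "\<lambda>z. B * c' * u_pow z"])
    show "integrable lborel (\<lambda>z. B * c' * u_pow z)" using u_pow_integrable by simp
    show "AE z in lborel. norm (plain_min c' j z) \<le> B * c' * u_pow z" for j
      using plain_min_bounds(1,2)[OF c', of j] by (intro AE_I2) (simp only: real_norm_def abs_of_nonneg)
    show "AE z in lborel. (\<lambda>j. plain_min c' j z) \<longlonglongrightarrow> 0"
    proof (rule AE_I2)
      fix z
      have "(\<lambda>j. B * (decay j * \<bar>U z\<bar>)) \<longlonglongrightarrow> B * (0 * \<bar>U z\<bar>)"
        by (intro tendsto_mult tendsto_const decay_tendsto_0)
      then have l: "(\<lambda>j. B * (decay j * \<bar>U z\<bar>)) \<longlonglongrightarrow> 0" by simp
      show "(\<lambda>j. plain_min c' j z) \<longlonglongrightarrow> 0"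
        by (rule tendsto_sandwich[OF _ _ tendsto_const l]) (intro always_eventually allI plain_min_bounds(1,3) c')+
    qed
  qed (use min_term_measurable(2)[of _ c'] in auto)
  then show ?thesis by simp
qed

text \<open>At fixed c' the limit in j removes the minimum; what survives is the Young remainder,
  which is small for large c'.\<close>

lemma u_pow_integral_le:
  assumes c': "0 < c'"
  shows "(\<integral>\<^sup>+z. ennreal (u_pow z * \<Phi> 0) \<partial>lborel) \<le> ennreal (remainder_const / beta_const * (0 + c' powr (- (1 / (p - 1))) * (Bd * mass)))"
proof (rule fatou_u_pow)
  let ?G = "\<lambda>j. integral\<^sup>L lborel (plain_min c' j)"
  show "(\<lambda>j. remainder_const / beta_const * (?G j + c' powr (- (1 / (p - 1))) * (Bd * mass))) \<longlonglongrightarrow> remainder_const / beta_const * (0 + c' powr (- (1 / (p - 1))) * (Bd * mass))"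
    by (intro tendsto_mult tendsto_add tendsto_const plain_min_tendsto_0 c')
  show "\<forall>\<^sub>F j in sequentially. (LINT z|lborel. pdens j z) \<le> remainder_const / beta_const * (?G j + c' powr (- (1 / (p - 1))) * (Bd * mass))"
    using datum_nonneg
  proof eventually_elim
    case (elim j)
    have "integral\<^sup>L lborel (weighted_min c' j) \<le> ?G j"
    proof (intro integral_mono weighted_min_integrable c' plain_min_bounds(4))
      fix z
      show "weighted_min c' j z \<le> plain_min c' j z"
      proof (cases "fst z \<in> {0<..<time j}")
        case True
        have "\<bar>U z\<bar> powr p * wt j z \<le> \<bar>U z\<bar> powr p" using wt_bounds(2)[OF True] by (simp add: mult_left_le)
        then show ?thesis using \<Phi>_nonneg c' decay_pos[of j] by (intro mult_left_mono min.mono) auto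
      qed simp
    qed
    then have "remainder_const * (integral\<^sup>L lborel (weighted_min c' j) + c' powr (- (1 / (p - 1))) * (Bd * mass))
        \<le> remainder_const * (?G j + c' powr (- (1 / (p - 1))) * (Bd * mass))"
      using remainder_const_pos by (intro mult_left_mono add_right_mono) auto
    with pdens_le_weighted_min[OF c' elim] have "beta_const * (LINT z|lborel. pdens j z) \<le> remainder_const * (?G j + c' powr (- (1 / (p - 1))) * (Bd * mass))"
      by (rule order_trans)
    then show ?case using beta_const_pos by (simp add: field_simps)
  qed
qed

lemma u_pow_AE_0: "AE z in lborel. u_pow z = 0"
proof -
  let ?q = "1 / (p - 1)"
  \<comment> \<open>Here \<open>time j\<close> serves as the parameter c' tending to infinity and no
    longer as a time.\<close>
  have "(\<lambda>j. remainder_const / beta_const * (0 + time j powr (- ?q) * (Bd * mass))) \<longlonglongrightarrow> remainder_const / beta_const * (0 + 0 * (Bd * mass))"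
    using p by (intro tendsto_mult tendsto_add tendsto_const time_powr_neg) auto
  then have "(\<lambda>j. ennreal (remainder_const / beta_const * (0 + time j powr (- ?q) * (Bd * mass)))) \<longlonglongrightarrow> ennreal 0"
    by (intro tendsto_ennrealI) simp
  then have "(\<integral>\<^sup>+z. ennreal (u_pow z * \<Phi> 0) \<partial>lborel) \<le> ennreal 0"
  proof (rule tendsto_lowerbound)
    show "\<forall>\<^sub>F j in sequentially. (\<integral>\<^sup>+z. ennreal (u_pow z * \<Phi> 0) \<partial>lborel) \<le> ennreal (remainder_const / beta_const * (0 + time j powr (- ?q) * (Bd * mass)))"
      by (intro always_eventually allI u_pow_integral_le time_pos)
  qed simp
  then have "AE z in lborel. ennreal (u_pow z * \<Phi> 0) = 0"
    by (subst nn_integral_0_iff_AE[symmetric]) auto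
  then show ?thesis
  proof eventually_elim
    case (elim z)
    then have "u_pow z * \<Phi> 0 \<le> 0" by (simp only: ennreal_eq_0_iff)
    then show ?case using \<Phi>_0 u_pow_nonneg[of z] by (simp add: mult_le_0_iff)
  qed
qed

text \<open>Once U vanishes almost everywhere at positive times, the right side of
  \<open>main_inequality\<close> is 0, while its left side contains a positive datum.\<close>

lemma no_global_solution: False
proof -
  obtain j where j: "datum j > 0"
    using eventually_happens[OF datum_pos] by auto
  have "AE z in lborel. ldens j z = 0"
    using u_pow_AE_0
  proof eventually_elim
    case (elim z)
    then show ?case by (cases "0 < fst z") (auto simp: u_pow_def lin_dens_def[OF standing])
  qed
  then have "(LINT z|lborel. ldens j z) = (LINT z::real \<times> 'a|lborel. 0)"
    using ldens_integrable[of j] by (intro integral_cong_AE) auto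
  then have "(LINT z|lborel. ldens j z) = 0" by simp
  moreover have "0 \<le> beta_const * (LINT z|lborel. pdens j z)"
    using beta_const_pos pdens_nonneg by (intro mult_nonneg_nonneg Bochner_Integration.integral_nonneg) auto
  moreover have "0 < time j powr (- \<alpha>) * datum j" using time_pos[of j] j by simp
  ultimately show False
    using main_inequality[of j] by simp
qed

end

end

section \<open>The exponents\<close>

text \<open>The number e bounds the three decay rates from below, whence the constant 3. The last
  assumption says that the decay T^(-(\<alpha>+e)), raised to the power p/(p-1), beats the cylinder
  volume T^(1 + \<kappa> n).\<close>

lemma scaling_growth:
  fixes T \<alpha> \<kappa> \<sigma> p e :: real
  assumes T: "1 \<le> T" and p: "1 < p" and e: "e \<le> 2" "e \<le> 2 * \<kappa>" "e \<le> 1 + \<sigma> * \<kappa>"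
    and le: "1 + \<kappa> * real n \<le> (\<alpha> + e) * (p / (p - 1))"
  shows "(T powr (- \<alpha>) * (T powr (- 2) + T powr (- 2 * \<kappa>) + T powr (- 1 - \<sigma> * \<kappa>))) powr (p / (p - 1)) *
      (T * (T powr \<kappa>) ^ n) \<le> 3 powr (p / (p - 1))"
proof -
  let ?q = "p / (p - 1)"
  have q: "?q \<ge> 0" using p by simp
  have T0: "T > 0" using T by simp
  have "T powr (- 2) + T powr (- 2 * \<kappa>) + T powr (- 1 - \<sigma> * \<kappa>) \<le> T powr (- e) + T powr (- e) + T powr (- e)"
    using T e by (intro add_mono powr_mono) auto
  then have "T powr (- \<alpha>) * (T powr (- 2) + T powr (- 2 * \<kappa>) + T powr (- 1 - \<sigma> * \<kappa>)) \<le> T powr (- \<alpha>) * (3 * T powr (- e))"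
    by (intro mult_left_mono) auto
  also have "\<dots> = 3 * T powr (- (\<alpha> + e))"
    using T0 by (simp flip: powr_add)
  finally have "(T powr (- \<alpha>) * (T powr (- 2) + T powr (- 2 * \<kappa>) + T powr (- 1 - \<sigma> * \<kappa>))) powr ?q \<le> (3 * T powr (- (\<alpha> + e))) powr ?q"
    using q by (intro powr_mono2) (auto intro!: mult_nonneg_nonneg add_nonneg_nonneg)
  also have "\<dots> = 3 powr ?q * T powr (- ((\<alpha> + e) * ?q))"
    by (simp only: powr_mult powr_powr mult_minus_left)
  finally have 1: "(T powr (- \<alpha>) * (T powr (- 2) + T powr (- 2 * \<kappa>) + T powr (- 1 - \<sigma> * \<kappa>))) powr ?q \<le> 3 powr ?q * T powr (- ((\<alpha> + e) * ?q))" .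
  have "(T powr \<kappa>) ^ n = T powr (\<kappa> * real n)"
    using T0 by (simp add: powr_powr flip: powr_realpow)
  then have 2: "T * (T powr \<kappa>) ^ n = T powr (1 + \<kappa> * real n)"
    using powr_mult_base[of T "\<kappa> * real n"] T0 by simp
  have "(T powr (- \<alpha>) * (T powr (- 2) + T powr (- 2 * \<kappa>) + T powr (- 1 - \<sigma> * \<kappa>))) powr ?q * (T * (T powr \<kappa>) ^ n)
      \<le> 3 powr ?q * T powr (- ((\<alpha> + e) * ?q)) * T powr (1 + \<kappa> * real n)"
    unfolding 2 by (intro mult_right_mono 1) simp
  also have "\<dots> = 3 powr ?q * T powr (- ((\<alpha> + e) * ?q) + (1 + \<kappa> * real n))"
    unfolding powr_add by (simp only: mult.assoc)
  also have "\<dots> \<le> 3 powr ?q * T powr 0"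
    using T le by (intro mult_left_mono powr_mono) auto
  finally show ?thesis using T0 by simp
qed

text \<open>
  For \<open>p < 1/\<gamma>\<close> a small \<open>\<kappa>\<close> suffices, with \<open>e = 0\<close>; otherwise \<open>\<kappa> = 1 / (2 - min \<sigma> 1)\<close> balances
  \<open>R^-2\<close> with the larger of \<open>T^-2\<close> and \<open>T^-1 R^-\<sigma>\<close>.
\<close>

lemma scaling_exponent_exists:
  fixes \<gamma> \<sigma> p :: real
  assumes \<sigma>: "0 < \<sigma>" and \<gamma>: "0 < \<gamma>" "\<gamma> < 1" and p: "1 < p" and n: "1 \<le> n"
    and cond: "int n \<le> \<lfloor>2 - \<gamma> * (2 - min \<sigma> 1)\<rfloor>
       \<or> (p \<le> p_crit n \<gamma> \<sigma> \<and>
          ((\<lfloor>2 - \<gamma> * (2 - min \<sigma> 1)\<rfloor> < int n \<and> n \<le> 2) \<or>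
           (n > 2 \<and> (real n - 2) / real n \<le> \<gamma>)))
       \<or> (p < 1 / \<gamma> \<and> n \<ge> 3 \<and> \<gamma> < (real n - 2) / real n)"
  obtains \<kappa> e where "0 < \<kappa>" "e \<le> 2" "e \<le> 2 * \<kappa>" "e \<le> 1 + \<sigma> * \<kappa>"
    "1 + \<kappa> * real n \<le> ((1 - \<gamma>) + e) * (p / (p - 1))"
proof (cases "p < 1 / \<gamma>")
  case True
  \<comment> \<open>Solves 1 + \<kappa> n = (1 - \<gamma>) p/(p-1), the required inequality with e =
    0; the solution is positive exactly because \<gamma> p < 1.\<close>
  define \<kappa> where "\<kappa> = ((1 - \<gamma>) * (p / (p - 1)) - 1) / real n"
  have "\<gamma> * p < 1" using True \<gamma> by (simp add: field_simps)
  then have "(1 - \<gamma>) * (p / (p - 1)) - 1 > 0" using p by (simp add: field_simps)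
  then have "\<kappa> > 0" using n by (simp add: \<kappa>_def)
  moreover have "1 + \<kappa> * real n = (1 - \<gamma>) * (p / (p - 1))" using n by (simp add: \<kappa>_def)
  ultimately show ?thesis using \<sigma> by (intro that[of \<kappa> 0]) auto
next
  case False
  define d where "d = 2 - min \<sigma> 1"
  define \<kappa> where "\<kappa> = 1 / d"
  have d: "1 \<le> d" "d < 2" using \<sigma> by (auto simp: d_def)
  have \<kappa>: "\<kappa> > 0" "\<kappa> \<le> 1" using d by (auto simp: \<kappa>_def)
  \<comment> \<open>The inequality required for \<kappa> = 1/d and e = 2 \<kappa>, multiplied by d
    (p - 1) and rearranged. If n - 2 + \<gamma> d > 0 it says
    \<open>p \<le> p_crit n \<gamma> \<sigma>\<close>; otherwise its left side is
    nonpositive.\<close>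
  have key: "(real n - 2 + \<gamma> * d) * (p - 1) \<le> 2 + (1 - \<gamma>) * d"
    using cond False
  proof (elim disjE conjE)
    assume "int n \<le> \<lfloor>2 - \<gamma> * (2 - min \<sigma> 1)\<rfloor>"
    then have "real n - 2 + \<gamma> * d \<le> 0" by (simp add: le_floor_iff d_def)
    then have "(real n - 2 + \<gamma> * d) * (p - 1) \<le> 0" using p by (simp add: mult_nonpos_nonneg)
    also have "0 \<le> 2 + (1 - \<gamma>) * d" using \<gamma> d by simp
    finally show ?thesis .
  next
    \<comment> \<open>An integer strictly above the floor exceeds the number itself, so the
      denominator of \<open>p_crit\<close> is positive and its division is genuine.\<close>
    assume "\<lfloor>2 - \<gamma> * (2 - min \<sigma> 1)\<rfloor> < int n" and pc: "p \<le> p_crit n \<gamma> \<sigma>"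
    then have "real n - 2 + \<gamma> * d > 0" by (simp add: floor_less_iff d_def)
    then show ?thesis using pc by (simp add: p_crit_def d_def[symmetric] field_simps)
  next
    assume "2 < n" and pc: "p \<le> p_crit n \<gamma> \<sigma>"
    then have "real n - 2 + \<gamma> * d > 0" using \<gamma> d by (intro add_pos_pos) auto
    then show ?thesis using pc by (simp add: p_crit_def d_def[symmetric] field_simps)
  \<comment> \<open>The remaining alternative assumes p < 1/\<gamma>, against the case
    \<open>False\<close>.\<close>
  qed auto
  have "(d + real n) * (p - 1) \<le> ((1 - \<gamma>) * d + 2) * p"
    using key by (simp add: algebra_simps)
  then have "d + real n \<le> ((1 - \<gamma>) * d + 2) * (p / (p - 1))"
    using p by (simp add: field_simps)
  then have "\<kappa> * (d + real n) \<le> \<kappa> * (((1 - \<gamma>) * d + 2) * (p / (p - 1)))"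
    using \<kappa> by (intro mult_left_mono) auto
  moreover have "\<kappa> * d = 1" using d by (simp add: \<kappa>_def)
  moreover have "\<kappa> * (d + real n) = \<kappa> * d + \<kappa> * real n"
    "\<kappa> * (((1 - \<gamma>) * d + 2) * (p / (p - 1))) = ((1 - \<gamma>) * (\<kappa> * d) + 2 * \<kappa>) * (p / (p - 1))"
    by (simp_all only: distrib_left distrib_right mult_ac)
  ultimately have 1: "1 + \<kappa> * real n \<le> ((1 - \<gamma>) + 2 * \<kappa>) * (p / (p - 1))"
    using \<open>\<kappa> * d = 1\<close> by (simp only: mult_1_right)
  have "2 * \<kappa> \<le> 1 + \<sigma> * \<kappa>"
  proof -
    have "(2 - \<sigma>) * \<kappa> \<le> d * \<kappa>" using \<kappa> by (intro mult_right_mono) (auto simp: d_def)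
    then show ?thesis using \<open>\<kappa> * d = 1\<close> by (simp add: algebra_simps)
  qed
  then show ?thesis using \<kappa> 1 by (intro that[of \<kappa> "2 * \<kappa>"]) auto
qed

text \<open>Each \<open>Lcurve T r q\<close> gives measurability on one strip. The extension by 0 is
  the limit of the restrictions to the strips (0, j+1), a sequence that is eventually constant at
  every point.\<close>

lemma Lcurve_extension_measurable:
  fixes u :: "real \<Rightarrow> 'a::euclidean_space \<Rightarrow> real"
  assumes "\<And>T. 0 < T \<Longrightarrow> u \<in> Lcurve T r q"
  shows "(\<lambda>z. if 0 < fst z then u (fst z) (snd z) else 0) \<in> borel_measurable borel"
proof -
  let ?S = "\<lambda>j::nat. {0<..<real (Suc j)} \<times> (UNIV :: 'a set)"
  let ?f = "\<lambda>j z. indicat_real (?S j) z *\<^sub>R (case z of (t, x) \<Rightarrow> u t x)"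
  have "?f j \<in> borel_measurable (lborel \<Otimes>\<^sub>M lborel)" for j
  proof -
    have "(\<lambda>(t, x). u t x) \<in> borel_measurable (restrict_space (lborel \<Otimes>\<^sub>M lborel) (?S j))"
      using assms[of "real (Suc j)"] by (simp add: Lcurve_def)
    moreover have "?S j \<in> sets (lborel \<Otimes>\<^sub>M lborel)" by (intro pair_measureI) auto
    then have "?S j \<inter> space (lborel \<Otimes>\<^sub>M lborel) \<in> sets (lborel \<Otimes>\<^sub>M lborel)" by (rule sets.Int[OF _ sets.top])
    ultimately show ?thesis by (subst (asm) borel_measurable_restrict_space_iff) auto
  qed
  then have m: "?f j \<in> borel_measurable borel" for j by (simp add: lborel_prod)
  show ?thesis
  proof (rule borel_measurable_LIMSEQ_metric[OF m])
    fix z :: "real \<times> 'a"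
    obtain j0 where j0: "fst z < real j0" using reals_Archimedean2 by blast
    show "(\<lambda>j. ?f j z) \<longlonglongrightarrow> (if 0 < fst z then u (fst z) (snd z) else 0)"
    proof (rule tendsto_eventually)
      show "\<forall>\<^sub>F j in sequentially. ?f j z = (if 0 < fst z then u (fst z) (snd z) else 0)"
        using eventually_ge_at_top[of j0]
        by eventually_elim (use j0 in \<open>auto simp: indicator_def case_prod_unfold mem_Times_iff\<close>)
    qed
  qed
qed

theorem theorem1p1:
  fixes \<mu> \<sigma> \<gamma> p :: real
    and u0 u1 :: "real ^ 'n \<Rightarrow> real"
  defines "n \<equiv> CARD('n)"
  assumes "\<mu> > 0" and "0 < \<sigma>" "\<sigma> < 2" and "0 < \<gamma>" "\<gamma> < 1" and "p > 1"
    and "u0 \<in> Hspace \<sigma>" and "u1 \<in> Lspace 2"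
    and "integrable lborel u0"
    and "integrable lborel (\<lambda>x. u1 x + \<mu> * frac_laplacian (\<sigma> / 2) u0 x)"
    and "(LINT x|lborel. u1 x + \<mu> * frac_laplacian (\<sigma> / 2) u0 x) > 0"
    and "int n \<le> \<lfloor>2 - \<gamma> * (2 - min \<sigma> 1)\<rfloor>
       \<or> (p \<le> p_crit n \<gamma> \<sigma> \<and>
          ((\<lfloor>2 - \<gamma> * (2 - min \<sigma> 1)\<rfloor> < int n \<and> n \<le> 2) \<or>
           (n > 2 \<and> (real n - 2) / real n \<le> \<gamma>)))
       \<or> (p < 1 / \<gamma> \<and> n \<ge> 3 \<and> \<gamma> < (real n - 2) / real n)"
  shows "\<not> (\<exists>u. global_weak_solution \<mu> \<sigma> \<gamma> p u0 u1 u)"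
proof
  assume "\<exists>u. global_weak_solution \<mu> \<sigma> \<gamma> p u0 u1 u"
  then obtain u where u: "\<And>T. 0 < T \<Longrightarrow> weak_solution \<mu> \<sigma> \<gamma> p u0 u1 T u"
    by (auto simp: global_weak_solution_def)
  have n: "1 \<le> n" by (simp add: n_def Suc_leI)
  obtain \<kappa> e where \<kappa>: "0 < \<kappa>" "e \<le> 2" "e \<le> 2 * \<kappa>" "e \<le> 1 + \<sigma> * \<kappa>"
    "1 + \<kappa> * real n \<le> ((1 - \<gamma>) + e) * (p / (p - 1))"
    using scaling_exponent_exists[OF assms(3,5,6,7) n assms(13)] .
  obtain k :: nat where "(2 + (1 - \<gamma>)) / (p - 1) \<le> real k"
    using real_arch_simple by blast
  then have k: "real k + 2 + (1 - \<gamma>) \<le> real k * p"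
    using assms(7) by (simp add: field_simps)
  define U where "U = (\<lambda>z. if 0 < fst z then u (fst z) (snd z) else 0)"
  have U: "U \<in> borel_measurable borel"
    unfolding U_def by (rule Lcurve_extension_measurable[of u 1 2]) (use u in \<open>auto simp: weak_solution_def\<close>)
  obtain \<Phi> W and L :: "real ^ 'n \<Rightarrow> real" and C B where TP: "test_profile \<sigma> \<Phi> W L C B"
    using test_profile_exists[OF assms(3,4), where 'a = "real ^ 'n"] by blast
  show False
  proof (rule test_profile.no_global_solution[OF TP, where \<mu> = \<mu> and \<gamma> = \<gamma> and p = p and \<alpha> = "1 - \<gamma>" and \<kappa> = \<kappa>
      and Bd = "3 powr (p / (p - 1))" and k = k and U = U and u = u and ?u0.0 = u0 and ?u1.0 = u1])
    show "(T powr (- (1 - \<gamma>)) * (T powr (- 2) + T powr (- 2 * \<kappa>) + T powr (- 1 - \<sigma> * \<kappa>))) powr (p / (p - 1)) *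
        (T * (T powr \<kappa>) ^ DIM(real ^ 'n)) \<le> 3 powr (p / (p - 1))" if "1 \<le> T" for T
      using scaling_growth[OF that assms(7) \<kappa>(2-5)] by (simp add: n_def)
    show "U (t, x) = u t x" if "0 < t" for t x using that by (simp add: U_def)
  qed (use assms u U k \<kappa>(1) in auto)
qed

end
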